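(* Let $\varphi(t,\mathbf x)$ and $\mathbf A(t,\mathbf x)$ be potentials defined and twice continuously differentiable in a domain $D\subset\mathbb R\times\mathbb R^3$, and let $\mathbf E=-\nabla\varphi-\frac1{\mathrm c}\partial_t\mathbf A$, $\mathbf B=\nabla\times\mathbf A$. Let $\hat{\mathbf r}:[T_-,T_+]\to\mathbb R^3$ be a trajectory with $(t,\hat{\mathbf r}(t))\in D$ for all $t\in[T_-,T_+]$, and let the limit potentials be the linear parts of $\varphi,\mathbf A$ at the trajectory: $$\varphi_\infty(t,\mathbf x)=\varphi(t,\hat{\mathbf r})+(\mathbf x-\hat{\mathbf r})\cdot\nabla\varphi(t,\hat{\mathbf r}),\qquad \mathbf A_\infty(t,\mathbf x)=\mathbf A(t,\hat{\mathbf r})+(\mathbf x-\hat{\mathbf r})\cdot\nabla\mathbf A(t,\hat{\mathbf r}).$$ Suppose that asymptotic solutions $\psi_n$ of the NLS equation concentrate at $\hat{\mathbf r}(t)$ (with these limit potentials). Then $\hat{\mathbf r}$ satisfies Newton's law $$m\,\partial_t^2\hat{\mathbf r}=q\,\mathbf E(t,\hat{\mathbf r})+\frac{q}{\mathrm c}\,\partial_t\hat{\mathbf r}\times\mathbf B(t,\hat{\mathbf r})\qquad\text{on }[T_-,T_+].$$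
   Context: **NLS equation and densities.** $m,q,\chi,\mathrm c>0$ are fixed constants. Given real $\varphi(t,\mathbf x)$ and $\mathbf A(t,\mathbf x)\in\mathbb R^3$ put $\tilde\partial_t=\partial_t+\frac{iq}{\chi}\varphi$, $\tilde\nabla=\nabla-\frac{iq}{\chi\mathrm c}\mathbf A$ (components $\tilde\partial_j$), $\tilde\partial_t^*=\partial_t-\frac{iq}{\chi}\varphi$, $\tilde\nabla^*=\nabla+\frac{iq}{\chi\mathrm c}\mathbf A$, $\mathbf E=-\nabla\varphi-\frac1{\mathrm c}\partial_t\mathbf A$, $\mathbf B=\nabla\times\mathbf A$. The NLS equation with size parameter $a>0$ is $i\tilde\partial_t\psi=\frac{\chi}{2m}\left[-\tilde\nabla^2\psi+G_a'(\psi^*\psi)\psi\right]$, where $\psi$ is complex valued, $G_a'(s)=a^{-2}G_1'(a^3s)$, $G_a(s)=\int_0^sG_a'(s')\,ds'$. Standing condition on the nonlinearity: $G_1'$ is real valued and continuous for $s>0$, it is the derivative of $G_1$, which is differentiable for $s>0$ and continuous for $s\ge0$; $\psi\mapsto G_1(\psi^*\psi)$ is differentiable on $\mathbb C$ with differential $g(\psi)\,d\psi^*+g^*(\psi)\,d\psi$, where $g(\psi)=G_1'(\psi^*\psi)\psi$ for $\psi\ne0$, $g(0)=0$, and $g$ is continuous on $\mathbb C$. Define $\rho=q\psi\psi^*$, $\mathbf J=-\frac{iq\chi}{2m}(\psi^*\tilde\nabla\psi-\psi\tilde\nabla^*\psi^* )$, $\mathbf P=\frac{i\chi}{2}(\psi\tilde\nabla^*\psi^*-\psi^*\tilde\nabla\psi)$,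 $\mathbf f=\rho\mathbf E+\frac1{\mathrm c}\mathbf J\times\mathbf B$, $u=\frac{\chi^2}{2m}\left[|\tilde\nabla\psi|^2+G_a(|\psi|^2)\right]$, and for $i,j\in\{1,2,3\}$: $T^{ij}=\frac{\chi^2}{2m}(\tilde\partial_i\psi\,\tilde\partial_j^*\psi^*+\tilde\partial_j\psi\,\tilde\partial_i^*\psi^* )$ if $i\ne j$; $T^{ii}=-u+\frac{\chi^2}{m}\tilde\partial_i\psi\,\tilde\partial_i^*\psi^*+\frac{i\chi}{2}(\psi^*\tilde\partial_t\psi-\psi\tilde\partial_t^*\psi^* )$ (no sum). **Trajectories and neighborhoods.** A trajectory is a $C^2$ function $\hat{\mathbf r}:[T_-,T_+]\to\mathbb R^3$ with bounded first and second derivatives; $\hat{\mathbf v}=\partial_t\hat{\mathbf r}$. For $R_n\to0$ let $\Omega_n=\Omega_n(t)=\{\mathbf x:|\mathbf x-\hat{\mathbf r}(t)|\le R_n\}$ and $\hat\Omega_n=\{(t,\mathbf x):T_-\le t\le T_+,\ \mathbf x\in\Omega_n(t)\}$; $\bar{\mathbf n}$ is the outer unit normal to $\partial\Omega_n$, $d\sigma$ surface measure. $C$ denotes constants independent of $n$; $\nabla_{0,\mathbf x}=(\frac1{\mathrm c}\partial_t,\nabla)$. **Localized NLS equations.** Sequences $a_n\to0$, $R_n\to0$ with $R_n/a_n\to\infty$, and potentials $\varphi_n,\mathbf A_n$ twice continuously differentiable in $\hat\Omega_n$. There are limit potentials, linear in $\mathbf x$: $\varphi_\infty(t,\mathbf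 x)=\varphi_\infty(t)+(\mathbf x-\hat{\mathbf r})\cdot\nabla\varphi_\infty(t)$, $\mathbf A_\infty(t,\mathbf x)=\mathbf A_\infty(t)+(\mathbf x-\hat{\mathbf r})\cdot\nabla\mathbf A_\infty(t)$, with $|\varphi_\infty|,|\nabla_{0,\mathbf x}\varphi_\infty|,|\mathbf A_\infty|,|\nabla_{0,\mathbf x}\mathbf A_\infty|\le C$ on the trajectory for $T_-\le t\le T_+$, such that $\max_{\hat\Omega_n}(|\varphi_n-\varphi_\infty|+|\nabla_{0,\mathbf x}\varphi_n-\nabla_{0,\mathbf x}\varphi_\infty|)\to0$, $\max_{\hat\Omega_n}(|\mathbf A_n-\mathbf A_\infty|+|\nabla_{0,\mathbf x}\mathbf A_n-\nabla_{0,\mathbf x}\mathbf A_\infty|)\to0$, and $|\varphi_n|,|\nabla_{0,\mathbf x}\varphi_n|,|\mathbf A_n|,|\nabla_{0,\mathbf x}\mathbf A_n|\le C$ in $\hat\Omega_n$. Put $\mathbf E_\infty(t)=-\nabla\varphi_\infty(t,\hat{\mathbf r})-\frac1{\mathrm c}\partial_t\mathbf A_\infty(t,\hat{\mathbf r})$, $\mathbf B_\infty(t)=\nabla\times\mathbf A_\infty(t,\hat{\mathbf r})$ (derivatives at fixed $\mathbf x$, evaluated at $\mathbf x=\hat{\mathbf r}(t)$). **Concentrating asymptotic solutions.** Asymptotic solutions $\psi_n$ of the NLS equation concentrate at $\hat{\mathbf r}$ if the condition on the nonlinearity holds, there are sequences $a_n\to0$, $R_n\to0$ with $R_n/a_n\to\infty$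 and potentials $\varphi_n,\mathbf A_n$ twice continuously differentiable in $\hat\Omega_n$, with limit potentials $\varphi_\infty,\mathbf A_\infty$ linear in $\mathbf x$ satisfying $|\varphi_\infty|,|\nabla_{0,\mathbf x}\varphi_\infty|,|\mathbf A_\infty|,|\nabla_{0,\mathbf x}\mathbf A_\infty|\le C$ on the trajectory for $T_-\le t\le T_+$, such that $\max_{\hat\Omega_n}(|\varphi_n-\varphi_\infty|+|\nabla_{0,\mathbf x}\varphi_n-\nabla_{0,\mathbf x}\varphi_\infty|)\to0$, $\max_{\hat\Omega_n}(|\mathbf A_n-\mathbf A_\infty|+|\nabla_{0,\mathbf x}\mathbf A_n-\nabla_{0,\mathbf x}\mathbf A_\infty|)\to0$ and $|\varphi_n|,|\nabla_{0,\mathbf x}\varphi_n|,|\mathbf A_n|,|\nabla_{0,\mathbf x}\mathbf A_n|\le C$ in $\hat\Omega_n$, and there are $\psi_n\in C^2(\hat\Omega_n)$ such that the following hold, where all densities are computed from $\psi_n,\varphi_n,\mathbf A_n,a_n$, $\bar\rho_n(t)=\int_{\Omega_n}\rho_n\,d\mathbf x$, and $\mathbf r=\mathbf r_n(t)=\frac1{\bar\rho_n}\int_{\Omega_n}\mathbf x\rho_n\,d\mathbf x$: (i$'$) There are perturbation terms $\rho',\mathbf J',\mathbf P',T^{ij\prime},\mathbf f'$ (depending on $n$) on $\hat\Omega_n$ such that $\partial_t\rho+\partial_t\rho'+\nabla\cdot\mathbf J+\nabla\cdot\mathbf J'=0$ and $\partial_t\mathbf P+\partial_t\mathbf P'+\partial_iT^{ij}+\partial_iT^{ij\prime}=\mathbf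 f+\mathbf f'$ in $\hat\Omega_n$ (component $j$, sum over $i$), and $Q_0',Q_2',Q_3'\to0$ uniformly on $[T_-,T_+]$, where $Q_0'=\int_{\Omega_n(t)}\mathbf P'(t)d\mathbf x-\int_{\Omega_n(t_0)}\mathbf P'(t_0)d\mathbf x-\int_{t_0}^t\int_{\partial\Omega_n}\mathbf P'\,\hat{\mathbf v}\cdot\bar{\mathbf n}\,d\sigma dt'+\int_{t_0}^t\int_{\Omega_n}\partial_iT^{ij\prime}d\mathbf xdt'-\int_{t_0}^t\int_{\Omega_n}\mathbf f'd\mathbf xdt'$, $Q_2'=\int_{\Omega_n}\partial_t((\mathbf x-\mathbf r)\rho')d\mathbf x+\partial_t\mathbf r\int_{\Omega_n}\rho'd\mathbf x+\int_{\partial\Omega_n}(\mathbf x-\mathbf r)\,\bar{\mathbf n}\cdot\mathbf J'd\sigma-\int_{\Omega_n}\mathbf J'd\mathbf x$, $Q_3'=\bar\rho'(t)-\bar\rho'(t_0)-\int_{t_0}^t\int_{\partial\Omega_n}\hat{\mathbf v}\cdot\bar{\mathbf n}\rho'd\sigma dt'+\int_{t_0}^t\int_{\partial\Omega_n}\bar{\mathbf n}\cdot\mathbf J'd\sigma dt'$, with $\bar\rho'=\int_{\Omega_n}\rho'd\mathbf x$. (ii) $\left|\int_{\Omega_n}\mathbf P_n(t)\,d\mathbf x\right|\le C$ for $T_-\le t\le T_+$. (iii) $C\ge\bar\rho_n(t)\ge c_0>0$ for $n\ge n_0$, $T_-\le t\le T_+$. (iv) There is $t_0\in[T_-,T_+]$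 with $\bar\rho_n(t_0)\to\bar\rho_\infty$. (v) Uniformly on $[T_-,T_+]$ the following tend to $0$: $Q_0=\int_{t_0}^t\int_{\partial\Omega_n}\bar{\mathbf n}_iT^{ij}d\sigma dt'$; $Q_{01}=\int_{t_0}^t\int_{\partial\Omega_n}\mathbf P\,\hat{\mathbf v}\cdot\bar{\mathbf n}\,d\sigma dt'$; $Q_{20}=-\int_{\partial\Omega_n}(\mathbf x-\mathbf r)\hat{\mathbf v}\cdot\bar{\mathbf n}\,\rho\,d\sigma$; $Q_{22}=\int_{\partial\Omega_n}(\mathbf x-\mathbf r)\bar{\mathbf n}\cdot\mathbf J\,d\sigma$; $Q_{23}=\int_{t_0}^t\int_{\partial\Omega_n}\hat{\mathbf v}\cdot\bar{\mathbf n}\,\rho\,d\sigma dt'-\int_{t_0}^t\int_{\partial\Omega_n}\bar{\mathbf n}\cdot\mathbf J\,d\sigma dt'$. (vi) With $Q_{30}=\int_{\Omega_n}(\mathbf E-\mathbf E_\infty)\rho\,d\mathbf x$ and $Q_{31}=\int_{\Omega_n}\frac1{\mathrm c}\mathbf J\times(\mathbf B-\mathbf B_\infty)\,d\mathbf x$, $\int_{t_0}^t(Q_{30}+Q_{31})dt'\to0$ uniformly on $[T_-,T_+]$. *)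

theory Defs
  imports "HOL-Analysis.Analysis"
begin

text \<open>Fields are total functions of a space-time point \<open>(t, x)\<close>; only their values on the relevant
  domain matter.\<close>

type_synonym spacetime = "real \<times> (real^3)"

text \<open>
  Partial derivatives on a set \<open>S\<close> of space-time points are taken from the Frechet derivative
  within \<open>S\<close>.  The sets used are open sets, the slab over \<open>[Tm, Tp]\<close> and the closed tube around a
  trajectory.  In each of them the derivative within the set is unique (for \<open>Tm < Tp\<close> and positive
  radius), also at boundary points, where it is the one-sided derivative.
\<close>

definition dt :: "spacetime set \<Rightarrow> (spacetime \<Rightarrow> 'b) \<Rightarrow> spacetime \<Rightarrow> 'b::real_normed_vector" where
  "dt S f p = frechet_derivative f (at p within S) (1, 0)"

definition dx :: "spacetime set \<Rightarrow> 3 \<Rightarrow> (spacetime \<Rightarrow> 'b) \<Rightarrow> spacetime \<Rightarrow> 'b::real_normed_vector" where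
  "dx S i f p = frechet_derivative f (at p within S) (0, axis i 1)"

text \<open>For a vector field the entry \<open>grad S F p $ i $ j\<close> is \<open>\<partial>\<^sub>i F\<^sub>j\<close>.\<close>

definition grad :: "spacetime set \<Rightarrow> (spacetime \<Rightarrow> 'b) \<Rightarrow> spacetime \<Rightarrow> ('b::real_normed_vector)^3" where
  "grad S f p = (\<chi> i. dx S i f p)"

definition divergence :: "spacetime set \<Rightarrow> (spacetime \<Rightarrow> real^3) \<Rightarrow> spacetime \<Rightarrow> real" where
  "divergence S F p = (\<Sum>i\<in>UNIV. dx S i F p $ i)"

definition tensor_divergence ::
    "spacetime set \<Rightarrow> (3 \<Rightarrow> 3 \<Rightarrow> spacetime \<Rightarrow> real) \<Rightarrow> spacetime \<Rightarrow> real^3" where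
  "tensor_divergence S T p = (\<chi> j. \<Sum>i\<in>UNIV. dx S i (T i j) p)"

definition curl :: "spacetime set \<Rightarrow> (spacetime \<Rightarrow> real^3) \<Rightarrow> spacetime \<Rightarrow> real^3" where
  "curl S F p = vector
     [dx S 2 F p $ 3 - dx S 3 F p $ 2,
      dx S 3 F p $ 1 - dx S 1 F p $ 3,
      dx S 1 F p $ 2 - dx S 2 F p $ 1]"

definition C1_on :: "spacetime set \<Rightarrow> (spacetime \<Rightarrow> 'b::real_normed_vector) \<Rightarrow> bool" where
  "C1_on S f \<longleftrightarrow> f differentiable_on S \<and> continuous_on S (dt S f) \<and>
     (\<forall>i. continuous_on S (dx S i f))"

definition C2_on :: "spacetime set \<Rightarrow> (spacetime \<Rightarrow> 'b::real_normed_vector) \<Rightarrow> bool" where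
  "C2_on S f \<longleftrightarrow> C1_on S f \<and> C1_on S (dt S f) \<and> (\<forall>i. C1_on S (dx S i f))"

definition vel :: "real \<Rightarrow> real \<Rightarrow> (real \<Rightarrow> real^3) \<Rightarrow> real \<Rightarrow> real^3" where
  "vel Tm Tp r t = vector_derivative r (at t within {Tm..Tp})"

definition acc :: "real \<Rightarrow> real \<Rightarrow> (real \<Rightarrow> real^3) \<Rightarrow> real \<Rightarrow> real^3" where
  "acc Tm Tp r t = vector_derivative (vel Tm Tp r) (at t within {Tm..Tp})"

definition trajectory :: "real \<Rightarrow> real \<Rightarrow> (real \<Rightarrow> real^3) \<Rightarrow> bool" where
  "trajectory Tm Tp r \<longleftrightarrow>
     r differentiable_on {Tm..Tp} \<and> vel Tm Tp r differentiable_on {Tm..Tp} \<and>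
     continuous_on {Tm..Tp} (acc Tm Tp r) \<and>
     bounded (vel Tm Tp r ` {Tm..Tp}) \<and> bounded (acc Tm Tp r ` {Tm..Tp})"

definition slab :: "real \<Rightarrow> real \<Rightarrow> spacetime set" where
  "slab Tm Tp = {Tm..Tp} \<times> UNIV"

definition tube :: "real \<Rightarrow> real \<Rightarrow> (real \<Rightarrow> real^3) \<Rightarrow> real \<Rightarrow> spacetime set" where
  "tube Tm Tp r R = {(t, x). Tm \<le> t \<and> t \<le> Tp \<and> norm (x - r t) \<le> R}"

definition unit_normal :: "(real \<Rightarrow> real^3) \<Rightarrow> real \<Rightarrow> spacetime \<Rightarrow> real^3" where
  "unit_normal r R p = (1 / R) *\<^sub>R (snd p - r (fst p))"

text \<open>The surface integral over a sphere in spherical coordinates, with area element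
  \<open>R\<^sup>2 sin \<theta> d\<theta> d\<phi>\<close>.\<close>

definition sphere_point :: "real \<Rightarrow> real \<Rightarrow> real^3" where
  "sphere_point \<theta> \<phi> = vector [sin \<theta> * cos \<phi>, sin \<theta> * sin \<phi>, cos \<theta>]"

definition sphere_integral ::
    "real^3 \<Rightarrow> real \<Rightarrow> (real^3 \<Rightarrow> 'b) \<Rightarrow> 'b::{banach, second_countable_topology}" where
  "sphere_integral z R f =
     (LBINT \<theta>=ereal 0..ereal pi. (LBINT \<phi>=ereal 0..ereal (2 * pi).
        (R\<^sup>2 * sin \<theta>) *\<^sub>R f (z + R *\<^sub>R sphere_point \<theta> \<phi>)))"

definition ball_int ::
    "(real \<Rightarrow> real^3) \<Rightarrow> real \<Rightarrow> (spacetime \<Rightarrow> 'b) \<Rightarrow> real \<Rightarrow> 'b::{banach, second_countable_topology}" where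
  "ball_int r R f t = (LINT x:cball (r t) R|lborel. f (t, x))"

definition bdry_int ::
    "(real \<Rightarrow> real^3) \<Rightarrow> real \<Rightarrow> (spacetime \<Rightarrow> 'b) \<Rightarrow> real \<Rightarrow> 'b::{banach, second_countable_topology}" where
  "bdry_int r R f t = sphere_integral (r t) R (\<lambda>x. f (t, x))"

text \<open>The time integral is oriented: it changes sign if \<open>t < t0\<close>.\<close>

definition time_int :: "real \<Rightarrow> (real \<Rightarrow> 'b) \<Rightarrow> real \<Rightarrow> 'b::{banach, second_countable_topology}" where
  "time_int t0 g t = (LBINT s=ereal t0..ereal t. g s)"

definition charge_center ::
    "(real \<Rightarrow> real^3) \<Rightarrow> real \<Rightarrow> (spacetime \<Rightarrow> real) \<Rightarrow> real \<Rightarrow> real^3" where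
  "charge_center r R \<rho> t = (1 / ball_int r R \<rho> t) *\<^sub>R ball_int r R (\<lambda>p. \<rho> p *\<^sub>R snd p) t"

text \<open>\<open>vanishes_uniformly S F\<close> says that the supremum of \<open>norm (F n)\<close> over \<open>S n\<close> tends to 0; the sets
  may vary with \<open>n\<close>.\<close>

definition vanishes_uniformly ::
    "(nat \<Rightarrow> 'p set) \<Rightarrow> (nat \<Rightarrow> 'p \<Rightarrow> 'b::real_normed_vector) \<Rightarrow> bool" where
  "vanishes_uniformly S F \<longleftrightarrow> (\<forall>\<epsilon>>0. \<forall>\<^sub>F n in sequentially. \<forall>p\<in>S n. norm (F n p) < \<epsilon>)"

definition linear_part ::
    "spacetime set \<Rightarrow> (real \<Rightarrow> real^3) \<Rightarrow> (spacetime \<Rightarrow> 'b) \<Rightarrow> spacetime \<Rightarrow> 'b::real_normed_vector" where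
  "linear_part S r F p = (let t = fst p; x = snd p in
     F (t, r t) + (\<Sum>i\<in>UNIV. (x - r t) $ i *\<^sub>R grad S F (t, r t) $ i))"

definition linear_in_space ::
    "real \<Rightarrow> real \<Rightarrow> (real \<Rightarrow> real^3) \<Rightarrow> (spacetime \<Rightarrow> 'b::real_normed_vector) \<Rightarrow> bool" where
  "linear_in_space Tm Tp r F \<longleftrightarrow>
     (\<exists>(F0 :: real \<Rightarrow> 'b) (F1 :: real \<Rightarrow> 'b^3). \<forall>t\<in>{Tm..Tp}. \<forall>x.
        F (t, x) = F0 t + (\<Sum>i\<in>UNIV. (x - r t) $ i *\<^sub>R F1 t $ i))"

text \<open>
  The constants of the NLS equation are the mass \<open>m\<close>, the charge \<open>q\<close>, the constant \<open>chi\<close> and the speed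
  of light \<open>c\<close>; the nonlinearity is given by \<open>G1\<close> and its derivative \<open>G1'\<close>.  The densities below are
  given by real-valued complex expressions; \<open>Re\<close> only changes the type.
\<close>

locale nls =
  fixes m q chi c :: real and G1 G1' :: "real \<Rightarrow> real"
begin

definition nl_g :: "complex \<Rightarrow> complex" where
  "nl_g z = (if z = 0 then 0 else complex_of_real (G1' ((cmod z)\<^sup>2)) * z)"

definition nonlinearity_condition :: bool where
  "nonlinearity_condition \<longleftrightarrow>
     continuous_on {0<..} G1' \<and>
     (\<forall>s>0. (G1 has_real_derivative G1' s) (at s)) \<and>
     continuous_on {0..} G1 \<and>
     (\<forall>z. ((\<lambda>z. complex_of_real (G1 ((cmod z)\<^sup>2))) has_derivative
            (\<lambda>h. nl_g z * cnj h + cnj (nl_g z) * h)) (at z)) \<and>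
     continuous_on UNIV nl_g"

definition Ga' :: "real \<Rightarrow> real \<Rightarrow> real" where
  "Ga' a s = G1' (a ^ 3 * s) / a\<^sup>2"

definition Ga :: "real \<Rightarrow> real \<Rightarrow> real" where
  "Ga a s = (LBINT s'=ereal 0..ereal s. Ga' a s')"

text \<open>The derivative \<open>\<nabla>\<^sub>0\<^sub>,\<^sub>x = ((1/c) \<partial>\<^sub>t, \<nabla>)\<close>.\<close>

definition grad0 ::
    "spacetime set \<Rightarrow> (spacetime \<Rightarrow> 'b) \<Rightarrow> spacetime \<Rightarrow> 'b::real_normed_vector \<times> ('b^3)" where
  "grad0 S f p = ((1 / c) *\<^sub>R dt S f p, grad S f p)"

definition Efield ::
    "spacetime set \<Rightarrow> (spacetime \<Rightarrow> real) \<Rightarrow> (spacetime \<Rightarrow> real^3) \<Rightarrow> spacetime \<Rightarrow> real^3" where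
  "Efield S \<phi> A p = - grad S \<phi> p - (1 / c) *\<^sub>R dt S A p"

definition Bfield :: "spacetime set \<Rightarrow> (spacetime \<Rightarrow> real^3) \<Rightarrow> spacetime \<Rightarrow> real^3" where
  "Bfield S A p = curl S A p"

text \<open>Covariant derivatives and, with suffix \<open>star\<close>, their conjugates.\<close>

definition cov_t :: "spacetime set \<Rightarrow> (spacetime \<Rightarrow> real) \<Rightarrow> (spacetime \<Rightarrow> complex) \<Rightarrow> spacetime \<Rightarrow> complex" where
  "cov_t S \<phi> f p = dt S f p + \<i> * complex_of_real (q / chi * \<phi> p) * f p"

definition cov_t_star :: "spacetime set \<Rightarrow> (spacetime \<Rightarrow> real) \<Rightarrow> (spacetime \<Rightarrow> complex) \<Rightarrow> spacetime \<Rightarrow> complex" where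
  "cov_t_star S \<phi> f p = dt S f p - \<i> * complex_of_real (q / chi * \<phi> p) * f p"

definition cov_x :: "spacetime set \<Rightarrow> (spacetime \<Rightarrow> real^3) \<Rightarrow> 3 \<Rightarrow> (spacetime \<Rightarrow> complex) \<Rightarrow> spacetime \<Rightarrow> complex" where
  "cov_x S A j f p = dx S j f p - \<i> * complex_of_real (q / (chi * c) * A p $ j) * f p"

definition cov_x_star :: "spacetime set \<Rightarrow> (spacetime \<Rightarrow> real^3) \<Rightarrow> 3 \<Rightarrow> (spacetime \<Rightarrow> complex) \<Rightarrow> spacetime \<Rightarrow> complex" where
  "cov_x_star S A j f p = dx S j f p + \<i> * complex_of_real (q / (chi * c) * A p $ j) * f p"

definition charge_density :: "(spacetime \<Rightarrow> complex) \<Rightarrow> spacetime \<Rightarrow> real" where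
  "charge_density \<psi> p = Re (complex_of_real q * \<psi> p * cnj (\<psi> p))"

definition current_density ::
    "spacetime set \<Rightarrow> (spacetime \<Rightarrow> real^3) \<Rightarrow> (spacetime \<Rightarrow> complex) \<Rightarrow> spacetime \<Rightarrow> real^3" where
  "current_density S A \<psi> p = (\<chi> j. Re (- (\<i> * complex_of_real (q * chi / (2 * m))) *
     (cnj (\<psi> p) * cov_x S A j \<psi> p - \<psi> p * cov_x_star S A j (\<lambda>p. cnj (\<psi> p)) p)))"

definition momentum_density ::
    "spacetime set \<Rightarrow> (spacetime \<Rightarrow> real^3) \<Rightarrow> (spacetime \<Rightarrow> complex) \<Rightarrow> spacetime \<Rightarrow> real^3" where
  "momentum_density S A \<psi> p = (\<chi> j. Re (\<i> * complex_of_real (chi / 2) *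
     (\<psi> p * cov_x_star S A j (\<lambda>p. cnj (\<psi> p)) p - cnj (\<psi> p) * cov_x S A j \<psi> p)))"

definition lorentz_force ::
    "spacetime set \<Rightarrow> (spacetime \<Rightarrow> real) \<Rightarrow> (spacetime \<Rightarrow> real^3) \<Rightarrow> (spacetime \<Rightarrow> complex) \<Rightarrow> spacetime \<Rightarrow> real^3" where
  "lorentz_force S \<phi> A \<psi> p = charge_density \<psi> p *\<^sub>R Efield S \<phi> A p +
     (1 / c) *\<^sub>R cross3 (current_density S A \<psi> p) (Bfield S A p)"

definition u_density ::
    "real \<Rightarrow> spacetime set \<Rightarrow> (spacetime \<Rightarrow> real^3) \<Rightarrow> (spacetime \<Rightarrow> complex) \<Rightarrow> spacetime \<Rightarrow> real" where
  "u_density a S A \<psi> p = chi\<^sup>2 / (2 * m) *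
     ((\<Sum>j\<in>UNIV. (cmod (cov_x S A j \<psi> p))\<^sup>2) + Ga a ((cmod (\<psi> p))\<^sup>2))"

definition stress_tensor ::
    "real \<Rightarrow> spacetime set \<Rightarrow> (spacetime \<Rightarrow> real) \<Rightarrow> (spacetime \<Rightarrow> real^3) \<Rightarrow> (spacetime \<Rightarrow> complex) \<Rightarrow>
     3 \<Rightarrow> 3 \<Rightarrow> spacetime \<Rightarrow> real" where
  "stress_tensor a S \<phi> A \<psi> i j p =
     (let \<psi>s = (\<lambda>p. cnj (\<psi> p)) in
      if i \<noteq> j then
        Re (complex_of_real (chi\<^sup>2 / (2 * m)) *
          (cov_x S A i \<psi> p * cov_x_star S A j \<psi>s p + cov_x S A j \<psi> p * cov_x_star S A i \<psi>s p))
      else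
        Re (- complex_of_real (u_density a S A \<psi> p)
          + complex_of_real (chi\<^sup>2 / m) * (cov_x S A i \<psi> p * cov_x_star S A i \<psi>s p)
          + \<i> * complex_of_real (chi / 2) *
              (cnj (\<psi> p) * cov_t S \<phi> \<psi> p - \<psi> p * cov_t_star S \<phi> \<psi>s p)))"

definition localized_potentials ::
    "real \<Rightarrow> real \<Rightarrow> (real \<Rightarrow> real^3) \<Rightarrow> (nat \<Rightarrow> real) \<Rightarrow>
     (nat \<Rightarrow> spacetime \<Rightarrow> real) \<Rightarrow> (nat \<Rightarrow> spacetime \<Rightarrow> real^3) \<Rightarrow>
     (spacetime \<Rightarrow> real) \<Rightarrow> (spacetime \<Rightarrow> real^3) \<Rightarrow> bool" where
  "localized_potentials Tm Tp r R \<phi> A \<phi>inf Ainf \<longleftrightarrow>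
     (let S = (\<lambda>n. tube Tm Tp r (R n)); S0 = slab Tm Tp in
      (\<forall>n. C2_on (S n) (\<phi> n) \<and> C2_on (S n) (A n)) \<and>
      linear_in_space Tm Tp r \<phi>inf \<and> \<phi>inf differentiable_on S0 \<and>
      linear_in_space Tm Tp r Ainf \<and> Ainf differentiable_on S0 \<and>
      (\<exists>C. \<forall>t\<in>{Tm..Tp}.
         \<bar>\<phi>inf (t, r t)\<bar> \<le> C \<and> norm (grad0 S0 \<phi>inf (t, r t)) \<le> C \<and>
         norm (Ainf (t, r t)) \<le> C \<and> norm (grad0 S0 Ainf (t, r t)) \<le> C) \<and>
      vanishes_uniformly S (\<lambda>n p. \<bar>\<phi> n p - \<phi>inf p\<bar> + norm (grad0 (S n) (\<phi> n) p - grad0 S0 \<phi>inf p)) \<and>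
      vanishes_uniformly S (\<lambda>n p. norm (A n p - Ainf p) + norm (grad0 (S n) (A n) p - grad0 S0 Ainf p)) \<and>
      (\<exists>C. \<forall>n. \<forall>p\<in>S n.
         \<bar>\<phi> n p\<bar> \<le> C \<and> norm (grad0 (S n) (\<phi> n) p) \<le> C \<and>
         norm (A n p) \<le> C \<and> norm (grad0 (S n) (A n) p) \<le> C))"

text \<open>
  The perturbation terms are continuously differentiable on the closed tube, so that the
  conservation laws and all integrals have their classical meaning; \<open>f'\<close> is then continuous by the
  momentum law.
\<close>

definition perturbed_conservation_laws ::
    "real \<Rightarrow> real \<Rightarrow> (real \<Rightarrow> real^3) \<Rightarrow> (nat \<Rightarrow> real) \<Rightarrow> real \<Rightarrow>
     (nat \<Rightarrow> spacetime \<Rightarrow> real) \<Rightarrow> (nat \<Rightarrow> spacetime \<Rightarrow> real^3) \<Rightarrow> (nat \<Rightarrow> spacetime \<Rightarrow> real^3) \<Rightarrow>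
     (nat \<Rightarrow> 3 \<Rightarrow> 3 \<Rightarrow> spacetime \<Rightarrow> real) \<Rightarrow> (nat \<Rightarrow> spacetime \<Rightarrow> real^3) \<Rightarrow> bool" where
  "perturbed_conservation_laws Tm Tp r R t0 \<rho> J P T f \<longleftrightarrow>
     (\<exists>(\<rho>' :: nat \<Rightarrow> spacetime \<Rightarrow> real) (J' :: nat \<Rightarrow> spacetime \<Rightarrow> real^3)
       (P' :: nat \<Rightarrow> spacetime \<Rightarrow> real^3) (T' :: nat \<Rightarrow> 3 \<Rightarrow> 3 \<Rightarrow> spacetime \<Rightarrow> real)
       (f' :: nat \<Rightarrow> spacetime \<Rightarrow> real^3).
      let S = (\<lambda>n. tube Tm Tp r (R n));
          vn = (\<lambda>n p. vel Tm Tp r (fst p) \<bullet> unit_normal r (R n) p);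
          nJ' = (\<lambda>n p. unit_normal r (R n) p \<bullet> J' n p);
          rc = (\<lambda>n. charge_center r (R n) (\<rho> n));
          Q0' = (\<lambda>n t.
              ball_int r (R n) (P' n) t - ball_int r (R n) (P' n) t0
            - time_int t0 (bdry_int r (R n) (\<lambda>p. vn n p *\<^sub>R P' n p)) t
            + time_int t0 (ball_int r (R n) (tensor_divergence (S n) (T' n))) t
            - time_int t0 (ball_int r (R n) (f' n)) t);
          Q2' = (\<lambda>n t.
              ball_int r (R n) (dt (S n) (\<lambda>p. \<rho>' n p *\<^sub>R (snd p - rc n (fst p)))) t
            + ball_int r (R n) (\<rho>' n) t *\<^sub>R vel Tm Tp (rc n) t
            + bdry_int r (R n) (\<lambda>p. nJ' n p *\<^sub>R (snd p - rc n (fst p))) t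
            - ball_int r (R n) (J' n) t);
          Q3' = (\<lambda>n t.
              ball_int r (R n) (\<rho>' n) t - ball_int r (R n) (\<rho>' n) t0
            - time_int t0 (bdry_int r (R n) (\<lambda>p. vn n p * \<rho>' n p)) t
            + time_int t0 (bdry_int r (R n) (nJ' n)) t)
      in
        (\<forall>n. C1_on (S n) (\<rho>' n) \<and> C1_on (S n) (J' n) \<and> C1_on (S n) (P' n) \<and>
             (\<forall>i j. C1_on (S n) (T' n i j))) \<and>
        (\<forall>n. \<forall>p\<in>S n.
           dt (S n) (\<rho> n) p + dt (S n) (\<rho>' n) p
             + divergence (S n) (J n) p + divergence (S n) (J' n) p = 0) \<and>
        (\<forall>n. \<forall>p\<in>S n.
           dt (S n) (P n) p + dt (S n) (P' n) p
             + tensor_divergence (S n) (T n) p + tensor_divergence (S n) (T' n) p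
             = f n p + f' n p) \<and>
        uniform_limit {Tm..Tp} Q0' (\<lambda>_. 0) sequentially \<and>
        uniform_limit {Tm..Tp} Q2' (\<lambda>_. 0) sequentially \<and>
        uniform_limit {Tm..Tp} Q3' (\<lambda>_. 0) sequentially)"

definition boundary_terms_vanish ::
    "real \<Rightarrow> real \<Rightarrow> (real \<Rightarrow> real^3) \<Rightarrow> (nat \<Rightarrow> real) \<Rightarrow> real \<Rightarrow>
     (nat \<Rightarrow> spacetime \<Rightarrow> real) \<Rightarrow> (nat \<Rightarrow> spacetime \<Rightarrow> real^3) \<Rightarrow> (nat \<Rightarrow> spacetime \<Rightarrow> real^3) \<Rightarrow>
     (nat \<Rightarrow> 3 \<Rightarrow> 3 \<Rightarrow> spacetime \<Rightarrow> real) \<Rightarrow> bool" where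
  "boundary_terms_vanish Tm Tp r R t0 \<rho> J P T \<longleftrightarrow>
     (let vn = (\<lambda>n p. vel Tm Tp r (fst p) \<bullet> unit_normal r (R n) p);
          nJ = (\<lambda>n p. unit_normal r (R n) p \<bullet> J n p);
          rc = (\<lambda>n. charge_center r (R n) (\<rho> n));
          Q0 = (\<lambda>n t. time_int t0 (bdry_int r (R n)
                 (\<lambda>p. (\<chi> j. \<Sum>i\<in>UNIV. unit_normal r (R n) p $ i * T n i j p) :: real^3)) t);
          Q01 = (\<lambda>n t. time_int t0 (bdry_int r (R n) (\<lambda>p. vn n p *\<^sub>R P n p)) t);
          Q20 = (\<lambda>n t. - bdry_int r (R n) (\<lambda>p. (vn n p * \<rho> n p) *\<^sub>R (snd p - rc n (fst p))) t);
          Q22 = (\<lambda>n t. bdry_int r (R n) (\<lambda>p. nJ n p *\<^sub>R (snd p - rc n (fst p))) t);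
          Q23 = (\<lambda>n t. time_int t0 (bdry_int r (R n) (\<lambda>p. vn n p * \<rho> n p)) t
                      - time_int t0 (bdry_int r (R n) (nJ n)) t)
      in
        uniform_limit {Tm..Tp} Q0 (\<lambda>_. 0) sequentially \<and>
        uniform_limit {Tm..Tp} Q01 (\<lambda>_. 0) sequentially \<and>
        uniform_limit {Tm..Tp} Q20 (\<lambda>_. 0) sequentially \<and>
        uniform_limit {Tm..Tp} Q22 (\<lambda>_. 0) sequentially \<and>
        uniform_limit {Tm..Tp} Q23 (\<lambda>_. 0) sequentially)"

text \<open>
  \<open>asymptotic_solutions_concentrate Tm Tp r \<phi>inf Ainf \<psi>\<close>: the \<open>\<psi> n\<close> are asymptotic solutions which
  concentrate at the trajectory \<open>r\<close>, with limit potentials \<open>\<phi>inf\<close> and \<open>Ainf\<close>.  Being an asymptotic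
  solution means that the charge and momentum conservation laws of the NLS equation hold up to
  perturbation terms; the NLS equation itself is not imposed.
\<close>

definition asymptotic_solutions_concentrate ::
    "real \<Rightarrow> real \<Rightarrow> (real \<Rightarrow> real^3) \<Rightarrow> (spacetime \<Rightarrow> real) \<Rightarrow> (spacetime \<Rightarrow> real^3) \<Rightarrow>
     (nat \<Rightarrow> spacetime \<Rightarrow> complex) \<Rightarrow> bool" where
  "asymptotic_solutions_concentrate Tm Tp r \<phi>inf Ainf \<psi> \<longleftrightarrow>
     nonlinearity_condition \<and>
     (\<exists>(a :: nat \<Rightarrow> real) (R :: nat \<Rightarrow> real)
       (\<phi> :: nat \<Rightarrow> spacetime \<Rightarrow> real) (A :: nat \<Rightarrow> spacetime \<Rightarrow> real^3).
      let S = (\<lambda>n. tube Tm Tp r (R n));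
          \<rho> = (\<lambda>n. charge_density (\<psi> n));
          J = (\<lambda>n. current_density (S n) (A n) (\<psi> n));
          P = (\<lambda>n. momentum_density (S n) (A n) (\<psi> n));
          T = (\<lambda>n. stress_tensor (a n) (S n) (\<phi> n) (A n) (\<psi> n));
          f = (\<lambda>n. lorentz_force (S n) (\<phi> n) (A n) (\<psi> n));
          Einf = (\<lambda>t. Efield (slab Tm Tp) \<phi>inf Ainf (t, r t));
          Binf = (\<lambda>t. Bfield (slab Tm Tp) Ainf (t, r t));
          Q30 = (\<lambda>n. ball_int r (R n)
            (\<lambda>p. \<rho> n p *\<^sub>R (Efield (S n) (\<phi> n) (A n) p - Einf (fst p))));
          Q31 = (\<lambda>n. ball_int r (R n)
            (\<lambda>p. (1 / c) *\<^sub>R cross3 (J n p) (Bfield (S n) (A n) p - Binf (fst p))))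
      in
        (\<forall>n. 0 < a n) \<and> (\<forall>n. 0 < R n) \<and>
        a \<longlonglongrightarrow> 0 \<and> R \<longlonglongrightarrow> 0 \<and> filterlim (\<lambda>n. R n / a n) at_top sequentially \<and>
        localized_potentials Tm Tp r R \<phi> A \<phi>inf Ainf \<and>
        (\<forall>n. C2_on (S n) (\<psi> n)) \<and>
        (\<exists>C. \<forall>n. \<forall>t\<in>{Tm..Tp}. norm (ball_int r (R n) (P n) t) \<le> C) \<and>
        (\<exists>C. \<exists>c0>0. \<exists>n0. \<forall>n\<ge>n0. \<forall>t\<in>{Tm..Tp}.
            c0 \<le> ball_int r (R n) (\<rho> n) t \<and> ball_int r (R n) (\<rho> n) t \<le> C) \<and>
        (\<exists>t0\<in>{Tm..Tp}. \<exists>\<rho>inf.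
           (\<lambda>n. ball_int r (R n) (\<rho> n) t0) \<longlonglongrightarrow> \<rho>inf \<and>
           perturbed_conservation_laws Tm Tp r R t0 \<rho> J P T f \<and>
           boundary_terms_vanish Tm Tp r R t0 \<rho> J P T \<and>
           uniform_limit {Tm..Tp} (\<lambda>n. time_int t0 (\<lambda>s. Q30 n s + Q31 n s)) (\<lambda>_. 0) sequentially))"

end

end

theory Submission
  imports Defs
begin


text \<open>
  The conservation laws are integrated over the shrinking ball around \<open>r t\<close>, and the limit of the
  resulting equations of motion of the ball is taken.  Let \<open>\<rho>b\<close> and \<open>p\<close> be the charge and the momentum
  in the ball and \<open>x\<close> its charge center.  Because \<open>J = (q/m) P\<close>, three identities hold exactly:

    \<^item> \<open>\<rho>b t - \<rho>b t0 = Q23 - Q3'\<close> (\<open>charge_balance\<close>);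
    \<^item> \<open>p t - p t0\<close> is the time integral of the total Lorentz force plus \<open>Q01 - Q0 - Q0'\<close>
      (\<open>momentum_balance\<close>), and the total force is \<open>\<rho>b E + (q / (m c)) p \<times> B + Q30 + Q31\<close> with the limit
      fields \<open>E\<close>, \<open>B\<close> at \<open>r t\<close> (\<open>total_lorentz_force\<close>);
    \<^item> \<open>\<rho>b x' = (q/m) p - Q22 - Q20 - Q2'\<close> (\<open>charge_center_motion\<close>).

  They follow from the transport theorem for the moving ball (\<open>reynolds\<close>) and from the divergence
  theorem on a ball (\<open>integral_cball_directional_derivative\<close>), both with the surface integral taken in
  spherical coordinates.

  The remainders vanish uniformly.  Hence \<open>\<rho>b\<close> tends uniformly to a positive constant \<open>\<rho>inf\<close>,
  and \<open>p\<close> differs from \<open>(m/q) \<rho>inf x'\<close> by a uniformly vanishing term.  The center \<open>x\<close> lies in the ball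
  and so tends uniformly to \<open>r\<close>, which makes \<open>x'\<close> converge to \<open>r'\<close> only weakly.  This is enough: the
  force is affine in the velocity, and \<open>B\<close> is continuously differentiable along the trajectory, so
  integration by parts gives the limit of the time integral of \<open>x' \<times> B\<close>.  Thus \<open>\<rho>inf x'\<close> is, up to a
  uniformly vanishing term, \<open>(q/m) (p t0 + F)\<close> with \<open>F\<close> the time integral of
  \<open>\<rho>inf E + (\<rho>inf / c) r' \<times> B\<close>.  One more integration in time shows that \<open>p t0\<close> converges, and then
  that \<open>\<rho>inf r' = (q/m) (p0 + F)\<close>; differentiating this gives Newton's law (\<open>newton_limit\<close>).
\<close>

section \<open>Spherical coordinates\<close>

text \<open>The identification of triples with vectors, which carries the product structure needed for
  Fubini's theorem over to \<open>real^3\<close>.\<close>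

definition vec3 :: "real \<times> real \<times> real \<Rightarrow> real^3" where
  "vec3 p = vector [fst p, fst (snd p), snd (snd p)]"

lemma vec3_nth [simp]:
  "vec3 p $ 1 = fst p" "vec3 p $ 2 = fst (snd p)" "vec3 p $ 3 = snd (snd p)"
  by (simp_all add: vec3_def)

lemma linear_vec3: "linear vec3"
  by (rule linearI) (auto simp: vec_eq_iff forall_3)

lemma continuous_on_vec3 [continuous_intros]:
  "continuous_on S f \<Longrightarrow> continuous_on S (\<lambda>x. vec3 (f x))"
  using continuous_on_compose2[OF linear_continuous_on[OF linear_vec3[unfolded linear_conv_bounded_linear], of UNIV]]
  by simp

lemma Basis_vec3: "(Basis :: (real^3) set) = {axis 1 1, axis 2 1, axis 3 1}"
  by (auto simp: Basis_vec_def UNIV_3)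

lemma mem_box_vec3: "x \<in> box l u \<longleftrightarrow>
    l $ 1 < x $ 1 \<and> x $ 1 < u $ 1 \<and> l $ 2 < x $ 2 \<and> x $ 2 < u $ 2 \<and> l $ 3 < x $ 3 \<and> x $ 3 < u $ 3"
  for x :: "real^3"
  by (simp add: mem_box Basis_vec3 inner_axis)

lemma Basis_triple: "(Basis :: (real \<times> real \<times> real) set) = {(1,0,0), (0,1,0), (0,0,1)}"
  by (auto simp: Basis_prod_def zero_prod_def)

lemma mem_box_triple: "x \<in> box l u \<longleftrightarrow>
    fst l < fst x \<and> fst x < fst u \<and> fst (snd l) < fst (snd x) \<and> fst (snd x) < fst (snd u) \<and>
    snd (snd l) < snd (snd x) \<and> snd (snd x) < snd (snd u)"
  for x :: "real \<times> real \<times> real"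
  by (cases x; cases l; cases u) (simp add: mem_box Basis_triple)

lemma prod_Basis_triple:
  "(\<Prod>b\<in>Basis. f b) = f (1,0,0) * f (0,1,0) * f (0,0,1::real) "
  for f :: "real \<times> real \<times> real \<Rightarrow> 'a::comm_monoid_mult"
  by (simp add: Basis_triple mult.assoc)

lemma prod_Basis_vec3: "(\<Prod>b\<in>Basis. f b) = f (axis 1 1) * f (axis 2 1) * f (axis 3 (1::real) :: real^3)"
proof -
  show ?thesis
    by (simp only: Basis_vec3) (simp add: axis_eq_axis mult.assoc)
qed

lemma lborel_vec3: "(lborel :: (real^3) measure) = distr lborel borel vec3"
proof (rule lborel_eqI)
  have [measurable]: "vec3 \<in> borel_measurable borel"
    by (intro borel_measurable_continuous_onI continuous_intros)
  show "sets (distr lborel borel vec3) = sets borel" by simp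
  fix l u :: "real^3"
  assume lu: "\<And>b. b \<in> Basis \<Longrightarrow> l \<bullet> b \<le> u \<bullet> b"
  have le: "l $ i \<le> u $ i" for i
    using lu[of "axis i 1"] by (simp add: inner_axis axis_in_Basis_iff)
  have "vec3 -` box l u = box (l $ 1, l $ 2, l $ 3) (u $ 1, u $ 2, u $ 3)"
    by (auto simp: mem_box_triple mem_box_vec3)
  moreover have "emeasure lborel (box (l $ 1, l $ 2, l $ 3) (u $ 1, u $ 2, u $ 3))
      = (\<Prod>b\<in>Basis. (u - l) \<bullet> b)"
  proof -
    have *: "(l $ 1, l $ 2, l $ 3) \<bullet> b \<le> (u $ 1, u $ 2, u $ 3) \<bullet> b" if "b \<in> Basis" for b
      using that le by (auto simp: Basis_triple)
    show ?thesis
      by (subst emeasure_lborel_box[OF *])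
        (simp_all add: prod_Basis_triple prod_Basis_vec3 inner_axis)
  qed
  ultimately show "emeasure (distr lborel borel vec3) (box l u) = ennreal (\<Prod>b\<in>Basis. (u - l) \<bullet> b)"
    by (simp add: emeasure_distr)
qed

text \<open>The coordinates of \<open>v\<close> are the radius, the polar angle and the azimuth of \<open>spherical v\<close>;
  \<open>spherical' v\<close> is the derivative at \<open>v\<close>.\<close>

definition spherical :: "real^3 \<Rightarrow> real^3" where
  "spherical v = (v $ 1) *\<^sub>R sphere_point (v $ 2) (v $ 3)"

definition spherical' :: "real^3 \<Rightarrow> real^3 \<Rightarrow> real^3" where
  "spherical' v h = vector
    [h $ 1 * (sin (v $ 2) * cos (v $ 3)) + v $ 1 * (h $ 2 * cos (v $ 2) * cos (v $ 3) - h $ 3 * sin (v $ 2) * sin (v $ 3)),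
     h $ 1 * (sin (v $ 2) * sin (v $ 3)) + v $ 1 * (h $ 2 * cos (v $ 2) * sin (v $ 3) + h $ 3 * sin (v $ 2) * cos (v $ 3)),
     h $ 1 * cos (v $ 2) - v $ 1 * (h $ 2 * sin (v $ 2))]"

lemma sphere_point_nth [simp]:
  "sphere_point a b $ 1 = sin a * cos b" "sphere_point a b $ 2 = sin a * sin b" "sphere_point a b $ 3 = cos a"
  by (simp_all add: sphere_point_def)

lemma has_derivative_vec_iff:
  "(f has_derivative f') (at x within S) \<longleftrightarrow>
   (\<forall>i. ((\<lambda>x. f x $ i) has_derivative (\<lambda>h. f' h $ i)) (at x within S))"
  for f :: "'a::real_normed_vector \<Rightarrow> real^'n"
  by (subst has_derivative_componentwise_within) (auto simp: Basis_vec_def inner_axis)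

lemma spherical_has_derivative: "(spherical has_derivative spherical' v) (at v within S)"
  unfolding has_derivative_vec_iff forall_3
  by (auto simp: spherical_def spherical'_def algebra_simps
      intro!: derivative_eq_intros bounded_linear_imp_has_derivative bounded_linear_vec_nth)

lemma det_spherical: "det (matrix (spherical' v)) = (v $ 1)\<^sup>2 * sin (v $ 2)"
proof -
  have "det (matrix (spherical' v)) = (v $ 1)\<^sup>2 * sin (v $ 2) *
     (((cos (v $ 2))\<^sup>2 + (sin (v $ 2))\<^sup>2) * ((cos (v $ 3))\<^sup>2 + (sin (v $ 3))\<^sup>2))"
    by (simp add: det_3 matrix_def spherical'_def axis_def
        power2_eq_square algebra_simps
        del: sin_cos_squared_add sin_cos_squared_add2 sin_cos_squared_add3)
  then show ?thesis by simp
qed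

lemma norm_sq_vec3: "(norm (x::real^3))\<^sup>2 = (x $ 1)\<^sup>2 + (x $ 2)\<^sup>2 + (x $ 3)\<^sup>2"
  by (simp only: power2_norm_eq_inner inner_vec_def sum_3) (simp add: power2_eq_square)

lemma norm_sphere_point [simp]: "norm (sphere_point a b) = 1"
proof -
  have "(norm (sphere_point a b))\<^sup>2 = (sin a)\<^sup>2 * ((cos b)\<^sup>2 + (sin b)\<^sup>2) + (cos a)\<^sup>2"
    by (simp add: norm_sq_vec3 power_mult_distrib distrib_left del: sin_cos_squared_add sin_cos_squared_add2)
  then have "(norm (sphere_point a b))\<^sup>2 = 1\<^sup>2" by simp
  then show ?thesis using power2_eq_iff_nonneg[of "norm (sphere_point a b)" 1] by simp
qed

lemma continuous_on_sphere_point [continuous_intros]: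
  fixes f g :: "'a::t2_space \<Rightarrow> real"
  assumes "continuous_on S f" "continuous_on S g"
  shows "continuous_on S (\<lambda>x. sphere_point (f x) (g x))"
proof -
  have "sphere_point a b = vec3 (sin a * cos b, sin a * sin b, cos a)" for a b
    by (simp add: sphere_point_def vec3_def)
  then show ?thesis using assms by (auto intro!: continuous_intros)
qed

lemma spherical_inj: "inj_on spherical (box 0 (vector [R, pi, 2 * pi]))"
proof (rule inj_onI)
  fix v w assume v: "v \<in> box 0 (vector [R, pi, 2 * pi])" and w: "w \<in> box 0 (vector [R, pi, 2 * pi])"
    and eq: "spherical v = spherical w"
  have b: "0 < v $ 1" "0 < v $ 2" "0 < v $ 3" "v $ 2 < pi" "v $ 3 < 2 * pi"
     "0 < w $ 1" "0 < w $ 2" "0 < w $ 3" "w $ 2 < pi" "w $ 3 < 2 * pi"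
    using v w by (auto simp: mem_box_vec3)
  have 1: "v $ 1 = w $ 1"
    using arg_cong[OF eq, of norm] b by (simp add: spherical_def)
  have sp: "sphere_point (v $ 2) (v $ 3) = sphere_point (w $ 2) (w $ 3)"
    using eq b by (simp add: spherical_def 1)
  have "cos (v $ 2) = cos (w $ 2)" using arg_cong[OF sp, of "\<lambda>x. x $ 3"] by simp
  then have 2: "v $ 2 = w $ 2" using b cos_inj_pi[of "v $ 2" "w $ 2"] by simp
  have s: "sin (w $ 2) > 0" using b by (simp add: sin_gt_zero)
  have "cos (v $ 3) = cos (w $ 3)" "sin (v $ 3) = sin (w $ 3)"
    using arg_cong[OF sp, of "\<lambda>x. x $ 1"] arg_cong[OF sp, of "\<lambda>x. x $ 2"] s by (simp_all add: 2)
  then obtain n :: int where n: "v $ 3 = w $ 3 + 2 * pi * n"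
    using sin_cos_eq_iff[of "v $ 3" "w $ 3"] by auto
  have "\<bar>v $ 3 - w $ 3\<bar> < 2 * pi * 1" using b by auto
  moreover have "\<bar>v $ 3 - w $ 3\<bar> = 2 * pi * \<bar>real_of_int n\<bar>" using n by (simp add: abs_mult)
  ultimately have "\<bar>real_of_int n\<bar> < 1" by simp
  then have "n = 0" by linarith
  with n have "v $ 3 = w $ 3" by simp
  with 1 2 show "v = w" by (simp add: vec_eq_iff forall_3)
qed

lemma spherical_image_subset: "spherical ` box 0 (vector [R, pi, 2 * pi]) \<subseteq> cball 0 R"
  by (auto simp: spherical_def mem_box_vec3)

text \<open>The image of the open coordinate box misses only a null set of the ball: points of the
  sphere and of the plane \<open>x\<^sub>2 = 0\<close>.\<close>

lemma spherical_image_superset: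
  "ball 0 R - {x. x $ 2 = 0} \<subseteq> spherical ` box 0 (vector [R, pi, 2 * pi])"
proof
  fix x :: "real^3" assume x: "x \<in> ball 0 R - {x. x $ 2 = 0}"
  define \<rho> where "\<rho> = norm x"
  define \<theta> where "\<theta> = arccos (x $ 3 / \<rho>)"
  have x2: "x $ 2 \<noteq> 0" and \<rho>: "0 < \<rho>" "\<rho> < R" using x by (auto simp: \<rho>_def)
  have sq: "\<rho>\<^sup>2 = (x $ 1)\<^sup>2 + (x $ 2)\<^sup>2 + (x $ 3)\<^sup>2" by (simp add: \<rho>_def norm_sq_vec3)
  have "(x $ 2)\<^sup>2 > 0" using x2 by simp
  then have "(x $ 3)\<^sup>2 < \<rho>\<^sup>2" using sq zero_le_power2[of "x $ 1"] by linarith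
  then have "\<bar>x $ 3\<bar> < \<rho>" using \<rho> by (metis abs_of_pos power2_less_imp_less power2_abs less_imp_le)
  then have z: "-1 < x $ 3 / \<rho>" "x $ 3 / \<rho> < 1" using \<rho> by (auto simp: field_simps)
  have \<theta>: "0 < \<theta>" "\<theta> < pi" using arccos_lt_bounded[OF z] by (auto simp: \<theta>_def)
  have c: "cos \<theta> = x $ 3 / \<rho>" using z by (simp add: \<theta>_def)
  have s: "sin \<theta> > 0" using \<theta> by (simp add: sin_gt_zero)
  have "(sin \<theta>)\<^sup>2 = 1 - (x $ 3 / \<rho>)\<^sup>2" using c by (simp add: sin_squared_eq)
  then have "(\<rho> * sin \<theta>)\<^sup>2 = \<rho>\<^sup>2 - (x $ 3)\<^sup>2"
    using \<rho> by (simp add: power_mult_distrib right_diff_distrib power_divide)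
  then have s2: "(\<rho> * sin \<theta>)\<^sup>2 = (x $ 1)\<^sup>2 + (x $ 2)\<^sup>2"
    using sq by simp
  have "(x $ 1 / (\<rho> * sin \<theta>))\<^sup>2 + (x $ 2 / (\<rho> * sin \<theta>))\<^sup>2 = (\<rho> * sin \<theta>)\<^sup>2 / (\<rho> * sin \<theta>)\<^sup>2"
    by (simp only: s2 power_divide add_divide_distrib)
  also have "\<dots> = 1" using s \<rho> by simp
  finally obtain \<phi> where \<phi>: "0 \<le> \<phi>" "\<phi> < 2 * pi"
      "x $ 1 / (\<rho> * sin \<theta>) = cos \<phi>" "x $ 2 / (\<rho> * sin \<theta>) = sin \<phi>"
    using sincos_total_2pi by metis
  have "\<phi> \<noteq> 0" using \<phi>(4) x2 s \<rho> by auto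
  then have "vector [\<rho>, \<theta>, \<phi>] \<in> box 0 (vector [R, pi, 2 * pi] :: real^3)"
    using \<rho> \<theta> \<phi> by (auto simp: mem_box_vec3)
  moreover have "\<rho> * sin \<theta> \<noteq> 0" using s \<rho> by simp
  then have "x $ 1 = cos \<phi> * (\<rho> * sin \<theta>)" "x $ 2 = sin \<phi> * (\<rho> * sin \<theta>)"
    using \<phi>(3,4) by (metis nonzero_divide_eq_eq)+
  then have "spherical (vector [\<rho>, \<theta>, \<phi>]) = x"
    using c \<rho> by (simp add: spherical_def vec_eq_iff forall_3)
  ultimately show "x \<in> spherical ` box 0 (vector [R, pi, 2 * pi])"
    by (intro image_eqI[of _ _ "vector [\<rho>, \<theta>, \<phi>]"]) simp_all
qed

lemma continuous_on_spherical: "continuous_on S spherical"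
  by (rule has_derivative_continuous_on) (rule spherical_has_derivative)

lemma spherical_in_cball: "v \<in> cbox 0 (vector [R, pi, 2 * pi]) \<Longrightarrow> spherical v \<in> cball 0 R"
  by (simp add: spherical_def mem_box_cart forall_3)

lemma integral_cball_spherical_real:
  fixes h :: "real^3 \<Rightarrow> real"
  assumes h: "continuous_on (cball 0 R) h"
  shows "integral (cball 0 R) h =
    integral (cbox 0 (vector [R, pi, 2 * pi])) (\<lambda>v. ((v $ 1)\<^sup>2 * sin (v $ 2)) * h (spherical v))"
proof -
  define S where "S = box 0 (vector [R, pi, 2 * pi] :: real^3)"
  \<comment> \<open>The change of variables formula is stated for vector-valued integrands.\<close>
  define f where "f = (\<lambda>x. (\<chi> i. h x) :: real^1)"
  have f: "continuous_on (cball 0 R) f"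
    unfolding f_def using h by (intro continuous_intros)
  have "set_integrable lborel (cball 0 R) f"
    unfolding set_integrable_def by (rule borel_integrable_compact) (auto intro: f)
  then have ai: "f absolutely_integrable_on cball 0 R"
    unfolding set_integrable_def using integrable_completion[of "\<lambda>x. indicat_real (cball 0 R) x *\<^sub>R f x" lborel]
    by (simp add: borel_measurable_integrable)
  have neg: "negligible (sphere 0 R \<union> {x :: real^3. x $ 2 = 0})"
    by (simp add: negligible_sphere negligible_standard_hyperplane_cart)
  have n1: "negligible {x \<in> cball 0 R - spherical ` S. f x \<noteq> 0}"
  proof (rule negligible_subset[OF neg], rule subsetI)
    fix x assume "x \<in> {x \<in> cball 0 R - spherical ` S. f x \<noteq> 0}"
    then show "x \<in> sphere 0 R \<union> {x. x $ 2 = 0}"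
      using spherical_image_superset[of R, THEN subsetD, of x] by (auto simp: S_def)
  qed
  have n2: "negligible {x \<in> spherical ` S - cball 0 R. f x \<noteq> 0}"
    using spherical_image_subset[of R] by (intro negligible_subset[OF negligible_empty]) (auto simp: S_def)
  have ai2: "f absolutely_integrable_on spherical ` S"
    using ai absolutely_integrable_spike_set_eq[OF n1 n2] by simp
  have "(\<lambda>v. \<bar>det (matrix (spherical' v))\<bar> *\<^sub>R f (spherical v)) absolutely_integrable_on S \<and>
      integral S (\<lambda>v. \<bar>det (matrix (spherical' v))\<bar> *\<^sub>R f (spherical v)) = integral (spherical ` S) f"
    by (subst has_absolute_integral_change_of_variables)
      (auto simp: S_def ai2[unfolded S_def] spherical_inj intro: spherical_has_derivative)
  then have int: "(\<lambda>v. \<bar>det (matrix (spherical' v))\<bar> *\<^sub>R f (spherical v)) integrable_on S"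
    and "integral S (\<lambda>v. \<bar>det (matrix (spherical' v))\<bar> *\<^sub>R f (spherical v)) = integral (spherical ` S) f"
    by (simp_all add: absolutely_integrable_on_def)
  then have "integral (cball 0 R) f $ 1 =
      integral S (\<lambda>v. (\<bar>det (matrix (spherical' v))\<bar> *\<^sub>R f (spherical v)) $ 1)"
    using integral_spike_set[OF n1 n2] integral_component_eq_cart[OF int] by metis
  also have "\<dots> = integral S (\<lambda>v. ((v $ 1)\<^sup>2 * sin (v $ 2)) * h (spherical v))"
  proof (rule integral_cong)
    fix v assume "v \<in> S"
    then have "0 \<le> sin (v $ 2)" by (simp add: S_def mem_box_vec3 sin_ge_zero)
    then show "(\<bar>det (matrix (spherical' v))\<bar> *\<^sub>R f (spherical v)) $ 1
        = ((v $ 1)\<^sup>2 * sin (v $ 2)) * h (spherical v)"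
      by (simp add: det_spherical f_def abs_mult)
  qed
  also have "integral (cball 0 R) f $ 1 = integral (cball 0 R) h"
    using ai by (simp add: absolutely_integrable_on_def f_def flip: integral_component_eq_cart)
  finally show ?thesis
    by (simp add: S_def integral_open_interval)
qed

lemma integral_vec3:
  fixes k :: "real^3 \<Rightarrow> 'b::euclidean_space"
  assumes k: "continuous_on (cbox l u) k"
  shows "integral (cbox l u) k = integral (cbox (l $ 1, l $ 2, l $ 3) (u $ 1, u $ 2, u $ 3)) (\<lambda>p. k (vec3 p))"
proof -
  let ?B = "cbox (l $ 1, l $ 2, l $ 3) (u $ 1, u $ 2, u $ 3)"
  have int: "integrable lborel (\<lambda>x. indicator (cbox l u) x *\<^sub>R k x)"
    by (rule borel_integrable_compact) (auto intro: k)
  have B: "indicat_real (cbox l u) (vec3 p) = indicat_real ?B p" for p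
    by (cases p) (auto simp: indicator_def mem_box_cart forall_3 mem_box Basis_triple)
  have "continuous_on ?B (\<lambda>p. k (vec3 p))"
    by (rule continuous_on_compose2[OF k])
      (auto intro!: continuous_intros simp: mem_box_cart forall_3 mem_box Basis_triple)
  then have int2: "integrable lborel (\<lambda>p. indicator ?B p *\<^sub>R k (vec3 p))"
    by (intro borel_integrable_compact) auto
  have [measurable]: "vec3 \<in> borel_measurable borel"
    by (intro borel_measurable_continuous_onI continuous_intros)
  have "integral (cbox l u) k = integral\<^sup>L (distr lborel borel vec3) (\<lambda>x. indicator (cbox l u) x *\<^sub>R k x)"
    using set_borel_integral_eq_integral(2)[of "cbox l u" k] int
    by (simp add: set_integrable_def set_lebesgue_integral_def flip: lborel_vec3)
  also have "\<dots> = (\<integral>p. indicator (cbox l u) (vec3 p) *\<^sub>R k (vec3 p) \<partial>lborel)"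
    using int by (intro integral_distr) (auto dest: borel_measurable_integrable)
  also have "\<dots> = integral ?B (\<lambda>p. k (vec3 p))"
    using set_borel_integral_eq_integral(2)[of ?B "\<lambda>p. k (vec3 p)"] int2
    by (simp add: set_integrable_def set_lebesgue_integral_def B)
  finally show ?thesis .
qed

lemma set_integrable_cball:
  fixes h :: "'a::euclidean_space \<Rightarrow> 'b::euclidean_space"
  assumes "continuous_on (cball z R) h"
  shows "set_integrable lborel (cball z R) h"
  unfolding set_integrable_def by (rule borel_integrable_compact) (auto intro: assms)

lemma set_integral_cball_translate:
  fixes h :: "'a::euclidean_space \<Rightarrow> 'b::euclidean_space"
  assumes h: "continuous_on (cball z R) h"
  shows "(LINT x:cball z R|lborel. h x) = (LINT x:cball 0 R|lborel. h (z + x))"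
proof -
  have "(\<integral>x. indicator (cball z R) x *\<^sub>R h x \<partial>distr lborel borel ((+) z))
     = (\<integral>x. indicator (cball z R) (z + x) *\<^sub>R h (z + x) \<partial>lborel)"
    using set_integrable_cball[OF h]
    by (intro integral_distr) (auto simp: set_integrable_def dest: borel_measurable_integrable)
  moreover have "indicat_real (cball z R) (z + x) = indicat_real (cball 0 R) x" for x
    by (simp add: indicator_def dist_norm)
  ultimately show ?thesis
    by (simp add: lborel_distr_plus set_lebesgue_integral_def)
qed

lemma cbox_spherical_cball:
  "(s, \<theta>, \<phi>) \<in> cbox (0, 0, 0) (R, pi, 2 * pi) \<Longrightarrow> z + s *\<^sub>R sphere_point \<theta> \<phi> \<in> cball z R"
  by (auto simp: dist_norm)


lemma set_integral_cball_spherical: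
  fixes h :: "real^3 \<Rightarrow> 'b::euclidean_space"
  assumes h: "continuous_on (cball z R) h"
  shows "(LINT x:cball z R|lborel. h x) =
    integral (cbox (0, 0, 0) (R, pi, 2 * pi))
      (\<lambda>(s, \<theta>, \<phi>). (s\<^sup>2 * sin \<theta>) *\<^sub>R h (z + s *\<^sub>R sphere_point \<theta> \<phi>))"
    (is "?l = integral ?B ?F")
proof (rule euclidean_eqI)
  fix b :: 'b assume "b \<in> Basis"
  have h0: "continuous_on (cball 0 R) (\<lambda>x. h (z + x))"
    by (rule continuous_on_compose2[OF h]) (auto intro!: continuous_intros simp: dist_norm)
  have F: "continuous_on ?B ?F"
    unfolding case_prod_unfold
    by (intro continuous_intros continuous_on_compose2[OF h])
      (use cbox_spherical_cball[of _ _ _ R z] in \<open>auto simp del: mem_cball cbox_Pair_eq\<close>)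
  have k: "continuous_on (cbox 0 (vector [R, pi, 2 * pi]))
      (\<lambda>v. ((v $ 1)\<^sup>2 * sin (v $ 2)) * (h (z + spherical v) \<bullet> b))"
    by (intro continuous_intros continuous_on_compose2[OF h0] continuous_on_spherical)
      (use spherical_in_cball[of _ R] in auto)
  have "?l \<bullet> b = integral (cball 0 R) (\<lambda>x. h (z + x)) \<bullet> b"
    using set_borel_integral_eq_integral[OF set_integrable_cball[OF h0]]
    by (simp add: set_integral_cball_translate[OF h])
  also have "\<dots> = integral (cball 0 R) (\<lambda>x. h (z + x) \<bullet> b)"
    using set_borel_integral_eq_integral[OF set_integrable_cball[OF h0]]
    by (simp add: integral_component_eq)
  also have "\<dots> = integral (cbox 0 (vector [R, pi, 2 * pi]))
      (\<lambda>v. ((v $ 1)\<^sup>2 * sin (v $ 2)) * (h (z + spherical v) \<bullet> b))"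
    by (intro integral_cball_spherical_real continuous_intros h0)
  also have "\<dots> = integral ?B (\<lambda>p. ?F p \<bullet> b)"
    by (subst integral_vec3[OF k]) (simp add: case_prod_unfold spherical_def)
  also have "\<dots> = integral ?B ?F \<bullet> b"
    using F by (intro integral_component_eq integrable_continuous)
  finally show "?l \<bullet> b = integral ?B ?F \<bullet> b" .
qed

lemma interval_integral_continuous_eq_integral:
  fixes f :: "real \<Rightarrow> 'b::euclidean_space"
  assumes "a \<le> b" "continuous_on {a..b} f"
  shows "(LBINT x=ereal a..ereal b. f x) = integral {a..b} f"
  using assms by (intro interval_integral_eq_integral) (auto intro: borel_integrable_atLeastAtMost')

lemma sphere_integral_eq:
  fixes f :: "real^3 \<Rightarrow> 'b::euclidean_space"
  assumes f: "continuous_on (sphere z R) f" and R: "0 \<le> R"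
  shows "sphere_integral z R f = integral (cbox (0, 0) (pi, 2 * pi))
     (\<lambda>(\<theta>, \<phi>). (R\<^sup>2 * sin \<theta>) *\<^sub>R f (z + R *\<^sub>R sphere_point \<theta> \<phi>))"
proof -
  let ?F = "\<lambda>\<theta> \<phi>. (R\<^sup>2 * sin \<theta>) *\<^sub>R f (z + R *\<^sub>R sphere_point \<theta> \<phi>)"
  have F: "continuous_on S (\<lambda>x. ?F (g x) (h x))"
    if "continuous_on S g" "continuous_on S h" for S :: "'s::t2_space set" and g h
    by (intro continuous_intros continuous_on_compose2[OF f] that) (use R in \<open>auto simp: dist_norm\<close>)
  have F2: "continuous_on (UNIV \<times> cbox 0 (2 * pi)) (\<lambda>(\<theta>, \<phi>). ?F \<theta> \<phi>)"
    unfolding case_prod_unfold by (intro F continuous_intros)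
  have F3: "continuous_on (cbox (0, 0) (pi, 2 * pi)) (\<lambda>(\<theta>, \<phi>). ?F \<theta> \<phi>)"
    unfolding case_prod_unfold by (intro F continuous_intros)
  have "sphere_integral z R f = (LBINT \<theta>=ereal 0..ereal pi. integral {0..2*pi} (?F \<theta>))"
    unfolding sphere_integral_def
    by (intro interval_integral_cong interval_integral_continuous_eq_integral F continuous_intros) auto
  also have "\<dots> = integral {0..pi} (\<lambda>\<theta>. integral {0..2*pi} (?F \<theta>))"
    using integral_continuous_on_param[OF F2]
    by (intro interval_integral_continuous_eq_integral) (auto intro: continuous_on_subset)
  also have "\<dots> = integral (cbox (0, 0) (pi, 2 * pi)) (\<lambda>(\<theta>, \<phi>). ?F \<theta> \<phi>)"
    using integral_prod_continuous[OF F3] by simp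
  finally show ?thesis .
qed

lemma set_integral_cball_sphere_integral:
  fixes h :: "real^3 \<Rightarrow> 'b::euclidean_space"
  assumes h: "continuous_on (cball z R) h" 
  shows "(LINT x:cball z R|lborel. h x) = integral {0..R} (\<lambda>s. sphere_integral z s h)"
proof -
  have F: "continuous_on (cbox (0, 0, 0) (R, pi, 2 * pi))
      (\<lambda>(s, \<theta>, \<phi>). (s\<^sup>2 * sin \<theta>) *\<^sub>R h (z + s *\<^sub>R sphere_point \<theta> \<phi>))"
    unfolding case_prod_unfold
    by (intro continuous_intros continuous_on_compose2[OF h])
      (use cbox_spherical_cball[of _ _ _ R z] in \<open>auto simp del: mem_cball cbox_Pair_eq\<close>)
  have h': "continuous_on (sphere z s) h" if "s \<le> R" for s
    by (rule continuous_on_subset[OF h]) (use that in auto)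
  show ?thesis
    unfolding set_integral_cball_spherical[OF h]
    by (subst integral_prod_continuous[OF F]) (auto intro!: integral_cong simp: sphere_integral_eq[OF h'])
qed

lemma continuous_on_sphere_integral:
  fixes h :: "real^3 \<Rightarrow> 'b::euclidean_space"
  assumes h: "continuous_on (cball z R) h" 
  shows "continuous_on {0..R} (\<lambda>s. sphere_integral z s h)"
proof -
  have h': "continuous_on (sphere z s) h" if "s \<le> R" for s
    by (rule continuous_on_subset[OF h]) (use that in auto)
  have F: "continuous_on ({0..R} \<times> cbox (0, 0) (pi, 2 * pi))
      (\<lambda>(s, p). case p of (\<theta>, \<phi>) \<Rightarrow> (s\<^sup>2 * sin \<theta>) *\<^sub>R h (z + s *\<^sub>R sphere_point \<theta> \<phi>))"
    unfolding case_prod_unfold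
    by (intro continuous_intros continuous_on_compose2[OF h]) (auto simp: dist_norm)
  show ?thesis
    using integral_continuous_on_param[OF F]
    by (rule continuous_on_eq) (simp add: sphere_integral_eq[OF h'])
qed


section \<open>The divergence theorem on a ball\<close>

lemma sphere_integral_linear:
  fixes f :: "real^3 \<Rightarrow> 'b::euclidean_space" and L :: "'b \<Rightarrow> 'c::euclidean_space"
  assumes L: "bounded_linear L" and f: "continuous_on (sphere z R) f" and R: "0 \<le> R"
  shows "sphere_integral z R (\<lambda>x. L (f x)) = L (sphere_integral z R f)"
proof -
  interpret bounded_linear L by fact
  have c: "continuous_on (sphere z R) (\<lambda>x. L (f x))"
    by (rule continuous_on[OF f])
  have "continuous_on (cbox (0, 0) (pi, 2 * pi))
      (\<lambda>(\<theta>, \<phi>). (R\<^sup>2 * sin \<theta>) *\<^sub>R f (z + R *\<^sub>R sphere_point \<theta> \<phi>))"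
    unfolding case_prod_unfold
    by (intro continuous_intros continuous_on_compose2[OF f]) (use R in \<open>auto simp: dist_norm\<close>)
  from integral_linear[OF integrable_continuous[OF this] L] show ?thesis
    by (simp add: sphere_integral_eq[OF f R] sphere_integral_eq[OF c R] o_def case_prod_unfold scaleR)
qed

lemma sphere_integral_add:
  fixes f g :: "real^3 \<Rightarrow> 'b::euclidean_space"
  assumes f: "continuous_on (sphere z R) f" and g: "continuous_on (sphere z R) g" and R: "0 \<le> R"
  shows "sphere_integral z R (\<lambda>x. f x + g x) = sphere_integral z R f + sphere_integral z R g"
proof -
  have c: "continuous_on (cbox (0, 0) (pi, 2 * pi))
      (\<lambda>(\<theta>, \<phi>). (R\<^sup>2 * sin \<theta>) *\<^sub>R f (z + R *\<^sub>R sphere_point \<theta> \<phi>))"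
    if f: "continuous_on (sphere z R) f" for f :: "real^3 \<Rightarrow> 'b"
    unfolding case_prod_unfold
    by (intro continuous_intros continuous_on_compose2[OF f]) (use R in \<open>auto simp: dist_norm\<close>)
  show ?thesis
    using integral_add[OF integrable_continuous[OF c[OF f]] integrable_continuous[OF c[OF g]]]
    by (simp add: sphere_integral_eq[OF f R] sphere_integral_eq[OF g R]
        sphere_integral_eq[OF continuous_on_add[OF f g] R] case_prod_unfold scaleR_add_right)
qed

lemma sphere_integral_cong:
  assumes "\<And>x. x \<in> sphere z R \<Longrightarrow> f x = g x" "0 \<le> R"
  shows "sphere_integral z R f = sphere_integral z R g"
  using assms unfolding sphere_integral_def by (intro interval_integral_cong) (auto simp: dist_norm)

text \<open>By translation invariance the difference quotients of an integrable \<open>F\<close> integrate to 0; a Lipschitz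
  bound and bounded support allow the passage to the limit.  This replaces integration by parts along
  lines.\<close>

lemma integral_directional_derivative_eq_0:
  fixes F D :: "'a::euclidean_space \<Rightarrow> 'b::{banach, second_countable_topology}"
  assumes lip: "\<And>x y. norm (F x - F y) \<le> L * norm (x - y)"
    and F0: "\<And>x. x \<notin> cball z s \<Longrightarrow> F x = 0"
    and D: "D \<in> borel_measurable borel"
    and lim: "AE x in lborel. ((\<lambda>h. (1 / h) *\<^sub>R (F (x + h *\<^sub>R v) - F x)) \<longlongrightarrow> D x) (at_right 0)"
  shows "(\<integral>x. D x \<partial>lborel) = 0"
proof -
  define u where "u = (\<lambda>n x. real (Suc n) *\<^sub>R (F (x + (1 / real (Suc n)) *\<^sub>R v) - F x))"
  have L: "0 \<le> L" 
  proof -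
    obtain b :: 'a where "b \<in> Basis" using nonempty_Basis by blast
    with lip[of b 0] show ?thesis using order_trans[OF norm_ge_zero, of "F b - F 0" L] by simp
  qed
  have "continuous_on UNIV F"
    by (rule lipschitz_on_continuous_on[of L]) (use L lip in \<open>auto simp: lipschitz_on_def dist_norm\<close>)
  then have F_meas[measurable]: "F \<in> borel_measurable borel" 
    by (rule borel_measurable_continuous_onI)
  have F_int: "integrable lborel F"
  proof -
    have "integrable lborel (\<lambda>x. indicator (cball z s) x *\<^sub>R F x)"
      using \<open>continuous_on UNIV F\<close> by (intro borel_integrable_compact) (auto intro: continuous_on_subset)
    moreover have "indicator (cball z s) x *\<^sub>R F x = F x" for x
      using F0[of x] by (auto simp: indicator_def)
    ultimately show ?thesis by simp
  qed
  have shift: "integrable lborel (\<lambda>x. F (x + w))" "(\<integral>x. F (x + w) \<partial>lborel) = (\<integral>x. F x \<partial>lborel)" for w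
  proof -
    have "integrable (distr lborel borel ((+) w)) F" using F_int by (simp add: lborel_distr_plus)
    then show "integrable lborel (\<lambda>x. F (x + w))"
      by (subst (asm) integrable_distr_eq) (auto simp: add.commute)
    have "(\<integral>x. F x \<partial>distr lborel borel ((+) w)) = (\<integral>x. F (w + x) \<partial>lborel)"
      by (intro integral_distr) auto
    then show "(\<integral>x. F (x + w) \<partial>lborel) = (\<integral>x. F x \<partial>lborel)"
      by (simp add: lborel_distr_plus add.commute)
  qed
  have u0: "(\<integral>x. u n x \<partial>lborel) = 0" for n
    unfolding u_def by (simp add: shift F_int)
  have "(\<lambda>n. \<integral>x. u n x \<partial>lborel) \<longlonglongrightarrow> (\<integral>x. D x \<partial>lborel)"
  proof (rule integral_dominated_convergence)
    show "integrable lborel (\<lambda>x. indicator (cball z (\<bar>s\<bar> + norm v)) x *\<^sub>R (L * norm v))"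
      by (intro borel_integrable_compact) auto
    show "AE x in lborel. (\<lambda>n. u n x) \<longlonglongrightarrow> D x"
      using lim
    proof eventually_elim
      case (elim x)
      have "filterlim (\<lambda>n. 1 / real (Suc n)) (at_right 0) sequentially"
        by real_asymp
      from filterlim_compose[OF elim this] show ?case by (simp add: u_def)
    qed
    show "AE x in lborel. norm (u n x) \<le> indicator (cball z (\<bar>s\<bar> + norm v)) x *\<^sub>R (L * norm v)" for n
    proof (rule AE_I2)
      fix x
      let ?w = "(1 / real (Suc n)) *\<^sub>R v"
      have w: "norm ?w \<le> norm v" by (simp add: field_simps mult_left_le_one_le)
      show "norm (u n x) \<le> indicator (cball z (\<bar>s\<bar> + norm v)) x *\<^sub>R (L * norm v)"
      proof (cases "x \<in> cball z (\<bar>s\<bar> + norm v)")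
        case True
        have "norm (F (x + ?w) - F x) \<le> L * norm ?w" using lip[of "x + ?w" x] by simp
        then have "norm (u n x) \<le> real (Suc n) * (L * norm ?w)"
          unfolding u_def norm_scaleR by (intro mult_mono) auto
        also have "\<dots> = L * norm v" by (simp add: field_simps)
        finally show ?thesis using True by simp
      next
        case False
        then have d: "dist z x > \<bar>s\<bar> + norm v" by simp
        moreover have "dist z x \<le> dist z (x + ?w) + norm ?w"
          using dist_triangle[of z x "x + ?w"] by (simp add: dist_norm)
        ultimately have "dist z (x + ?w) > s" "dist z x > s" using w norm_ge_zero[of v] by linarith+
        then show ?thesis using F0 False by (simp add: u_def)
      qed
    qed
  qed (use D in \<open>auto simp: u_def\<close>)
  then show ?thesis by (simp add: u0 LIMSEQ_const_iff)
qed

lemma differentiable_imp_lipschitz_compact: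
  fixes g :: "'a::euclidean_space \<Rightarrow> 'b::real_normed_vector"
  assumes "compact S" "convex S"
    and der: "\<And>x. x \<in> S \<Longrightarrow> (g has_derivative g' x) (at x within S)"
    and cont: "\<And>h. continuous_on S (\<lambda>x. g' x h)"
  obtains L where "0 \<le> L" "\<And>x y. x \<in> S \<Longrightarrow> y \<in> S \<Longrightarrow> norm (g x - g y) \<le> L * norm (x - y)"
proof -
  have "compact ((\<lambda>x. \<Sum>b\<in>Basis. norm (g' x b)) ` S)"
    by (intro compact_continuous_image continuous_intros cont assms)
  from compact_imp_bounded[OF this] obtain L where "\<forall>y\<in>(\<lambda>x. \<Sum>b\<in>Basis. norm (g' x b)) ` S. norm y \<le> L"
    unfolding bounded_iff by (rule exE)
  then have L: "\<bar>\<Sum>b\<in>Basis. norm (g' x b)\<bar> \<le> L" if "x \<in> S" for x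
    using that by auto
  have bd: "onorm (g' x) \<le> max 0 L" if "x \<in> S" for x
  proof (rule onorm_le)
    fix h
    interpret bounded_linear "g' x" using der[OF that] by (rule has_derivative_bounded_linear)
    have "norm (g' x h) = norm (\<Sum>b\<in>Basis. (h \<bullet> b) *\<^sub>R g' x b)"
      by (subst euclidean_representation[of h, symmetric]) (simp only: sum scaleR)
    also have "\<dots> \<le> (\<Sum>b\<in>Basis. norm h * norm (g' x b))"
      by (intro sum_norm_le) (simp add: mult_right_mono Basis_le_norm)
    also have "\<dots> = (\<Sum>b\<in>Basis. norm (g' x b)) * norm h"
      by (simp add: sum_distrib_left mult.commute)
    also have "\<dots> \<le> max 0 L * norm h"
      using L[OF that] by (intro mult_right_mono) auto
    finally show "norm (g' x h) \<le> max 0 L * norm h" .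
  qed
  show ?thesis
    by (rule that[of "max 0 L"]) (use differentiable_bound[OF \<open>convex S\<close> der bd] in auto)
qed

text \<open>The preceding lemma is applied to \<open>(s\<^sup>2 - |x - z|\<^sup>2) g x\<close>, extended by 0.  The weight vanishes on the
  sphere, so that the extension is Lipschitz and no boundary term arises.\<close>

lemma integral_cball_weighted_derivative:
  fixes g :: "real^3 \<Rightarrow> 'b::euclidean_space"
  assumes s: "0 < s"
    and der: "\<And>x. x \<in> cball z s \<Longrightarrow> (g has_derivative g' x) (at x within cball z s)"
    and cont: "\<And>h. continuous_on (cball z s) (\<lambda>x. g' x h)"
  shows "(LINT x:cball z s|lborel. (s\<^sup>2 - (norm (x - z))\<^sup>2) *\<^sub>R g' x v) =
         (LINT x:cball z s|lborel. (2 * ((x - z) \<bullet> v)) *\<^sub>R g x)"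
proof -
  define G where "G = (\<lambda>x. (s\<^sup>2 - (norm (x - z))\<^sup>2) *\<^sub>R g x)"
  define G' where "G' = (\<lambda>x h. (s\<^sup>2 - (norm (x - z))\<^sup>2) *\<^sub>R g' x h - (2 * ((x - z) \<bullet> h)) *\<^sub>R g x)"
  define F where "F = (\<lambda>x. if x \<in> cball z s then G x else 0)"
  define D where "D = (\<lambda>x. indicator (cball z s) x *\<^sub>R G' x v)"
  have g: "continuous_on (cball z s) g"
    by (rule has_derivative_continuous_on[OF der])
  have G: "(G has_derivative G' x) (at x within cball z s)" if "x \<in> cball z s" for x
    unfolding G_def G'_def power2_norm_eq_inner
    by (auto intro!: derivative_eq_intros der[OF that] simp: inner_commute algebra_simps)
  have G'_cont: "continuous_on (cball z s) (\<lambda>x. G' x h)" for h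
    unfolding G'_def by (intro continuous_intros cont g)
  obtain L where L: "0 \<le> L" "\<And>x y. x \<in> cball z s \<Longrightarrow> y \<in> cball z s \<Longrightarrow> norm (G x - G y) \<le> L * norm (x - y)"
    using differentiable_imp_lipschitz_compact[OF compact_cball convex_cball G G'_cont] by metis
  have G0: "G x = 0" if "x \<in> sphere z s" for x
    using that by (simp add: G_def dist_norm norm_minus_commute)
  have cross: "norm (F x - F y) \<le> L * norm (x - y)" if x: "x \<in> cball z s" and y: "y \<notin> cball z s" for x y
  proof -
    obtain p where p: "p \<in> closed_segment x y" "p \<in> sphere z s"
    proof -
      have "closed_segment x y \<inter> frontier (cball z s) \<noteq> {}"
        using x y by (intro connected_Int_frontier) auto
      then obtain p where "p \<in> closed_segment x y" "p \<in> frontier (cball z s)" by blast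
      with s that[of p] show ?thesis by simp
    qed
    have "norm (F x - F y) = norm (G x - G p)" using x y G0[OF p(2)] by (simp add: F_def)
    also have "\<dots> \<le> L * norm (x - p)" using p x by (intro L) auto
    also have "\<dots> \<le> L * norm (x - y)"
      using segment_bound(1)[OF p(1)] L(1) by (intro mult_left_mono) (simp_all add: norm_minus_commute)
    finally show ?thesis .
  qed
  have lip: "norm (F x - F y) \<le> L * norm (x - y)" for x y
    using cross[of x y] cross[of y x] L(2)[of x y] L(1)
    by (cases "x \<in> cball z s"; cases "y \<in> cball z s") (simp_all add: F_def norm_minus_commute)
  have G'_int: "set_integrable lborel (cball z s) (\<lambda>x. G' x v)"
    by (rule set_integrable_cball[OF G'_cont])
  have D_lim: "((\<lambda>h. (1 / h) *\<^sub>R (F (x + h *\<^sub>R v) - F x)) \<longlongrightarrow> D x) (at_right 0)" if "x \<notin> sphere z s" for x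
  proof -
    have "(F has_derivative (\<lambda>h. indicator (cball z s) x *\<^sub>R G' x h)) (at x)"
    proof (cases "x \<in> ball z s")
      case True
      then have "(G has_derivative G' x) (at x)"
        using G[of x] by (metis at_within_interior interior_cball ball_subset_cball subsetD)
      then have "(F has_derivative G' x) (at x)"
        by (rule has_derivative_transform_within_open[OF _ open_ball[of z s]]) (use True in \<open>auto simp: F_def\<close>)
      then show ?thesis using True by (simp add: eta_contract_eq)
    next
      case False
      with that have x: "x \<in> - cball z s" by auto
      have "((\<lambda>x. 0) has_derivative (\<lambda>h. 0 :: 'b)) (at x)" by simp
      then have "(F has_derivative (\<lambda>h. 0)) (at x)"
        by (rule has_derivative_transform_within_open[OF _ open_Compl[OF closed_cball[of z s]]]) (use x in \<open>auto simp: F_def\<close>)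
      then show ?thesis using x by simp
    qed
    then have F': "(F has_derivative (\<lambda>h. indicator (cball z s) x *\<^sub>R G' x h)) (at (x + 0 *\<^sub>R v))"
      by simp
    have line: "((\<lambda>h. x + h *\<^sub>R v) has_derivative (\<lambda>h. h *\<^sub>R v)) (at (0::real))"
      by (auto intro!: derivative_eq_intros)
    have lin: "indicator (cball z s) x *\<^sub>R G' x (h *\<^sub>R v) = h *\<^sub>R D x" for h
      using linear_scale[OF has_derivative_linear[OF F'], of h v] by (simp add: D_def)
    have "((\<lambda>h. F (x + h *\<^sub>R v)) has_derivative (\<lambda>h. h *\<^sub>R D x)) (at 0)"
      using has_derivative_compose[OF line F'] unfolding lin .
    then have "((\<lambda>h. norm (F (x + h *\<^sub>R v) - F x - h *\<^sub>R D x) / norm h) \<longlongrightarrow> 0) (at 0)"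
      by (simp add: has_derivative_at)
    then have "((\<lambda>h. norm ((1 / h) *\<^sub>R (F (x + h *\<^sub>R v) - F x) - D x)) \<longlongrightarrow> 0) (at 0)"
    proof (rule Lim_transform_eventually)
      show "\<forall>\<^sub>F h in at 0. norm (F (x + h *\<^sub>R v) - F x - h *\<^sub>R D x) / norm h
          = norm ((1 / h) *\<^sub>R (F (x + h *\<^sub>R v) - F x) - D x)"
        using eventually_neq_at_within[of 0]
      proof eventually_elim
        case (elim h)
        then have "(1 / h) *\<^sub>R (F (x + h *\<^sub>R v) - F x) - D x = (1 / h) *\<^sub>R (F (x + h *\<^sub>R v) - F x - h *\<^sub>R D x)"
          by (simp add: scaleR_diff_right)
        then show ?case by simp
      qed
    qed
    then have "((\<lambda>h. (1 / h) *\<^sub>R (F (x + h *\<^sub>R v) - F x)) \<longlongrightarrow> D x) (at 0)"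
      by (rule LIM_zero_cancel[OF tendsto_norm_zero_cancel])
    then show ?thesis
      by (simp add: filterlim_at_split)
  qed
  have "(\<integral>x. D x \<partial>lborel) = 0"
  proof (rule integral_directional_derivative_eq_0[OF lip])
    show "F x = 0" if "x \<notin> cball z s" for x using that by (simp add: F_def)
    show "D \<in> borel_measurable borel"
      using G'_int by (auto simp: D_def set_integrable_def dest: borel_measurable_integrable)
    have "sphere z s \<in> null_sets lborel"
      using negligible_sphere[of z s] null_sets_completion_iff[of "sphere z s" lborel]
      by (simp add: negligible_iff_null_sets)
    then have "AE x in lborel. x \<notin> sphere z s" by (rule AE_not_in)
    then show "AE x in lborel. ((\<lambda>h. (1 / h) *\<^sub>R (F (x + h *\<^sub>R v) - F x)) \<longlongrightarrow> D x) (at_right 0)"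
      by eventually_elim (rule D_lim)
  qed
  also have "(\<integral>x. D x \<partial>lborel) = (LINT x:cball z s|lborel. (s\<^sup>2 - (norm (x - z))\<^sup>2) *\<^sub>R g' x v)
     - (LINT x:cball z s|lborel. (2 * ((x - z) \<bullet> v)) *\<^sub>R g x)"
    unfolding D_def G'_def set_lebesgue_integral_def[symmetric]
    by (intro set_integral_diff set_integrable_cball continuous_intros cont g)
  finally show ?thesis by simp
qed

text \<open>The boundary term is recovered from the weighted identity by differentiating it with respect to
  the radius: in spherical coordinates both of its sides are integrals of continuous functions of the
  radius.\<close>

lemma integral_cball_directional_derivative:
  fixes g :: "real^3 \<Rightarrow> 'b::euclidean_space"
  assumes R: "0 < R"
    and der: "\<And>x. x \<in> cball z R \<Longrightarrow> (g has_derivative g' x) (at x within cball z R)"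
    and cont: "\<And>h. continuous_on (cball z R) (\<lambda>x. g' x h)"
  shows "(LINT x:cball z R|lborel. g' x v) =
         sphere_integral z R (\<lambda>x. ((1 / R) *\<^sub>R (x - z) \<bullet> v) *\<^sub>R g x)"
proof -
  define H where "H = (\<lambda>s. sphere_integral z s (\<lambda>x. g' x v))"
  define N where "N = (\<lambda>s. sphere_integral z s (\<lambda>x. ((x - z) \<bullet> v) *\<^sub>R g x))"
  have g: "continuous_on (cball z R) g"
    by (rule has_derivative_continuous_on[OF der])
  have N_cont: "continuous_on (cball z R) (\<lambda>x. ((x - z) \<bullet> v) *\<^sub>R g x)"
    by (intro continuous_intros g)
  have H: "continuous_on {0..R} H" and N: "continuous_on {0..R} N"
    unfolding H_def N_def by (intro continuous_on_sphere_integral cont N_cont)+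
  have sph: "sphere z s \<subseteq> cball z R" if "s \<le> R" for s using that by auto
  have int: "f integrable_on {0..s}" if "continuous_on {0..R} f" "s \<le> R" for f :: "real \<Rightarrow> 'b" and s
    by (rule integrable_continuous_real[OF continuous_on_subset[OF that(1)]]) (use that in auto)
  have H2: "continuous_on {0..R} (\<lambda>t. t\<^sup>2 *\<^sub>R H t)" by (intro continuous_intros H)
  \<comment> \<open>The weighted identity for the ball of radius \<open>s\<close>, in radial form.\<close>
  have eq: "s\<^sup>2 *\<^sub>R integral {0..s} H - integral {0..s} (\<lambda>t. t\<^sup>2 *\<^sub>R H t) = 2 *\<^sub>R integral {0..s} N"
    if s: "s \<in> {0..R}" for s
  proof (cases "s = 0")
    case False
    then have s0: "0 < s" "s \<le> R" using s by auto
    then have sub: "cball z s \<subseteq> cball z R" by auto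
    have c1: "continuous_on (cball z s) (\<lambda>x. (s\<^sup>2 - (norm (x - z))\<^sup>2) *\<^sub>R g' x v)"
      by (intro continuous_intros continuous_on_subset[OF cont sub])
    have c2: "continuous_on (cball z s) (\<lambda>x. (2 * ((x - z) \<bullet> v)) *\<^sub>R g x)"
      by (intro continuous_intros continuous_on_subset[OF g sub])
    have e1: "sphere_integral z t (\<lambda>x. (s\<^sup>2 - (norm (x - z))\<^sup>2) *\<^sub>R g' x v) = (s\<^sup>2 - t\<^sup>2) *\<^sub>R H t"
      if t: "t \<in> {0..s}" for t
    proof -
      have "sphere_integral z t (\<lambda>x. (s\<^sup>2 - (norm (x - z))\<^sup>2) *\<^sub>R g' x v)
          = sphere_integral z t (\<lambda>x. (s\<^sup>2 - t\<^sup>2) *\<^sub>R g' x v)"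
        using t by (intro sphere_integral_cong) (auto simp: dist_norm norm_minus_commute)
      also have "\<dots> = (s\<^sup>2 - t\<^sup>2) *\<^sub>R H t"
        unfolding H_def using t s0
        by (intro sphere_integral_linear bounded_linear_scaleR_right continuous_on_subset[OF cont sph]) auto
      finally show ?thesis .
    qed
    have e2: "sphere_integral z t (\<lambda>x. (2 * ((x - z) \<bullet> v)) *\<^sub>R g x) = 2 *\<^sub>R N t"
      if t: "t \<in> {0..s}" for t
      unfolding N_def scaleR_scaleR[symmetric] using t s0
      by (intro sphere_integral_linear bounded_linear_scaleR_right continuous_on_subset[OF N_cont sph]) auto
    have "integral {0..s} (\<lambda>t. (s\<^sup>2 - t\<^sup>2) *\<^sub>R H t) =
        (LINT x:cball z s|lborel. (s\<^sup>2 - (norm (x - z))\<^sup>2) *\<^sub>R g' x v)"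
      unfolding set_integral_cball_sphere_integral[OF c1] by (intro integral_cong) (simp add: e1)
    also have "\<dots> = (LINT x:cball z s|lborel. (2 * ((x - z) \<bullet> v)) *\<^sub>R g x)"
    proof (rule integral_cball_weighted_derivative[OF s0(1), where g = g and g' = g' and v = v and z = z])
      show "(g has_derivative g' x) (at x within cball z s)" if "x \<in> cball z s" for x
        by (rule has_derivative_subset[OF der sub]) (use that sub in blast)
    qed (rule continuous_on_subset[OF cont sub])
    also have "\<dots> = integral {0..s} (\<lambda>t. 2 *\<^sub>R N t)"
      unfolding set_integral_cball_sphere_integral[OF c2] by (intro integral_cong) (simp add: e2)
    finally have "integral {0..s} (\<lambda>t. (s\<^sup>2 - t\<^sup>2) *\<^sub>R H t) = integral {0..s} (\<lambda>t. 2 *\<^sub>R N t)" .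
    moreover have "integral {0..s} (\<lambda>t. (s\<^sup>2 - t\<^sup>2) *\<^sub>R H t) =
        s\<^sup>2 *\<^sub>R integral {0..s} H - integral {0..s} (\<lambda>t. t\<^sup>2 *\<^sub>R H t)"
      unfolding scaleR_left_diff_distrib
      by (subst integral_diff) (auto intro!: integrable_cmul int H H2 s0(2))
    ultimately show ?thesis by simp
  qed simp
  have R': "R \<in> {0..R}" using R by simp
  have "((\<lambda>s. s\<^sup>2 *\<^sub>R integral {0..s} H - integral {0..s} (\<lambda>t. t\<^sup>2 *\<^sub>R H t)) has_vector_derivative
      (R\<^sup>2 *\<^sub>R H R + (2 * R) *\<^sub>R integral {0..R} H - R\<^sup>2 *\<^sub>R H R)) (at R within {0..R})"
  proof (intro has_vector_derivative_diff has_vector_derivative_scaleR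
      integral_has_vector_derivative[OF H R'] integral_has_vector_derivative[OF H2 R'])
    show "((\<lambda>s. s\<^sup>2) has_real_derivative 2 * R) (at R within {0..R})"
      by (auto intro!: derivative_eq_intros)
  qed
  moreover have "((\<lambda>s. 2 *\<^sub>R integral {0..s} N) has_vector_derivative 2 *\<^sub>R N R) (at R within {0..R})"
    by (intro bounded_linear.has_vector_derivative[OF bounded_linear_scaleR_right]
        integral_has_vector_derivative[OF N R'])
  then have "((\<lambda>s. s\<^sup>2 *\<^sub>R integral {0..s} H - integral {0..s} (\<lambda>t. t\<^sup>2 *\<^sub>R H t)) has_vector_derivative 2 *\<^sub>R N R)
      (at R within {0..R})"
    by (rule has_vector_derivative_transform[rotated 2]) (use R eq in auto)
  ultimately have "(R\<^sup>2 *\<^sub>R H R + (2 * R) *\<^sub>R integral {0..R} H - R\<^sup>2 *\<^sub>R H R) = 2 *\<^sub>R N R"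
    using vector_derivative_unique_within_closed_interval[of 0 R R] R by simp
  then have "(2 * R) *\<^sub>R integral {0..R} H = 2 *\<^sub>R N R" by simp
  then have "(1 / (2 * R)) *\<^sub>R ((2 * R) *\<^sub>R integral {0..R} H) = (1 / (2 * R)) *\<^sub>R (2 *\<^sub>R N R)" by simp
  then have "integral {0..R} H = (1 / R) *\<^sub>R N R"
    using R by simp
  also have "\<dots> = sphere_integral z R (\<lambda>x. (1 / R) *\<^sub>R (((x - z) \<bullet> v) *\<^sub>R g x))"
    unfolding N_def using R
    by (intro sphere_integral_linear[symmetric] bounded_linear_scaleR_right continuous_on_subset[OF N_cont sph]) auto
  finally show ?thesis
    unfolding set_integral_cball_sphere_integral[OF cont] H_def by simp
qed


section \<open>Derivatives on the tube\<close>

text \<open>\<open>has_C1 S f f'\<close>: the function \<open>f\<close> has the derivative \<open>f' p\<close> within \<open>S\<close> at each point \<open>p\<close> of \<open>S\<close>, and \<open>f'\<close> is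
  continuous in \<open>p\<close> for each direction.  Unlike \<open>C1_on\<close>, it names the derivative, so that it is
  preserved by sums, products and compositions without uniqueness of derivatives.\<close>

definition has_C1 :: "spacetime set \<Rightarrow> (spacetime \<Rightarrow> 'b::real_normed_vector) \<Rightarrow> (spacetime \<Rightarrow> spacetime \<Rightarrow> 'b) \<Rightarrow> bool" where
  "has_C1 S f f' \<longleftrightarrow> (\<forall>p\<in>S. (f has_derivative f' p) (at p within S)) \<and> (\<forall>h. continuous_on S (\<lambda>p. f' p h))"

lemma has_C1_continuous: "has_C1 S f f' \<Longrightarrow> continuous_on S f"
  unfolding has_C1_def by (blast intro: has_derivative_continuous_on)

lemma C1_on_continuous: "C1_on S f \<Longrightarrow> continuous_on S f"
  by (simp add: C1_on_def differentiable_imp_continuous_on)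

lemma spacetime_decompose: "h = fst h *\<^sub>R (1, 0) + (\<Sum>i\<in>UNIV. snd h $ i *\<^sub>R (0, axis i 1))"
  for h :: spacetime
  by (cases h) (simp add: prod_eq_iff fst_sum snd_sum vec_eq_iff axis_def sum_3 forall_3)

lemma sum_axis_scaleR: "(\<Sum>j\<in>UNIV. axis i (1::real) $ j *\<^sub>R F j) = F i"
  for F :: "'n::finite \<Rightarrow> 'b::real_normed_vector"
proof -
  have "(\<Sum>j\<in>UNIV. axis i (1::real) $ j *\<^sub>R F j) = (\<Sum>j\<in>UNIV. if j = i then F j else 0)"
    by (intro sum.cong) (auto simp: axis_def)
  then show ?thesis by simp
qed

lemma linear_spacetime:
  fixes h :: spacetime
  assumes "linear D"
  shows "D h = fst h *\<^sub>R D (1, 0) + (\<Sum>i\<in>UNIV. snd h $ i *\<^sub>R D (0, axis i 1))"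
proof -
  interpret linear D by fact
  show ?thesis
    by (subst spacetime_decompose) (simp only: add scale sum)
qed

text \<open>The derivative assembled from the partial derivatives within \<open>S\<close>.\<close>

definition C1_deriv :: "spacetime set \<Rightarrow> (spacetime \<Rightarrow> 'b::real_normed_vector) \<Rightarrow> spacetime \<Rightarrow> spacetime \<Rightarrow> 'b" where
  "C1_deriv S f p h = fst h *\<^sub>R dt S f p + (\<Sum>i\<in>UNIV. snd h $ i *\<^sub>R dx S i f p)"

lemma differentiable_C1_deriv:
  assumes "f differentiable (at p within S)"
  shows "(f has_derivative C1_deriv S f p) (at p within S)"
proof -
  have D: "(f has_derivative frechet_derivative f (at p within S)) (at p within S)"
    using assms frechet_derivative_works by blast
  have "frechet_derivative f (at p within S) = C1_deriv S f p"
    by (rule ext) (simp add: C1_deriv_def dt_def dx_def flip: linear_spacetime[OF has_derivative_linear[OF D]])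
  with D show ?thesis by simp
qed

lemma C1_on_has_C1: "C1_on S f \<Longrightarrow> has_C1 S f (C1_deriv S f)"
  unfolding has_C1_def
  by (auto simp: C1_on_def differentiable_on_def intro: differentiable_C1_deriv)
    (auto simp: C1_deriv_def intro!: continuous_intros)

lemma has_C1_linear:
  assumes "bounded_linear L" "has_C1 S f f'"
  shows "has_C1 S (\<lambda>p. L (f p)) (\<lambda>p h. L (f' p h))"
  using assms(2) unfolding has_C1_def
  by (auto intro: bounded_linear.has_derivative[OF assms(1)] bounded_linear.continuous_on[OF assms(1)])

lemma has_C1_bilinear:
  assumes "bounded_bilinear B" "has_C1 S f f'" "has_C1 S g g'"
  shows "has_C1 S (\<lambda>p. B (f p) (g p)) (\<lambda>p h. B (f p) (g' p h) + B (f' p h) (g p))"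
  unfolding has_C1_def
proof (intro conjI ballI allI)
  show "((\<lambda>p. B (f p) (g p)) has_derivative (\<lambda>h. B (f p) (g' p h) + B (f' p h) (g p))) (at p within S)"
    if "p \<in> S" for p
    using assms(2,3) that unfolding has_C1_def by (intro bounded_bilinear.FDERIV[OF assms(1)]) blast+
  have "continuous_on S (\<lambda>p. f' p h)" "continuous_on S (\<lambda>p. g' p h)" for h
    using assms(2,3) unfolding has_C1_def by blast+
  then show "continuous_on S (\<lambda>p. B (f p) (g' p h) + B (f' p h) (g p))" for h
    by (intro continuous_on_add bounded_bilinear.continuous_on[OF assms(1)]
        has_C1_continuous[OF assms(2)] has_C1_continuous[OF assms(3)])
qed

lemma has_C1_add:
  "has_C1 S f f' \<Longrightarrow> has_C1 S g g' \<Longrightarrow> has_C1 S (\<lambda>p. f p + g p) (\<lambda>p h. f' p h + g' p h)"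
  unfolding has_C1_def by (auto intro!: has_derivative_add continuous_on_add)

lemma has_C1_const: "has_C1 S (\<lambda>p. k) (\<lambda>p h. 0)"
  unfolding has_C1_def by auto

lemma has_C1_snd: "has_C1 S snd (\<lambda>p h. snd h)"
  unfolding has_C1_def by (auto intro!: derivative_eq_intros)

lemma has_C1_vec:
  fixes f :: "spacetime \<Rightarrow> real^'n"
  assumes "\<And>i. has_C1 S (\<lambda>p. f p $ i) (f' i)"
  shows "has_C1 S f (\<lambda>p h. \<chi> i. f' i p h)"
  using assms unfolding has_C1_def
  by (auto simp: has_derivative_vec_iff intro!: continuous_on_vec_lambda)

lemma has_C1_compose:
  assumes f: "has_C1 S f f'" and G: "\<And>z. (G has_derivative G' z) (at z)"
    and cont: "continuous_on UNIV (\<lambda>(z, k). G' z k)"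
  shows "has_C1 S (\<lambda>p. G (f p)) (\<lambda>p h. G' (f p) (f' p h))"
  unfolding has_C1_def
proof (intro conjI ballI allI)
  show "((\<lambda>p. G (f p)) has_derivative (\<lambda>h. G' (f p) (f' p h))) (at p within S)" if "p \<in> S" for p
    using f that G has_derivative_compose[of f "f' p" p S G "G' (f p)"] unfolding has_C1_def by blast
  have "continuous_on S (\<lambda>p. (f p, f' p h))" for h
    using f unfolding has_C1_def by (intro continuous_on_Pair has_C1_continuous[OF f]) blast
  from continuous_on_compose2[OF cont this] show "continuous_on S (\<lambda>p. G' (f p) (f' p h))" for h
    by simp
qed

text \<open>A ball of fixed positive radius that moves along a trajectory; \<open>S\<close> is the tube which it sweeps.\<close>

locale moving_ball =
  fixes Tm Tp :: real and r :: "real \<Rightarrow> real^3" and R :: real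
  assumes T: "Tm < Tp" and traj: "trajectory Tm Tp r" and R: "0 < R"
begin

abbreviation "S \<equiv> tube Tm Tp r R"
abbreviation "v \<equiv> vel Tm Tp r"
abbreviation "I \<equiv> {Tm..Tp}"

lemma vel_deriv: "t \<in> I \<Longrightarrow> (r has_vector_derivative v t) (at t within I)"
  using traj unfolding trajectory_def vel_def differentiable_on_def
  by (auto simp: vector_derivative_works[symmetric])

lemma r_cont: "continuous_on I r"
  using traj differentiable_imp_continuous_on unfolding trajectory_def by blast

lemma v_cont: "continuous_on I v"
  using traj differentiable_imp_continuous_on unfolding trajectory_def by blast

lemma mem_tube: "(t, x) \<in> S \<longleftrightarrow> t \<in> I \<and> x \<in> cball (r t) R"
  by (auto simp: tube_def dist_norm norm_minus_commute)

text \<open>At a boundary point the tube need not contain a segment in the direction of each coordinate axis,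
  even locally.  It does contain curves that follow the motion of the ball while they move towards a
  point of it, and the initial velocities of these curves span the space.\<close>

lemma tube_unique:
  assumes p: "p \<in> S" and D1: "(f has_derivative D1) (at p within S)" and D2: "(f has_derivative D2) (at p within S)"
  shows "D1 = D2"
proof -
  obtain t x where px: "p = (t, x)" by (cases p)
  define y where "y = x - r t"
  have t: "t \<in> I" and y: "norm y \<le> R" using p by (auto simp: px mem_tube y_def dist_norm norm_minus_commute)
  define D where "D = (\<lambda>h. D1 h - D2 h)"
  have D: "((\<lambda>q. f q - f q) has_derivative D) (at p within S)"
    unfolding D_def by (rule has_derivative_diff[OF D1 D2])
  interpret D: linear D using D by (rule has_derivative_linear)
  have dir: "D (s - t, (s - t) *\<^sub>R v t + (w - y)) = 0" if s: "s \<in> I" and w: "w \<in> cball 0 R" for s w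
  proof -
    define g where "g = (\<lambda>e::real. t + e * (s - t))"
    \<comment> \<open>In the frame of the ball the curve runs straight from \<open>(t, y)\<close> to \<open>(s, w)\<close>.\<close>
    define \<gamma> where "\<gamma> = (\<lambda>e. (g e, r (g e) + (y + e *\<^sub>R (w - y))))"
    have gI: "g e \<in> I" if "e \<in> {0..1}" for e
      using convexD_alt[OF convex_real_interval(5) t s, of e] that by (simp add: g_def algebra_simps)
    have g: "(g has_vector_derivative (s - t)) (at 0 within {0..1})"
      unfolding g_def by (auto intro!: derivative_eq_intros simp: has_real_derivative_iff_has_vector_derivative[symmetric])
    have "(r has_vector_derivative v t) (at (g 0) within g ` {0..1})"
      using vel_deriv[OF t] gI by (auto intro: has_vector_derivative_within_subset simp: g_def)
    from vector_diff_chain_within[OF g this]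
    have rg: "((\<lambda>e. r (g e)) has_vector_derivative (s - t) *\<^sub>R v t) (at 0 within {0..1})"
      by (simp add: o_def)
    have \<gamma>: "(\<gamma> has_vector_derivative (s - t, (s - t) *\<^sub>R v t + (w - y))) (at 0 within {0..1})"
    proof -
      have "((\<lambda>e. y + e *\<^sub>R (w - y)) has_vector_derivative w - y) (at 0 within {0..1})"
        by (auto simp: has_vector_derivative_def intro!: derivative_eq_intros)
      then show ?thesis
        unfolding \<gamma>_def by (intro has_vector_derivative_Pair has_vector_derivative_add g rg)
    qed
    have \<gamma>S: "\<gamma> ` {0..1} \<subseteq> S"
    proof
      fix q assume "q \<in> \<gamma> ` {0..1}"
      then obtain e where e: "e \<in> {0..1}" "q = \<gamma> e" by auto
      have "y + e *\<^sub>R (w - y) \<in> cball 0 R"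
        using convexD_alt[OF convex_cball, of y 0 R w e] y w e by (simp add: algebra_simps)
      then show "q \<in> S" using gI[OF e(1)] by (simp add: e(2) \<gamma>_def mem_tube dist_norm)
    qed
    have "\<gamma> 0 = p" by (simp add: \<gamma>_def g_def px y_def)
    then have "((\<lambda>q. f q - f q) has_derivative D) (at (\<gamma> 0) within \<gamma> ` {0..1})"
      using has_derivative_subset[OF D \<gamma>S] by simp
    from diff_chain_within[OF \<gamma>[unfolded has_vector_derivative_def] this]
    have "((\<lambda>e::real. 0) has_derivative (\<lambda>e. D (e *\<^sub>R (s - t, (s - t) *\<^sub>R v t + (w - y))))) (at 0 within {0..1})"
      by (simp add: o_def)
    then have "((\<lambda>e::real. 0) has_vector_derivative D (s - t, (s - t) *\<^sub>R v t + (w - y))) (at 0 within {0..1})"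
      unfolding has_vector_derivative_def D.scale .
    then show ?thesis
      by (intro vector_derivative_unique_within_closed_interval[of 0 1 0 "\<lambda>e. 0"]) simp_all
  qed
  have sp: "D (0, h) = 0" for h
  proof -
    have 1: "D (0, w - y) = 0" if "w \<in> cball 0 R" for w
      using dir[OF t that] by simp
    have 2: "D (0, w) = 0" if "w \<in> cball 0 R" for w
      using 1[OF that] 1[of 0] R D.diff[of "(0, w - y)" "(0, 0 - y)"] by simp
    show ?thesis
    proof (cases "h = 0")
      case True then show ?thesis using D.zero by (simp add: zero_prod_def)
    next
      case False
      have "D ((norm h / R) *\<^sub>R (0, (R / norm h) *\<^sub>R h)) = 0"
        unfolding D.scale using 2[of "(R / norm h) *\<^sub>R h"] R by simp
      then show ?thesis using False R by simp
    qed
  qed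
  define s where "s = (if t = Tm then Tp else Tm)"
  have s: "s \<in> I" "s \<noteq> t" using T by (auto simp: s_def)
  have "D (s - t, 0) = 0"
    using dir[OF s(1), of 0] R sp D.diff[of "(s - t, (s - t) *\<^sub>R v t + (0 - y))" "(0, (s - t) *\<^sub>R v t + (0 - y))"]
    by simp
  then have "D ((s - t) *\<^sub>R (1, 0)) = 0" by simp
  then have tm: "D (1, 0) = 0" using s(2) unfolding D.scale by simp
  have "D h = 0" for h
    using linear_spacetime[OF D.linear_axioms, of h] by (simp add: tm sp)
  then show ?thesis by (auto simp: D_def)
qed

lemma
  assumes "has_C1 S f f'"
  shows has_C1_C1_on: "C1_on S f"
    and has_C1_dt: "p \<in> S \<Longrightarrow> dt S f p = f' p (1, 0)"
    and has_C1_dx: "p \<in> S \<Longrightarrow> dx S i f p = f' p (0, axis i 1)"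
proof -
  have d: "f differentiable (at p within S)" if "p \<in> S" for p
    using assms that unfolding has_C1_def differentiable_def by blast
  have eq: "frechet_derivative f (at p within S) = f' p" if "p \<in> S" for p
  proof (rule tube_unique[OF that])
    show "(f has_derivative frechet_derivative f (at p within S)) (at p within S)"
      using d[OF that] frechet_derivative_works by blast
    show "(f has_derivative f' p) (at p within S)" using assms that unfolding has_C1_def by blast
  qed
  show 1: "dt S f p = f' p (1, 0)" if "p \<in> S" for p using eq[OF that] by (simp add: dt_def)
  show 2: "dx S i f p = f' p (0, axis i 1)" if "p \<in> S" for p i using eq[OF that] by (simp add: dx_def)
  have c: "continuous_on S (\<lambda>p. f' p h)" for h using assms unfolding has_C1_def by blast
  show "C1_on S f"
    unfolding C1_on_def differentiable_on_def
  proof (intro conjI ballI allI)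
    show "continuous_on S (dt S f)"
      by (rule continuous_on_eq[OF c[of "(1, 0)"]]) (simp add: 1)
    show "continuous_on S (dx S i f)" for i
      by (rule continuous_on_eq[OF c[of "(0, axis i 1)"]]) (simp add: 2)
  qed (rule d)
qed

lemma C1_on_linear: "bounded_linear L \<Longrightarrow> C1_on S f \<Longrightarrow> C1_on S (\<lambda>p. L (f p))"
  by (rule has_C1_C1_on[OF has_C1_linear[OF _ C1_on_has_C1]])

lemma C1_on_bilinear: "bounded_bilinear B \<Longrightarrow> C1_on S f \<Longrightarrow> C1_on S g \<Longrightarrow> C1_on S (\<lambda>p. B (f p) (g p))"
  by (rule has_C1_C1_on[OF has_C1_bilinear[OF _ C1_on_has_C1 C1_on_has_C1]])

lemma C1_on_add: "C1_on S f \<Longrightarrow> C1_on S g \<Longrightarrow> C1_on S (\<lambda>p. f p + g p)"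
  by (rule has_C1_C1_on[OF has_C1_add[OF C1_on_has_C1 C1_on_has_C1]])

lemma C1_on_const: "C1_on S (\<lambda>p. k)"
  by (rule has_C1_C1_on[OF has_C1_const])

lemma C1_on_snd: "C1_on S snd"
  by (rule has_C1_C1_on[OF has_C1_snd])

lemma C1_on_vec: "(\<And>i. C1_on S (\<lambda>p. f p $ i)) \<Longrightarrow> C1_on S f" for f :: "spacetime \<Rightarrow> real^'n"
  by (rule has_C1_C1_on[OF has_C1_vec[OF C1_on_has_C1]])

lemma C1_on_cong:
  assumes "C1_on S f" "\<And>p. p \<in> S \<Longrightarrow> f p = g p"
  shows "C1_on S g"
proof -
  have "has_C1 S g (C1_deriv S f)"
    using C1_on_has_C1[OF assms(1)] has_derivative_transform[of _ S g f] assms(2)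
    unfolding has_C1_def by auto
  then show ?thesis by (rule has_C1_C1_on)
qed

lemma dt_linear: "bounded_linear L \<Longrightarrow> C1_on S f \<Longrightarrow> p \<in> S \<Longrightarrow> dt S (\<lambda>p. L (f p)) p = L (dt S f p)"
  by (subst has_C1_dt[OF has_C1_linear[OF _ C1_on_has_C1]]) (simp_all add: C1_deriv_def)

lemma C1_deriv_axis [simp]: "C1_deriv S f p (0, axis i 1) = dx S i f p"
  by (simp add: C1_deriv_def sum_axis_scaleR)

lemma C1_deriv_time [simp]: "C1_deriv S f p (1, 0) = dt S f p"
  by (simp add: C1_deriv_def)

section \<open>Integrals over a moving ball\<close>

lemma slice_cont: "continuous_on S f \<Longrightarrow> t \<in> I \<Longrightarrow> continuous_on (cball (r t) R) (\<lambda>x. f (t, x))"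
  by (rule continuous_on_compose2[of S f]) (auto intro!: continuous_intros simp: mem_tube)

lemma slice_cont_sphere: "continuous_on S f \<Longrightarrow> t \<in> I \<Longrightarrow> continuous_on (sphere (r t) R) (\<lambda>x. f (t, x))"
  by (rule continuous_on_subset[OF slice_cont]) auto

lemma slice_deriv:
  assumes f: "C1_on S f" and t: "t \<in> I" and x: "x \<in> cball (r t) R"
  shows "((\<lambda>x. f (t, x)) has_derivative (\<lambda>h. \<Sum>i\<in>UNIV. h $ i *\<^sub>R dx S i f (t, x))) (at x within cball (r t) R)"
proof -
  have "(f has_derivative C1_deriv S f (t, x)) (at (t, x) within S)"
    using C1_on_has_C1[OF f] t x unfolding has_C1_def by (simp add: mem_tube)
  then have "(f has_derivative C1_deriv S f (t, x)) (at (t, x) within Pair t ` cball (r t) R)"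
    by (rule has_derivative_subset) (use t in \<open>auto simp: mem_tube\<close>)
  moreover have "(Pair t has_derivative (\<lambda>h. (0, h))) (at x within cball (r t) R)"
    by (auto intro!: derivative_eq_intros)
  ultimately show ?thesis
    using diff_chain_within[of "Pair t" "\<lambda>h. (0, h)" x "cball (r t) R" f "C1_deriv S f (t, x)"]
    by (simp add: o_def C1_deriv_def)
qed

lemma gauss_direction:
  fixes f :: "spacetime \<Rightarrow> 'b::euclidean_space"
  assumes f: "C1_on S f" and t: "t \<in> I"
  shows "ball_int r R (\<lambda>p. \<Sum>i\<in>UNIV. w $ i *\<^sub>R dx S i f p) t = bdry_int r R (\<lambda>p. (unit_normal r R p \<bullet> w) *\<^sub>R f p) t"
proof -
  have "continuous_on (cball (r t) R) (\<lambda>x. \<Sum>i\<in>UNIV. h $ i *\<^sub>R dx S i f (t, x))" for h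
    using f t by (intro continuous_intros slice_cont) (auto simp: C1_on_def)
  from integral_cball_directional_derivative[OF R slice_deriv[OF f t] this, of w]
  show ?thesis
    by (simp add: ball_int_def bdry_int_def unit_normal_def)
qed

lemma gauss_axis:
  fixes f :: "spacetime \<Rightarrow> 'b::euclidean_space"
  assumes f: "C1_on S f" and t: "t \<in> I"
  shows "ball_int r R (dx S i f) t = bdry_int r R (\<lambda>p. (unit_normal r R p $ i) *\<^sub>R f p) t"
  using gauss_direction[OF f t, of "axis i 1"] by (simp add: inner_axis sum_axis_scaleR)

lemma ball_int_add:
  fixes f g :: "spacetime \<Rightarrow> 'b::euclidean_space"
  assumes "continuous_on S f" "continuous_on S g" "t \<in> I"
  shows "ball_int r R (\<lambda>p. f p + g p) t = ball_int r R f t + ball_int r R g t"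
  unfolding ball_int_def
  by (intro set_integral_add set_integrable_cball slice_cont assms)

lemma ball_int_linear:
  fixes f :: "spacetime \<Rightarrow> 'b::euclidean_space" and L :: "'b \<Rightarrow> 'c::euclidean_space"
  assumes "bounded_linear L" "continuous_on S f" "t \<in> I"
  shows "ball_int r R (\<lambda>p. L (f p)) t = L (ball_int r R f t)"
proof -
  interpret L: bounded_linear L by fact
  show ?thesis
    using integral_bounded_linear[OF assms(1) set_integrable_cball[OF slice_cont[OF assms(2,3)], unfolded set_integrable_def]]
    by (simp add: ball_int_def set_lebesgue_integral_def L.scaleR)
qed

lemma ball_int_cong:
  assumes "t \<in> I" "\<And>x. x \<in> cball (r t) R \<Longrightarrow> f (t, x) = g (t, x)"
  shows "ball_int r R f t = ball_int r R g t"
  unfolding ball_int_def using assms by (intro set_lebesgue_integral_cong) auto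

lemma bdry_int_add:
  fixes f g :: "spacetime \<Rightarrow> 'b::euclidean_space"
  assumes "continuous_on S f" "continuous_on S g" "t \<in> I"
  shows "bdry_int r R (\<lambda>p. f p + g p) t = bdry_int r R f t + bdry_int r R g t"
  unfolding bdry_int_def using R assms
  by (intro sphere_integral_add slice_cont_sphere) auto

lemma bdry_int_linear:
  fixes f :: "spacetime \<Rightarrow> 'b::euclidean_space" and L :: "'b \<Rightarrow> 'c::euclidean_space"
  assumes "bounded_linear L" "continuous_on S f" "t \<in> I"
  shows "bdry_int r R (\<lambda>p. L (f p)) t = L (bdry_int r R f t)"
  unfolding bdry_int_def using R assms
  by (intro sphere_integral_linear slice_cont_sphere) auto

lemma spherical_integrand_cont:
  fixes f :: "spacetime \<Rightarrow> 'b::euclidean_space"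
  assumes "continuous_on S f"
  shows "continuous_on (I \<times> cbox (0, 0, 0) (R, pi, 2 * pi))
    (\<lambda>(t, s, \<theta>, \<phi>). (s\<^sup>2 * sin \<theta>) *\<^sub>R f (t, r t + s *\<^sub>R sphere_point \<theta> \<phi>))"
  unfolding case_prod_unfold
  by (intro continuous_intros continuous_on_compose2[OF assms] continuous_on_compose2[OF r_cont])
    (auto simp: mem_tube dist_norm)

lemma ball_int_eq:
  fixes f :: "spacetime \<Rightarrow> 'b::euclidean_space"
  assumes "continuous_on S f" "t \<in> I"
  shows "ball_int r R f t = integral (cbox (0, 0, 0) (R, pi, 2 * pi))
    (\<lambda>(s, \<theta>, \<phi>). (s\<^sup>2 * sin \<theta>) *\<^sub>R f (t, r t + s *\<^sub>R sphere_point \<theta> \<phi>))"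
  unfolding ball_int_def by (rule set_integral_cball_spherical[OF slice_cont[OF assms]])

lemma ball_int_cont:
  fixes f :: "spacetime \<Rightarrow> 'b::euclidean_space"
  assumes "continuous_on S f"
  shows "continuous_on I (ball_int r R f)"
  using integral_continuous_on_param[OF spherical_integrand_cont[OF assms]]
  by (rule continuous_on_eq) (simp add: ball_int_eq[OF assms])

lemma bdry_int_cont:
  fixes f :: "spacetime \<Rightarrow> 'b::euclidean_space"
  assumes "continuous_on S f"
  shows "continuous_on I (bdry_int r R f)"
proof -
  have F: "continuous_on (I \<times> cbox (0, 0) (pi, 2 * pi))
      (\<lambda>(t, p). case p of (\<theta>, \<phi>) \<Rightarrow> (R\<^sup>2 * sin \<theta>) *\<^sub>R f (t, r t + R *\<^sub>R sphere_point \<theta> \<phi>))"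
    unfolding case_prod_unfold using R
    by (intro continuous_intros continuous_on_compose2[OF assms] continuous_on_compose2[OF r_cont])
      (auto simp: mem_tube dist_norm)
  show ?thesis
    using integral_continuous_on_param[OF F]
    by (rule continuous_on_eq) (use R in \<open>simp add: bdry_int_def sphere_integral_eq[OF slice_cont_sphere[OF assms]]\<close>)
qed

lemma unit_normal_cont: "continuous_on S (unit_normal r R)"
proof -
  have "continuous_on S (\<lambda>p. r (fst p))"
    by (rule continuous_on_compose2[OF r_cont]) (auto intro!: continuous_intros simp: tube_def)
  then show ?thesis unfolding unit_normal_def by (auto intro!: continuous_intros)
qed

lemma time_cont: "continuous_on I g \<Longrightarrow> continuous_on S (\<lambda>p. g (fst p))"
  by (rule continuous_on_compose2[of I g]) (auto intro!: continuous_intros simp: tube_def)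

text \<open>The derivative of \<open>f\<close> along a point carried by the ball.\<close>

lemma material_derivative:
  assumes f: "C1_on S f" and t: "t \<in> I" and y: "y \<in> cball 0 R"
  shows "((\<lambda>t. f (t, r t + y)) has_vector_derivative
    (dt S f (t, r t + y) + (\<Sum>i\<in>UNIV. v t $ i *\<^sub>R dx S i f (t, r t + y)))) (at t within I)"
proof -
  define \<gamma> where "\<gamma> = (\<lambda>t. (t, r t + y))"
  have "(f has_derivative C1_deriv S f (\<gamma> t)) (at (\<gamma> t) within S)"
    using C1_on_has_C1[OF f] t y unfolding has_C1_def by (simp add: mem_tube \<gamma>_def dist_norm)
  then have 1: "(f has_derivative C1_deriv S f (\<gamma> t)) (at (\<gamma> t) within \<gamma> ` I)"
    by (rule has_derivative_subset) (use y in \<open>auto simp: mem_tube \<gamma>_def dist_norm\<close>)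
  have "(\<gamma> has_vector_derivative (1, v t)) (at t within I)"
    using has_vector_derivative_add[OF vel_deriv[OF t] has_vector_derivative_const[of y]]
    unfolding \<gamma>_def by (intro has_vector_derivative_Pair has_vector_derivative_id) simp
  from vector_derivative_diff_chain_within[OF this 1] show ?thesis
    by (simp add: o_def \<gamma>_def C1_deriv_def)
qed

text \<open>Reynolds' transport theorem.  In spherical coordinates around the moving center the domain of
  integration is fixed, so that the integral can be differentiated under the integral sign; the
  convective part of the derivative becomes a surface integral by the divergence theorem.\<close>

lemma reynolds:
  fixes f :: "spacetime \<Rightarrow> 'b::euclidean_space"
  assumes f: "C1_on S f" and t: "t \<in> I"
  shows "(ball_int r R f has_vector_derivative
    (ball_int r R (dt S f) t + bdry_int r R (\<lambda>p. (v (fst p) \<bullet> unit_normal r R p) *\<^sub>R f p) t)) (at t within I)"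
proof -
  let ?B = "cbox (0, 0, 0) (R, pi, 2 * pi) :: (real \<times> real \<times> real) set"
  let ?g = "\<lambda>p. dt S f p + (\<Sum>i\<in>UNIV. v (fst p) $ i *\<^sub>R dx S i f p)"
  have fc: "continuous_on S f" and dtc: "continuous_on S (dt S f)" and dxc: "continuous_on S (dx S i f)" for i
    using f C1_on_continuous by (auto simp: C1_on_def)
  have gc: "continuous_on S ?g"
    by (intro continuous_intros dtc dxc time_cont v_cont)
  have "((\<lambda>t. integral ?B (\<lambda>(s, \<theta>, \<phi>). (s\<^sup>2 * sin \<theta>) *\<^sub>R f (t, r t + s *\<^sub>R sphere_point \<theta> \<phi>)))
      has_vector_derivative integral ?B (\<lambda>(s, \<theta>, \<phi>). (s\<^sup>2 * sin \<theta>) *\<^sub>R ?g (t, r t + s *\<^sub>R sphere_point \<theta> \<phi>)))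
      (at t within I)"
  proof (rule leibniz_rule_vector_derivative)
    fix t p assume t: "t \<in> I" and p: "p \<in> ?B"
    obtain s \<theta> \<phi> where p': "p = (s, \<theta>, \<phi>)" by (cases p)
    have "s *\<^sub>R sphere_point \<theta> \<phi> \<in> cball 0 R" using p by (auto simp: p')
    from material_derivative[OF f t this]
    have "((\<lambda>t. (s\<^sup>2 * sin \<theta>) *\<^sub>R f (t, r t + s *\<^sub>R sphere_point \<theta> \<phi>)) has_vector_derivative
       (s\<^sup>2 * sin \<theta>) *\<^sub>R ?g (t, r t + s *\<^sub>R sphere_point \<theta> \<phi>)) (at t within I)"
      by (intro bounded_linear.has_vector_derivative[OF bounded_linear_scaleR_right]) simp
    then show "((\<lambda>t. case p of (s, \<theta>, \<phi>) \<Rightarrow> (s\<^sup>2 * sin \<theta>) *\<^sub>R f (t, r t + s *\<^sub>R sphere_point \<theta> \<phi>)) has_vector_derivative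
       (case p of (s, \<theta>, \<phi>) \<Rightarrow> (s\<^sup>2 * sin \<theta>) *\<^sub>R ?g (t, r t + s *\<^sub>R sphere_point \<theta> \<phi>))) (at t within I)"
      by (simp add: p')
  next
    fix t assume t: "t \<in> I"
    have "continuous_on ?B (\<lambda>p. case (t, p) of (t, s, \<theta>, \<phi>) \<Rightarrow> (s\<^sup>2 * sin \<theta>) *\<^sub>R f (t, r t + s *\<^sub>R sphere_point \<theta> \<phi>))"
      by (rule continuous_on_compose2[OF spherical_integrand_cont[OF fc]]) (use t in \<open>auto intro!: continuous_intros simp del: cbox_Pair_eq\<close>)
    then show "(\<lambda>(s, \<theta>, \<phi>). (s\<^sup>2 * sin \<theta>) *\<^sub>R f (t, r t + s *\<^sub>R sphere_point \<theta> \<phi>)) integrable_on ?B"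
      by (intro integrable_continuous) simp
  next
    show "continuous_on (I \<times> ?B) (\<lambda>(t, p). case p of (s, \<theta>, \<phi>) \<Rightarrow>
        (s\<^sup>2 * sin \<theta>) *\<^sub>R ?g (t, r t + s *\<^sub>R sphere_point \<theta> \<phi>))"
      by (rule spherical_integrand_cont[OF gc])
  qed (use t in auto)
  then have "(ball_int r R f has_vector_derivative ball_int r R ?g t) (at t within I)"
    unfolding ball_int_eq[OF gc t]
    by (rule has_vector_derivative_transform[OF t, rotated]) (simp add: ball_int_eq[OF fc])
  moreover have "ball_int r R ?g t = ball_int r R (dt S f) t + ball_int r R (\<lambda>p. \<Sum>i\<in>UNIV. v (fst p) $ i *\<^sub>R dx S i f p) t"
    by (intro ball_int_add t dtc continuous_intros dxc time_cont v_cont)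
  moreover have "ball_int r R (\<lambda>p. \<Sum>i\<in>UNIV. v (fst p) $ i *\<^sub>R dx S i f p) t
      = bdry_int r R (\<lambda>p. (unit_normal r R p \<bullet> v t) *\<^sub>R f p) t"
    using gauss_direction[OF f t, of "v t"] by (simp add: ball_int_def)
  moreover have "\<dots> = bdry_int r R (\<lambda>p. (v (fst p) \<bullet> unit_normal r R p) *\<^sub>R f p) t"
    by (simp add: bdry_int_def inner_commute)
  ultimately show ?thesis by simp
qed

end


section \<open>Time integrals and uniformly vanishing sequences\<close>

lemma bounded_bilinear_cross3: "bounded_bilinear cross3"
  using bilinear_cross by (simp add: bilinear_conv_bounded_bilinear)

lemma time_int_FTC:
  fixes F :: "real \<Rightarrow> 'b::euclidean_space"
  assumes g: "continuous_on {a..b} g" and F: "\<And>t. t \<in> {a..b} \<Longrightarrow> (F has_vector_derivative g t) (at t within {a..b})"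
    and t: "t0 \<in> {a..b}" "t \<in> {a..b}"
  shows "time_int t0 g t = F t - F t0"
proof -
  have sub: "{min t0 t..max t0 t} \<subseteq> {a..b}" using t by auto
  show ?thesis
    unfolding time_int_def
  proof (rule interval_integral_FTC_finite)
    show "continuous_on {min t0 t..max t0 t} g" by (rule continuous_on_subset[OF g sub])
    show "(F has_vector_derivative g x) (at x within {min t0 t..max t0 t})"
      if "min t0 t \<le> x" "x \<le> max t0 t" for x
      by (rule has_vector_derivative_within_subset[OF F sub]) (use that sub in auto)
  qed
qed

lemma time_int_eq:
  fixes g :: "real \<Rightarrow> 'b::euclidean_space"
  assumes g: "continuous_on {a..b} g" and t: "t0 \<in> {a..b}" "t \<in> {a..b}"
  shows "time_int t0 g t = integral {a..t} g - integral {a..t0} g"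
  by (rule time_int_FTC[OF g integral_has_vector_derivative[OF g] t])

lemma time_int_deriv:
  fixes g :: "real \<Rightarrow> 'b::euclidean_space"
  assumes g: "continuous_on {a..b} g" and t: "t0 \<in> {a..b}" "t \<in> {a..b}"
  shows "(time_int t0 g has_vector_derivative g t) (at t within {a..b})"
proof -
  have "((\<lambda>t. integral {a..t} g - integral {a..t0} g) has_vector_derivative g t - 0) (at t within {a..b})"
    by (intro has_vector_derivative_diff integral_has_vector_derivative g t has_vector_derivative_const)
  then have "((\<lambda>t. integral {a..t} g - integral {a..t0} g) has_vector_derivative g t) (at t within {a..b})"
    by simp
  then show ?thesis
    by (rule has_vector_derivative_transform[OF t(2), rotated]) (simp add: time_int_eq[OF g t(1)])
qed

lemma time_int_cont:
  fixes g :: "real \<Rightarrow> 'b::euclidean_space"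
  assumes "continuous_on {a..b} g" "t0 \<in> {a..b}"
  shows "continuous_on {a..b} (time_int t0 g)"
  by (rule continuous_on_vector_derivative) (rule time_int_deriv[OF assms])

lemma time_int_add:
  fixes f g :: "real \<Rightarrow> 'b::euclidean_space"
  assumes f: "continuous_on {a..b} f" and g: "continuous_on {a..b} g" and t: "t0 \<in> {a..b}" "t \<in> {a..b}"
  shows "time_int t0 (\<lambda>s. f s + g s) t = time_int t0 f t + time_int t0 g t"
proof -
  have "time_int t0 (\<lambda>s. f s + g s) t = (time_int t0 f t + time_int t0 g t) - (time_int t0 f t0 + time_int t0 g t0)"
    by (rule time_int_FTC[OF _ _ t]) (intro continuous_on_add has_vector_derivative_add time_int_deriv f g t)+
  then show ?thesis
    using t by (simp add: time_int_eq[OF f] time_int_eq[OF g])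
qed

lemma time_int_linear:
  fixes f :: "real \<Rightarrow> 'b::euclidean_space" and L :: "'b \<Rightarrow> 'c::euclidean_space"
  assumes L: "bounded_linear L" and f: "continuous_on {a..b} f" and t: "t0 \<in> {a..b}" "t \<in> {a..b}"
  shows "time_int t0 (\<lambda>s. L (f s)) t = L (time_int t0 f t)"
proof -
  interpret bounded_linear L by fact
  have "time_int t0 (\<lambda>s. L (f s)) t = L (time_int t0 f t) - L (time_int t0 f t0)"
    by (rule time_int_FTC[OF _ _ t]) (intro bounded_linear.continuous_on[OF L]
        bounded_linear.has_vector_derivative[OF L] time_int_deriv f t)+
  then show ?thesis
    using t by (simp add: time_int_eq[OF f])
qed

lemma time_int_diff:
  fixes f g :: "real \<Rightarrow> 'b::euclidean_space"
  assumes f: "continuous_on {a..b} f" and g: "continuous_on {a..b} g" and t: "t0 \<in> {a..b}" "t \<in> {a..b}"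
  shows "time_int t0 (\<lambda>s. f s - g s) t = time_int t0 f t - time_int t0 g t"
  using time_int_add[OF f continuous_on_minus[OF g] t]
    time_int_linear[OF bounded_linear_minus[OF bounded_linear_ident] g t] by simp

lemma time_int_cong:
  assumes t: "t0 \<in> {a..b}" "t \<in> {a..b}" and "\<And>s. s \<in> {a..b} \<Longrightarrow> f s = g s"
  shows "time_int t0 f t = time_int t0 g t"
  unfolding time_int_def
  by (rule interval_integral_cong) (use assms in \<open>auto simp: min_def max_def split: if_splits\<close>)

lemma time_int_bound:
  fixes g :: "real \<Rightarrow> 'b::euclidean_space"
  assumes g: "continuous_on {a..b} g" and t: "t0 \<in> {a..b}" "t \<in> {a..b}"
    and B: "\<And>s. s \<in> {a..b} \<Longrightarrow> norm (g s) \<le> B"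
  shows "norm (time_int t0 g t) \<le> B * (b - a)"
proof -
  have "norm (time_int t0 g t - time_int t0 g t0) \<le> B * norm (t - t0)"
  proof (rule differentiable_bound[of "{a..b}" _ "\<lambda>s h. h *\<^sub>R g s"])
    show "(time_int t0 g has_derivative (\<lambda>h. h *\<^sub>R g s)) (at s within {a..b})" if "s \<in> {a..b}" for s
      using time_int_deriv[OF g t(1) that] by (simp add: has_vector_derivative_def)
    show "onorm (\<lambda>h. h *\<^sub>R g s) \<le> B" if "s \<in> {a..b}" for s
      by (rule onorm_le) (use B[OF that] in \<open>simp add: mult_right_mono mult.commute[of _ "\<bar>_\<bar>"] mult_left_mono\<close>)
  qed (use t in auto)
  also have "\<dots> \<le> B * (b - a)"
    using t order_trans[OF norm_ge_zero B[OF t(1)]] by (intro mult_left_mono) auto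
  finally show ?thesis using t by (simp add: time_int_eq[OF g])
qed

text \<open>\<open>unull A f\<close>: the sequence \<open>f\<close> tends to 0 uniformly on \<open>A\<close>.\<close>

abbreviation unull :: "real set \<Rightarrow> (nat \<Rightarrow> real \<Rightarrow> 'b::real_normed_vector) \<Rightarrow> bool" where
  "unull A f \<equiv> uniform_limit A f (\<lambda>_. 0) sequentially"

lemma unull_iff: "unull A f \<longleftrightarrow> (\<forall>e>0. \<forall>\<^sub>F n in sequentially. \<forall>t\<in>A. norm (f n t) < e)"
  by (simp add: uniform_limit_iff)

lemma unull_cong:
  assumes "unull A f" "\<forall>\<^sub>F n in sequentially. \<forall>t\<in>A. f n t = g n t"
  shows "unull A g"
  using uniform_limit_cong[OF assms(2), of "\<lambda>_. 0" "\<lambda>_. 0"] assms(1) by simp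

lemma unull_add: "unull A f \<Longrightarrow> unull A g \<Longrightarrow> unull A (\<lambda>n t. f n t + g n t)"
  using uniform_limit_add[where f = f and l = "\<lambda>_. 0" and g = g and m = "\<lambda>_. 0"] by simp

lemma unull_diff: "unull A f \<Longrightarrow> unull A g \<Longrightarrow> unull A (\<lambda>n t. f n t - g n t)"
  using uniform_limit_minus[where f = f and l = "\<lambda>_. 0" and g = g and m = "\<lambda>_. 0"] by simp

lemma unull_le:
  assumes f: "unull A f" and "\<forall>\<^sub>F n in sequentially. \<forall>t\<in>A. norm (g n t) \<le> K * norm (f n t)"
  shows "unull A g"
  unfolding unull_iff
proof (intro allI impI)
  fix e :: real assume "e > 0"
  then have "e / (\<bar>K\<bar> + 1) > 0" by (simp add: add_nonneg_pos)
  with f have "\<forall>\<^sub>F n in sequentially. \<forall>t\<in>A. norm (f n t) < e / (\<bar>K\<bar> + 1)"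
    unfolding unull_iff by blast
  with assms(2) show "\<forall>\<^sub>F n in sequentially. \<forall>t\<in>A. norm (g n t) < e"
  proof eventually_elim
    case (elim n)
    show ?case
    proof
      fix t assume t: "t \<in> A"
      have "norm (g n t) \<le> K * norm (f n t)" using elim t by blast
      also have "\<dots> \<le> (\<bar>K\<bar> + 1) * norm (f n t)" by (intro mult_right_mono) auto
      also have "\<dots> < e" using elim t by (simp add: field_simps add_nonneg_pos)
      finally show "norm (g n t) < e" .
    qed
  qed
qed

lemma unull_linear:
  assumes L: "bounded_linear L" and f: "unull A f"
  shows "unull A (\<lambda>n t. L (f n t))"
proof -
  obtain K where "\<And>x. norm (L x) \<le> norm x * K" using bounded_linear.bounded[OF L] by blast
  then show ?thesis by (intro unull_le[OF f, of _ K]) (simp add: mult.commute)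
qed

lemma unull_bilinear:
  assumes B: "bounded_bilinear B" and f: "unull A f"
    and g: "\<forall>\<^sub>F n in sequentially. \<forall>t\<in>A. norm (g n t) \<le> C"
  shows "unull A (\<lambda>n t. B (f n t) (g n t))"
proof -
  obtain K where K: "K \<ge> 0" "\<And>a b. norm (B a b) \<le> norm a * norm b * K"
    using bounded_bilinear.nonneg_bounded[OF B] by blast
  show ?thesis
  proof (rule unull_le[OF f])
    show "\<forall>\<^sub>F n in sequentially. \<forall>t\<in>A. norm (B (f n t) (g n t)) \<le> (C * K) * norm (f n t)"
      using g
    proof eventually_elim
      case (elim n)
      show ?case
      proof
        fix t assume "t \<in> A"
        then have "norm (f n t) * norm (g n t) * K \<le> norm (f n t) * C * K"
          using elim K(1) by (intro mult_right_mono mult_left_mono) auto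
        then show "norm (B (f n t) (g n t)) \<le> (C * K) * norm (f n t)"
          using K(2)[of "f n t" "g n t"] by (simp add: mult.commute mult.left_commute)
      qed
    qed
  qed
qed

lemma unull_time_int:
  fixes f :: "nat \<Rightarrow> real \<Rightarrow> 'b::euclidean_space"
  assumes f: "unull {a..b} f" and c: "\<forall>\<^sub>F n in sequentially. continuous_on {a..b} (f n)"
    and t0: "t0 \<in> {a..b}"
  shows "unull {a..b} (\<lambda>n. time_int t0 (f n))"
  unfolding unull_iff
proof (intro allI impI)
  fix e :: real assume e: "e > 0"
  have ab: "a \<le> b" using t0 by simp
  have "e / (2 * (b - a + 1)) > 0" using e ab by simp
  with f have "\<forall>\<^sub>F n in sequentially. \<forall>t\<in>{a..b}. norm (f n t) < e / (2 * (b - a + 1))"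
    unfolding unull_iff by blast
  with c show "\<forall>\<^sub>F n in sequentially. \<forall>t\<in>{a..b}. norm (time_int t0 (f n) t) < e"
  proof eventually_elim
    case (elim n)
    show ?case
    proof
      fix t assume t: "t \<in> {a..b}"
      have "norm (time_int t0 (f n) t) \<le> e / (2 * (b - a + 1)) * (b - a)"
        using elim t0 t by (intro time_int_bound) (auto intro: less_imp_le)
      also have "\<dots> < e" using e ab by (simp add: field_simps add_strict_increasing)
      finally show "norm (time_int t0 (f n) t) < e" .
    qed
  qed
qed

lemma unull_const:
  assumes "f \<longlonglongrightarrow> 0" shows "unull A (\<lambda>n t. f n)"
  using assms unfolding unull_iff tendsto_iff by (auto elim: eventually_mono)

lemma unull_pointwise: "unull A f \<Longrightarrow> t \<in> A \<Longrightarrow> (\<lambda>n. f n t) \<longlonglongrightarrow> 0"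
  by (rule tendsto_uniform_limitI)

lemma continuous_on_cross3 [continuous_intros]:
  "continuous_on A f \<Longrightarrow> continuous_on A g \<Longrightarrow> continuous_on A (\<lambda>x. cross3 (f x) (g x))"
  by (rule bounded_bilinear.continuous_on[OF bounded_bilinear_cross3])

lemma continuous_on_Icc_bounded:
  fixes f :: "real \<Rightarrow> 'b::real_normed_vector"
  assumes "continuous_on {a..b} f"
  obtains C where "\<And>t. t \<in> {a..b} \<Longrightarrow> norm (f t) \<le> C"
proof -
  have "bounded (f ` {a..b})"
    by (intro compact_imp_bounded compact_continuous_image assms) simp
  from bounded_normE[OF this] show ?thesis using that by (metis imageI)
qed

text \<open>Uniform convergence of \<open>x\<close> to 0 gives no pointwise control of \<open>x'\<close>, but integration by parts moves
  the derivative to the differentiable factor \<open>B\<close>.\<close>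

lemma unull_time_int_cross:
  fixes x x' :: "nat \<Rightarrow> real \<Rightarrow> real^3"
  assumes x: "unull {a..b} x"
    and der: "\<forall>\<^sub>F n in sequentially. \<forall>t\<in>{a..b}. (x n has_vector_derivative x' n t) (at t within {a..b})"
    and c: "\<forall>\<^sub>F n in sequentially. continuous_on {a..b} (x' n)"
    and B: "\<And>t. t \<in> {a..b} \<Longrightarrow> (B has_vector_derivative B' t) (at t within {a..b})"
    and B': "continuous_on {a..b} B'"
    and t0: "t0 \<in> {a..b}"
  shows "unull {a..b} (\<lambda>n. time_int t0 (\<lambda>t. cross3 (x' n t) (B t)))"
proof -
  note bb = bounded_bilinear_cross3
  have Bc: "continuous_on {a..b} B" by (rule continuous_on_vector_derivative) (rule B)
  obtain C where C: "norm (B t) \<le> C" if "t \<in> {a..b}" for t by (rule continuous_on_Icc_bounded[OF Bc]) blast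
  obtain C' where C': "norm (B' t) \<le> C'" if "t \<in> {a..b}" for t by (rule continuous_on_Icc_bounded[OF B']) blast
  have xc: "\<forall>\<^sub>F n in sequentially. continuous_on {a..b} (x n)"
    using der by eventually_elim (rule continuous_on_vector_derivative, blast)
  have u: "unull {a..b} (\<lambda>n t. cross3 (x n t) (B t))"
    by (rule unull_bilinear[OF bb x, where C = C]) (use C in auto)
  have u0: "unull {a..b} (\<lambda>n t. cross3 (x n t0) (B t0))"
    by (rule unull_const[OF unull_pointwise[OF u t0]])
  have "unull {a..b} (\<lambda>n t. cross3 (x n t) (B' t))"
    by (rule unull_bilinear[OF bb x, where C = C']) (use C' in auto)
  then have "unull {a..b} (\<lambda>n. time_int t0 (\<lambda>t. cross3 (x n t) (B' t)))"
    by (rule unull_time_int[OF _ _ t0]) (use xc in eventually_elim, intro continuous_intros B')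
  from unull_diff[OF unull_diff[OF u u0] this] show ?thesis
  proof (rule unull_cong)
    show "\<forall>\<^sub>F n in sequentially. \<forall>t\<in>{a..b}. cross3 (x n t) (B t) - cross3 (x n t0) (B t0)
        - time_int t0 (\<lambda>t. cross3 (x n t) (B' t)) t = time_int t0 (\<lambda>t. cross3 (x' n t) (B t)) t"
      using der c xc
    proof eventually_elim
      case (elim n)
      show ?case
      proof
        fix t assume t: "t \<in> {a..b}"
        have c1: "continuous_on {a..b} (\<lambda>t. cross3 (x n t) (B' t))"
          and c2: "continuous_on {a..b} (\<lambda>t. cross3 (x' n t) (B t))"
          by (intro continuous_intros B' Bc elim)+
        have "time_int t0 (\<lambda>t. cross3 (x n t) (B' t) + cross3 (x' n t) (B t)) t
            = cross3 (x n t) (B t) - cross3 (x n t0) (B t0)"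
        proof (rule time_int_FTC[OF _ _ t0 t])
          fix s assume "s \<in> {a..b}"
          then show "((\<lambda>t. cross3 (x n t) (B t)) has_vector_derivative
              cross3 (x n s) (B' s) + cross3 (x' n s) (B s)) (at s within {a..b})"
            using elim(1) by (intro bounded_bilinear.has_vector_derivative[OF bb] B) auto
        qed (intro continuous_on_add c1 c2)
        then show "cross3 (x n t) (B t) - cross3 (x n t0) (B t0)
          - time_int t0 (\<lambda>t. cross3 (x n t) (B' t)) t = time_int t0 (\<lambda>t. cross3 (x' n t) (B t)) t"
          unfolding time_int_add[OF c1 c2 t0 t] by (simp add: eq_diff_eq diff_eq_eq add_ac)
      qed
    qed
  qed
qed

section \<open>The limit of the equations of motion\<close>

text \<open>A point \<open>x n\<close> with charge \<open>\<rho> n\<close> and momentum \<open>p n\<close> obeys the velocity law \<open>\<rho> x' = (q/m) p\<close> and the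
  momentum law up to uniformly vanishing terms.  If \<open>\<rho> n\<close> tends to a constant and \<open>x n\<close> to \<open>r\<close>, then \<open>r\<close>
  obeys Newton's law.  The initial momenta \<open>p n t0\<close> are not assumed to converge.\<close>

lemma newton_limit:
  fixes \<rho> :: "nat \<Rightarrow> real \<Rightarrow> real" and p x x' :: "nat \<Rightarrow> real \<Rightarrow> real^3" and E B B' r v w :: "real \<Rightarrow> real^3"
  assumes ab: "a < b" and t0: "t0 \<in> {a..b}" and pos: "0 < m" "0 < q" "0 < c" "0 < \<rho>inf"
    and \<rho>: "unull {a..b} (\<lambda>n t. \<rho> n t - \<rho>inf)"
    and p_bd: "\<And>n t. t \<in> {a..b} \<Longrightarrow> norm (p n t) \<le> C"
    and x: "unull {a..b} (\<lambda>n t. x n t - r t)"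
    and x_der: "\<forall>\<^sub>F n in sequentially. \<forall>t\<in>{a..b}. (x n has_vector_derivative x' n t) (at t within {a..b})"
    and x'_cont: "\<forall>\<^sub>F n in sequentially. continuous_on {a..b} (x' n)"
    and vel: "unull {a..b} (\<lambda>n t. \<rho> n t *\<^sub>R x' n t - (q / m) *\<^sub>R p n t)"
    and mom: "unull {a..b} (\<lambda>n t. p n t - p n t0 -
       time_int t0 (\<lambda>s. \<rho> n s *\<^sub>R E s + (q / (m * c)) *\<^sub>R cross3 (p n s) (B s)) t)"
    and \<rho>_cont: "\<And>n. continuous_on {a..b} (\<rho> n)" and p_cont: "\<And>n. continuous_on {a..b} (p n)"
    and E_cont: "continuous_on {a..b} E"
    and B_der: "\<And>t. t \<in> {a..b} \<Longrightarrow> (B has_vector_derivative B' t) (at t within {a..b})"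
    and B'_cont: "continuous_on {a..b} B'"
    and r_der: "\<And>t. t \<in> {a..b} \<Longrightarrow> (r has_vector_derivative v t) (at t within {a..b})"
    and v_der: "\<And>t. t \<in> {a..b} \<Longrightarrow> (v has_vector_derivative w t) (at t within {a..b})"
    and t: "t \<in> {a..b}"
  shows "m *\<^sub>R w t = q *\<^sub>R E t + (q / c) *\<^sub>R cross3 (v t) (B t)"
proof -
  note bb = bounded_bilinear_cross3
  have v_cont: "continuous_on {a..b} v" by (rule continuous_on_vector_derivative) (rule v_der)
  have B_cont: "continuous_on {a..b} B" by (rule continuous_on_vector_derivative) (rule B_der)
  obtain CE where CE: "norm (E t) \<le> CE" if "t \<in> {a..b}" for t by (rule continuous_on_Icc_bounded[OF E_cont]) blast
  obtain CB where CB: "norm (B t) \<le> CB" if "t \<in> {a..b}" for t by (rule continuous_on_Icc_bounded[OF B_cont]) blast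
  define g where "g = (\<lambda>s. \<rho>inf *\<^sub>R E s + (\<rho>inf / c) *\<^sub>R cross3 (v s) (B s))"
  define F where "F = time_int t0 g"
  have g_cont: "continuous_on {a..b} g" unfolding g_def by (intro continuous_intros E_cont v_cont B_cont)
  have F_cont: "continuous_on {a..b} F" unfolding F_def by (rule time_int_cont[OF g_cont t0])

  have x'_bd: "\<forall>\<^sub>F n in sequentially. \<forall>t\<in>{a..b}. norm (x' n t) \<le> (q / m * C + 1) / (\<rho>inf / 2)"
  proof -
    have "\<forall>\<^sub>F n in sequentially. \<forall>t\<in>{a..b}. norm (\<rho> n t *\<^sub>R x' n t - (q / m) *\<^sub>R p n t) < 1"
      using vel unfolding unull_iff by simp
    moreover have "\<forall>\<^sub>F n in sequentially. \<forall>t\<in>{a..b}. norm (\<rho> n t - \<rho>inf) < \<rho>inf / 2"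
      using \<rho>[unfolded unull_iff, rule_format, of "\<rho>inf / 2"] pos by simp
    ultimately show ?thesis
    proof eventually_elim
      case (elim n)
      show ?case
      proof
        fix t assume t: "t \<in> {a..b}"
        have r: "\<rho>inf / 2 \<le> \<rho> n t" using elim(2)[THEN bspec, OF t] unfolding real_norm_def by linarith
        have "\<rho>inf / 2 * norm (x' n t) \<le> \<rho> n t * norm (x' n t)" by (intro mult_right_mono r) simp
        also have "\<dots> = norm (\<rho> n t *\<^sub>R x' n t)" using r pos by simp
        also have "\<dots> \<le> norm ((q / m) *\<^sub>R p n t) + norm (\<rho> n t *\<^sub>R x' n t - (q / m) *\<^sub>R p n t)"
          using norm_triangle_ineq[of "(q / m) *\<^sub>R p n t" "\<rho> n t *\<^sub>R x' n t - (q / m) *\<^sub>R p n t"] by simp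
        also have "norm ((q / m) *\<^sub>R p n t) \<le> q / m * C"
          using pos p_bd[OF t, of n] by (simp add: divide_right_mono)
        also have "norm (\<rho> n t *\<^sub>R x' n t - (q / m) *\<^sub>R p n t) \<le> 1" using elim(1) t by (simp add: less_imp_le)
        finally show "norm (x' n t) \<le> (q / m * C + 1) / (\<rho>inf / 2)"
          using pos by (subst pos_le_divide_eq) (simp_all add: mult.commute)
      qed
    qed
  qed
  have vel': "unull {a..b} (\<lambda>n t. \<rho>inf *\<^sub>R x' n t - (q / m) *\<^sub>R p n t)"
    using unull_diff[OF vel unull_bilinear[OF bounded_bilinear_scaleR \<rho> x'_bd]]
    by (rule unull_cong) (simp add: algebra_simps)

  \<comment> \<open>The difference of the forces is split into the error of the charge, the error of the velocity law
    and the weakly convergent part \<open>(x' - v) \<times> B\<close>.\<close>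
  have force: "unull {a..b} (\<lambda>n t. time_int t0 (\<lambda>s. \<rho> n s *\<^sub>R E s + (q / (m * c)) *\<^sub>R cross3 (p n s) (B s)) t - F t)"
  proof -
    have 1: "unull {a..b} (\<lambda>n. time_int t0 (\<lambda>s. (\<rho> n s - \<rho>inf) *\<^sub>R E s))"
      by (intro unull_time_int[OF unull_bilinear[OF bounded_bilinear_scaleR \<rho>, where C = CE] _ t0] always_eventually allI
          continuous_intros \<rho>_cont E_cont) (use CE in auto)
    have 2: "unull {a..b} (\<lambda>n. time_int t0 (\<lambda>s. cross3 (\<rho>inf *\<^sub>R x' n s - (q / m) *\<^sub>R p n s) (B s)))"
      by (rule unull_time_int[OF unull_bilinear[OF bb vel', where C = CB] _ t0])
        (use CB x'_cont in \<open>auto elim!: eventually_mono intro!: continuous_intros p_cont B_cont\<close>)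
    have 3: "unull {a..b} (\<lambda>n. time_int t0 (\<lambda>s. cross3 (x' n s - v s) (B s)))"
    proof (rule unull_time_int_cross[OF x _ _ B_der B'_cont t0])
      show "\<forall>\<^sub>F n in sequentially. \<forall>t\<in>{a..b}.
          ((\<lambda>t. x n t - r t) has_vector_derivative x' n t - v t) (at t within {a..b})"
        using x_der by eventually_elim (auto intro!: has_vector_derivative_diff r_der)
      show "\<forall>\<^sub>F n in sequentially. continuous_on {a..b} (\<lambda>t. x' n t - v t)"
        using x'_cont by eventually_elim (intro continuous_intros v_cont)
    qed
    have "unull {a..b} (\<lambda>n t. time_int t0 (\<lambda>s. (\<rho> n s - \<rho>inf) *\<^sub>R E s) t
       - (1 / c) *\<^sub>R time_int t0 (\<lambda>s. cross3 (\<rho>inf *\<^sub>R x' n s - (q / m) *\<^sub>R p n s) (B s)) t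
       + (\<rho>inf / c) *\<^sub>R time_int t0 (\<lambda>s. cross3 (x' n s - v s) (B s)) t)"
      by (intro unull_add unull_diff unull_linear[OF bounded_linear_scaleR_right] 1 2 3)
    then show ?thesis
    proof (rule unull_cong)
      show "\<forall>\<^sub>F n in sequentially. \<forall>t\<in>{a..b}. time_int t0 (\<lambda>s. (\<rho> n s - \<rho>inf) *\<^sub>R E s) t
       - (1 / c) *\<^sub>R time_int t0 (\<lambda>s. cross3 (\<rho>inf *\<^sub>R x' n s - (q / m) *\<^sub>R p n s) (B s)) t
       + (\<rho>inf / c) *\<^sub>R time_int t0 (\<lambda>s. cross3 (x' n s - v s) (B s)) t
       = time_int t0 (\<lambda>s. \<rho> n s *\<^sub>R E s + (q / (m * c)) *\<^sub>R cross3 (p n s) (B s)) t - F t"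
        using x'_cont
      proof eventually_elim
        case (elim n)
        show ?case
        proof
          fix t assume t: "t \<in> {a..b}"
          let ?f1 = "\<lambda>s. (\<rho> n s - \<rho>inf) *\<^sub>R E s"
          let ?f2 = "\<lambda>s. cross3 (\<rho>inf *\<^sub>R x' n s - (q / m) *\<^sub>R p n s) (B s)"
          let ?f3 = "\<lambda>s. cross3 (x' n s - v s) (B s)"
          let ?f = "\<lambda>s. \<rho> n s *\<^sub>R E s + (q / (m * c)) *\<^sub>R cross3 (p n s) (B s)"
          have c: "continuous_on {a..b} ?f1" "continuous_on {a..b} ?f2" "continuous_on {a..b} ?f3" "continuous_on {a..b} ?f"
            by (intro continuous_intros \<rho>_cont E_cont p_cont B_cont v_cont elim)+
          have e: "?f s - g s = ?f1 s - (1 / c) *\<^sub>R ?f2 s + (\<rho>inf / c) *\<^sub>R ?f3 s" for s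
            using pos by (simp add: g_def algebra_simps bounded_bilinear.diff_left[OF bb]
                bounded_bilinear.scaleR_left[OF bb])
          have "time_int t0 ?f t - F t = time_int t0 (\<lambda>s. ?f s - g s) t"
            unfolding F_def by (rule time_int_diff[OF c(4) g_cont t0 t, symmetric])
          also have "\<dots> = time_int t0 (\<lambda>s. ?f1 s - (1 / c) *\<^sub>R ?f2 s) t + time_int t0 (\<lambda>s. (\<rho>inf / c) *\<^sub>R ?f3 s) t"
            unfolding e by (rule time_int_add[OF _ _ t0 t]) (intro continuous_intros c)+
          also have "time_int t0 (\<lambda>s. ?f1 s - (1 / c) *\<^sub>R ?f2 s) t = time_int t0 ?f1 t - time_int t0 (\<lambda>s. (1 / c) *\<^sub>R ?f2 s) t"
            by (rule time_int_diff[OF _ _ t0 t]) (intro continuous_intros c)+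
          also have "time_int t0 (\<lambda>s. (1 / c) *\<^sub>R ?f2 s) t = (1 / c) *\<^sub>R time_int t0 ?f2 t"
            by (rule time_int_linear[OF bounded_linear_scaleR_right c(2) t0 t])
          also have "time_int t0 (\<lambda>s. (\<rho>inf / c) *\<^sub>R ?f3 s) t = (\<rho>inf / c) *\<^sub>R time_int t0 ?f3 t"
            by (rule time_int_linear[OF bounded_linear_scaleR_right c(3) t0 t])
          finally show "time_int t0 ?f1 t - (1 / c) *\<^sub>R time_int t0 ?f2 t + (\<rho>inf / c) *\<^sub>R time_int t0 ?f3 t
            = time_int t0 ?f t - F t" by simp
        qed
      qed
    qed
  qed

  have main: "unull {a..b} (\<lambda>n t. \<rho>inf *\<^sub>R x' n t - (q / m) *\<^sub>R (p n t0 + F t))"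
    using unull_add[OF vel' unull_linear[OF bounded_linear_scaleR_right[of "q / m"] unull_add[OF mom force]]]
    by (rule unull_cong) (simp add: algebra_simps)

  define \<Phi> where "\<Phi> = time_int a F"
  have a: "a \<in> {a..b}" and b: "b \<in> {a..b}" using ab by auto
  have "unull {a..b} (\<lambda>n. time_int a (\<lambda>t. \<rho>inf *\<^sub>R x' n t - (q / m) *\<^sub>R (p n t0 + F t)))"
    by (rule unull_time_int[OF main _ a])
      (use x'_cont in \<open>auto elim!: eventually_mono intro!: continuous_intros F_cont\<close>)
  then have disp: "unull {a..b} (\<lambda>n t. \<rho>inf *\<^sub>R (x n t - x n a) - (q / m) *\<^sub>R ((t - a) *\<^sub>R p n t0 + \<Phi> t))"
  proof (rule unull_cong)
    show "\<forall>\<^sub>F n in sequentially. \<forall>t\<in>{a..b}. time_int a (\<lambda>t. \<rho>inf *\<^sub>R x' n t - (q / m) *\<^sub>R (p n t0 + F t)) t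
        = \<rho>inf *\<^sub>R (x n t - x n a) - (q / m) *\<^sub>R ((t - a) *\<^sub>R p n t0 + \<Phi> t)"
      (is "\<forall>\<^sub>F n in _. \<forall>t\<in>_. ?lhs n t = ?rhs n t")
      using x_der x'_cont
    proof eventually_elim
      case (elim n)
      show ?case
      proof
        fix t assume t: "t \<in> {a..b}"
        have "time_int a (\<lambda>t. \<rho>inf *\<^sub>R x' n t - (q / m) *\<^sub>R (p n t0 + F t)) t
          = (\<rho>inf *\<^sub>R x n t - (q / m) *\<^sub>R ((t - a) *\<^sub>R p n t0 + \<Phi> t))
          - (\<rho>inf *\<^sub>R x n a - (q / m) *\<^sub>R ((a - a) *\<^sub>R p n t0 + \<Phi> a))"
        proof (rule time_int_FTC[OF _ _ a t])
          fix s assume s: "s \<in> {a..b}"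
          have "((\<lambda>t. (t - a) *\<^sub>R p n t0) has_vector_derivative p n t0) (at s within {a..b})"
            by (auto simp: has_vector_derivative_def intro!: derivative_eq_intros)
          then show "((\<lambda>t. \<rho>inf *\<^sub>R x n t - (q / m) *\<^sub>R ((t - a) *\<^sub>R p n t0 + \<Phi> t)) has_vector_derivative
             \<rho>inf *\<^sub>R x' n s - (q / m) *\<^sub>R (p n t0 + F s)) (at s within {a..b})"
            using elim(1) s unfolding \<Phi>_def
            by (intro has_vector_derivative_diff has_vector_derivative_add
                bounded_linear.has_vector_derivative[OF bounded_linear_scaleR_right] time_int_deriv F_cont a) auto
        qed (intro continuous_intros elim F_cont)
        moreover have "\<Phi> a = 0" unfolding \<Phi>_def using a by (simp add: time_int_eq[OF F_cont])
        ultimately show "?lhs n t = ?rhs n t"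
          by (simp add: algebra_simps)
      qed
    qed
  qed
  have x_lim: "(\<lambda>n. x n t) \<longlonglongrightarrow> r t" if "t \<in> {a..b}" for t
    using unull_pointwise[OF x that] by (rule LIM_zero_cancel)
  have lim: "(\<lambda>n. (t - a) *\<^sub>R p n t0) \<longlonglongrightarrow> (m / q) *\<^sub>R (\<rho>inf *\<^sub>R (r t - r a)) - \<Phi> t" if t: "t \<in> {a..b}" for t
  proof -
    have "(\<lambda>n. (m / q) *\<^sub>R (\<rho>inf *\<^sub>R (x n t - x n a)) - (m / q) *\<^sub>R
        (\<rho>inf *\<^sub>R (x n t - x n a) - (q / m) *\<^sub>R ((t - a) *\<^sub>R p n t0 + \<Phi> t)) - \<Phi> t)
       \<longlonglongrightarrow> (m / q) *\<^sub>R (\<rho>inf *\<^sub>R (r t - r a)) - (m / q) *\<^sub>R 0 - \<Phi> t"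
      by (intro tendsto_intros x_lim t a unull_pointwise[OF disp])
    then show ?thesis using pos by (simp add: algebra_simps)
  qed
  \<comment> \<open>Displacements over the whole interval determine the limit of the initial momenta.\<close>
  define p0 where "p0 = (1 / (b - a)) *\<^sub>R ((m / q) *\<^sub>R (\<rho>inf *\<^sub>R (r b - r a)) - \<Phi> b)"
  have "(\<lambda>n. (1 / (b - a)) *\<^sub>R ((b - a) *\<^sub>R p n t0)) \<longlonglongrightarrow> p0"
    unfolding p0_def by (intro tendsto_intros lim b)
  then have p0: "(\<lambda>n. p n t0) \<longlonglongrightarrow> p0" using ab by simp
  have traj: "(t - a) *\<^sub>R p0 + \<Phi> t = (m / q) *\<^sub>R (\<rho>inf *\<^sub>R (r t - r a))" if t: "t \<in> {a..b}" for t
    using LIMSEQ_unique[OF lim[OF t] tendsto_scaleR[OF tendsto_const p0]] by (simp add: algebra_simps)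
  have v_eq: "p0 + F t = (m / q) *\<^sub>R (\<rho>inf *\<^sub>R v t)" if t: "t \<in> {a..b}" for t
  proof (rule vector_derivative_unique_within_closed_interval[OF ab])
    have "((\<lambda>t. (t - a) *\<^sub>R p0) has_vector_derivative p0) (at t within {a..b})"
      by (auto simp: has_vector_derivative_def intro!: derivative_eq_intros)
    then show "((\<lambda>t. (t - a) *\<^sub>R p0 + \<Phi> t) has_vector_derivative p0 + F t) (at t within cbox a b)"
      unfolding \<Phi>_def cbox_interval by (intro has_vector_derivative_add time_int_deriv F_cont a t)
    have "((\<lambda>t. (m / q) *\<^sub>R (\<rho>inf *\<^sub>R (r t - r a))) has_vector_derivative (m / q) *\<^sub>R (\<rho>inf *\<^sub>R (v t - 0))) (at t within {a..b})"
      by (intro bounded_linear.has_vector_derivative[OF bounded_linear_scaleR_right]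
          has_vector_derivative_diff r_der t has_vector_derivative_const)
    then show "((\<lambda>t. (t - a) *\<^sub>R p0 + \<Phi> t) has_vector_derivative (m / q) *\<^sub>R (\<rho>inf *\<^sub>R v t)) (at t within cbox a b)"
      unfolding cbox_interval
      by (rule has_vector_derivative_transform[OF t, rotated, OF has_vector_derivative_eq_rhs]) (simp_all add: traj)
  qed (use t in simp)
  have "g t = (m / q) *\<^sub>R (\<rho>inf *\<^sub>R w t)"
  proof (rule vector_derivative_unique_within_closed_interval[OF ab])
    have "((\<lambda>t. p0 + F t) has_vector_derivative 0 + g t) (at t within {a..b})"
      unfolding F_def by (intro has_vector_derivative_add has_vector_derivative_const time_int_deriv g_cont t0 t)
    then show "((\<lambda>t. p0 + F t) has_vector_derivative g t) (at t within cbox a b)" by simp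
    have "((\<lambda>t. (m / q) *\<^sub>R (\<rho>inf *\<^sub>R v t)) has_vector_derivative (m / q) *\<^sub>R (\<rho>inf *\<^sub>R w t)) (at t within {a..b})"
      by (intro bounded_linear.has_vector_derivative[OF bounded_linear_scaleR_right] v_der t)
    then show "((\<lambda>t. p0 + F t) has_vector_derivative (m / q) *\<^sub>R (\<rho>inf *\<^sub>R w t)) (at t within cbox a b)"
      unfolding cbox_interval
      by (rule has_vector_derivative_transform[OF t, rotated]) (simp add: v_eq)
  qed (use t in simp)
  then have "(q / \<rho>inf) *\<^sub>R ((m / q) *\<^sub>R (\<rho>inf *\<^sub>R w t)) = (q / \<rho>inf) *\<^sub>R g t" by simp
  then show ?thesis using pos by (simp add: g_def scaleR_add_right)
qed


section \<open>Balance laws on the moving ball\<close>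

context moving_ball
begin

abbreviation "nrm \<equiv> unit_normal r R"
abbreviation "vn p \<equiv> v (fst p) \<bullet> nrm p"

lemma vn_cont: "continuous_on S (\<lambda>p. vn p)"
  by (intro continuous_intros time_cont v_cont unit_normal_cont)

lemma ball_int_sum:
  fixes f :: "'i \<Rightarrow> spacetime \<Rightarrow> 'b::euclidean_space"
  assumes "finite A" "\<And>i. i \<in> A \<Longrightarrow> continuous_on S (f i)" "t \<in> I"
  shows "ball_int r R (\<lambda>p. \<Sum>i\<in>A. f i p) t = (\<Sum>i\<in>A. ball_int r R (f i) t)"
  using assms
proof (induction A rule: finite_induct)
  case (insert i A)
  have "ball_int r R (\<lambda>p. f i p + (\<Sum>i\<in>A. f i p)) t = ball_int r R (f i) t + ball_int r R (\<lambda>p. \<Sum>i\<in>A. f i p) t"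
    using insert by (intro ball_int_add continuous_on_sum) auto
  with insert show ?case by simp
qed (simp add: ball_int_def)

lemma bdry_int_sum:
  fixes f :: "'i \<Rightarrow> spacetime \<Rightarrow> 'b::euclidean_space"
  assumes "finite A" "\<And>i. i \<in> A \<Longrightarrow> continuous_on S (f i)" "t \<in> I"
  shows "bdry_int r R (\<lambda>p. \<Sum>i\<in>A. f i p) t = (\<Sum>i\<in>A. bdry_int r R (f i) t)"
  using assms
proof (induction A rule: finite_induct)
  case empty
  show ?case by (simp add: bdry_int_def sphere_integral_def)
next
  case (insert i A)
  have "bdry_int r R (\<lambda>p. f i p + (\<Sum>i\<in>A. f i p)) t = bdry_int r R (f i) t + bdry_int r R (\<lambda>p. \<Sum>i\<in>A. f i p) t"
    using insert by (intro bdry_int_add continuous_on_sum) auto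
  with insert show ?case by simp
qed

lemma ball_int_minus:
  fixes f :: "spacetime \<Rightarrow> 'b::euclidean_space"
  assumes "continuous_on S f" "t \<in> I"
  shows "ball_int r R (\<lambda>p. - f p) t = - ball_int r R f t"
  by (rule ball_int_linear[OF bounded_linear_minus[OF bounded_linear_ident] assms])

lemma ball_int_diff:
  fixes f g :: "spacetime \<Rightarrow> 'b::euclidean_space"
  assumes "continuous_on S f" "continuous_on S g" "t \<in> I"
  shows "ball_int r R (\<lambda>p. f p - g p) t = ball_int r R f t - ball_int r R g t"
  using ball_int_add[OF assms(1) continuous_on_minus[OF assms(2)] assms(3)] ball_int_minus[OF assms(2,3)] by simp

lemma ball_int_time_scale:
  fixes f :: "spacetime \<Rightarrow> real" and k :: "real \<Rightarrow> 'b::euclidean_space"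
  assumes "continuous_on S f" "t \<in> I"
  shows "ball_int r R (\<lambda>p. f p *\<^sub>R k (fst p)) t = ball_int r R f t *\<^sub>R k t"
proof -
  have "ball_int r R (\<lambda>p. f p *\<^sub>R k (fst p)) t = ball_int r R (\<lambda>p. f p *\<^sub>R k t) t"
    by (simp add: ball_int_def)
  also have "\<dots> = ball_int r R f t *\<^sub>R k t"
    by (rule ball_int_linear[OF bounded_linear_scaleR_left assms])
  finally show ?thesis .
qed

lemma norm_ball_int_le:
  fixes f :: "spacetime \<Rightarrow> 'b::euclidean_space"
  assumes "continuous_on S f" "continuous_on S g" "t \<in> I" "\<And>x. x \<in> cball (r t) R \<Longrightarrow> norm (f (t, x)) \<le> g (t, x)"
  shows "norm (ball_int r R f t) \<le> ball_int r R g t"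
proof -
  note f = set_borel_integral_eq_integral[OF set_integrable_cball[OF slice_cont[OF assms(1,3)]]]
  note g = set_borel_integral_eq_integral[OF set_integrable_cball[OF slice_cont[OF assms(2,3)]]]
  show ?thesis
    unfolding ball_int_def f(2) g(2) by (rule integral_norm_bound_integral[OF f(1) g(1) assms(4)])
qed

lemma C1_onD:
  assumes "C1_on S f"
  shows "continuous_on S f" "continuous_on S (dt S f)" "continuous_on S (dx S i f)"
  using assms C1_on_continuous by (auto simp: C1_on_def)

lemma C1_on_scaleR: "C1_on S f \<Longrightarrow> C1_on S g \<Longrightarrow> C1_on S (\<lambda>p. f p *\<^sub>R g p)"
  by (rule C1_on_bilinear[OF bounded_bilinear_scaleR])

lemma C1_on_nth: "C1_on S J \<Longrightarrow> C1_on S (\<lambda>p. J p $ i)" for J :: "spacetime \<Rightarrow> real^'n"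
  by (rule C1_on_linear[OF bounded_linear_vec_nth])

lemma divergence_cont: "C1_on S J \<Longrightarrow> continuous_on S (divergence S J)"
  unfolding divergence_def by (intro continuous_intros C1_onD)

lemma tensor_divergence_cont: "(\<And>i j. C1_on S (T i j)) \<Longrightarrow> continuous_on S (tensor_divergence S T)"
  unfolding tensor_divergence_def by (intro continuous_intros C1_onD)

lemma flux_cont: "continuous_on S J \<Longrightarrow> continuous_on S (\<lambda>p. nrm p \<bullet> J p)"
  by (intro continuous_intros unit_normal_cont)

text \<open>The divergence theorem for the fields \<open>J\<^sub>i (x - k)\<close>, whose \<open>i\<close>-th derivatives add up to
  \<open>(div J) (x - k) + J\<close>.\<close>

lemma gauss_moment:
  assumes J: "C1_on S J" and t: "t \<in> I"
  shows "ball_int r R (\<lambda>p. divergence S J p *\<^sub>R (snd p - k)) t =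
    bdry_int r R (\<lambda>p. (nrm p \<bullet> J p) *\<^sub>R (snd p - k)) t - ball_int r R J t"
proof -
  let ?F = "\<lambda>i p. J p $ i *\<^sub>R (snd p - k)"
  have s: "has_C1 S (\<lambda>p. snd p - k) (\<lambda>p h. snd h)"
    using has_C1_add[OF has_C1_snd has_C1_const[of S "- k"]] by simp
  have F: "has_C1 S (?F i) (\<lambda>p h. J p $ i *\<^sub>R snd h + (C1_deriv S J p h $ i) *\<^sub>R (snd p - k))" for i
    by (rule has_C1_bilinear[OF bounded_bilinear_scaleR has_C1_linear[OF bounded_linear_vec_nth C1_on_has_C1[OF J]] s])
  have sk: "continuous_on S (\<lambda>p. snd p - k)" using s by (rule has_C1_continuous)
  have Jc: "continuous_on S J" using C1_onD[OF J] by simp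
  have eq: "(\<Sum>i\<in>UNIV. dx S i (?F i) p) = divergence S J p *\<^sub>R (snd p - k) + J p" if "p \<in> S" for p
  proof -
    have "(\<Sum>i\<in>UNIV. J p $ i *\<^sub>R axis i 1) = J p"
      by (simp add: vec_eq_iff axis_def if_distrib[where f = "\<lambda>a. _ * a"] cong: if_cong)
    then show ?thesis
      unfolding has_C1_dx[OF F that] divergence_def scaleR_sum_left by (simp add: sum.distrib)
  qed
  have "ball_int r R (\<lambda>p. divergence S J p *\<^sub>R (snd p - k) + J p) t = ball_int r R (\<lambda>p. \<Sum>i\<in>UNIV. dx S i (?F i) p) t"
    by (rule ball_int_cong[OF t]) (use t eq in \<open>simp add: mem_tube\<close>)
  also have "\<dots> = (\<Sum>i\<in>UNIV. ball_int r R (dx S i (?F i)) t)"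
    by (intro ball_int_sum t C1_onD has_C1_C1_on[OF F]) auto
  also have "\<dots> = (\<Sum>i\<in>UNIV. bdry_int r R (\<lambda>p. nrm p $ i *\<^sub>R ?F i p) t)"
    by (simp add: gauss_axis[OF has_C1_C1_on[OF F] t])
  also have "\<dots> = bdry_int r R (\<lambda>p. \<Sum>i\<in>UNIV. nrm p $ i *\<^sub>R ?F i p) t"
    by (intro bdry_int_sum[symmetric] t continuous_intros unit_normal_cont Jc sk) auto
  also have "\<dots> = bdry_int r R (\<lambda>p. (nrm p \<bullet> J p) *\<^sub>R (snd p - k)) t"
    by (simp add: inner_vec_def scaleR_sum_left)
  finally show ?thesis
    by (subst (asm) ball_int_add[OF _ _ t]) (auto intro!: continuous_intros divergence_cont J Jc sk simp: algebra_simps)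
qed

lemma gauss_divergence:
  assumes J: "C1_on S J" and t: "t \<in> I"
  shows "ball_int r R (divergence S J) t = bdry_int r R (\<lambda>p. nrm p \<bullet> J p) t"
proof -
  have "ball_int r R (divergence S J) t = (\<Sum>i\<in>UNIV. ball_int r R (\<lambda>p. dx S i J p $ i) t)"
    unfolding divergence_def by (intro ball_int_sum t continuous_intros C1_onD J) auto
  also have "\<dots> = (\<Sum>i\<in>UNIV. bdry_int r R (\<lambda>p. nrm p $ i * J p $ i) t)"
  proof (rule sum.cong[OF refl])
    fix i
    have "ball_int r R (\<lambda>p. dx S i J p $ i) t = ball_int r R (dx S i J) t $ i"
      by (intro ball_int_linear bounded_linear_vec_nth C1_onD J t)
    also have "\<dots> = bdry_int r R (\<lambda>p. (nrm p $ i *\<^sub>R J p) $ i) t"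
      unfolding gauss_axis[OF J t]
      by (intro bdry_int_linear[symmetric] bounded_linear_vec_nth t continuous_intros unit_normal_cont C1_onD J)
    finally show "ball_int r R (\<lambda>p. dx S i J p $ i) t = bdry_int r R (\<lambda>p. nrm p $ i * J p $ i) t" by simp
  qed
  also have "\<dots> = bdry_int r R (\<lambda>p. \<Sum>i\<in>UNIV. nrm p $ i * J p $ i) t"
    by (intro bdry_int_sum[symmetric] t continuous_intros unit_normal_cont C1_onD J) auto
  finally show ?thesis by (simp add: inner_vec_def)
qed

lemma gauss_tensor:
  assumes T: "\<And>i j. C1_on S (T i j)" and t: "t \<in> I"
  shows "ball_int r R (tensor_divergence S T) t = bdry_int r R (\<lambda>p. \<chi> j. \<Sum>i\<in>UNIV. nrm p $ i * T i j p) t"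
proof (subst vec_eq_iff, rule allI)
  fix j
  let ?n = "\<lambda>p. (\<chi> j. \<Sum>i\<in>UNIV. nrm p $ i * T i j p) :: real^3"
  have n: "continuous_on S ?n"
    by (intro continuous_intros unit_normal_cont C1_onD T)
  have "ball_int r R (tensor_divergence S T) t $ j = ball_int r R (\<lambda>p. tensor_divergence S T p $ j) t"
    by (intro ball_int_linear[symmetric] bounded_linear_vec_nth tensor_divergence_cont T t)
  also have "\<dots> = (\<Sum>i\<in>UNIV. ball_int r R (dx S i (T i j)) t)"
    unfolding tensor_divergence_def vec_lambda_beta by (intro ball_int_sum t C1_onD T) auto
  also have "\<dots> = (\<Sum>i\<in>UNIV. bdry_int r R (\<lambda>p. nrm p $ i * T i j p) t)"
    by (simp add: gauss_axis[OF T t])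
  also have "\<dots> = bdry_int r R (\<lambda>p. \<Sum>i\<in>UNIV. nrm p $ i * T i j p) t"
    by (intro bdry_int_sum[symmetric] t continuous_intros unit_normal_cont C1_onD T) auto
  also have "\<dots> = bdry_int r R (\<lambda>p. ?n p $ j) t" by simp
  also have "\<dots> = bdry_int r R ?n t $ j"
    by (rule bdry_int_linear[OF bounded_linear_vec_nth n t])
  finally show "ball_int r R (tensor_divergence S T) t $ j = bdry_int r R ?n t $ j" .
qed

lemma transport_integrated:
  fixes f :: "spacetime \<Rightarrow> 'b::euclidean_space"
  assumes f: "C1_on S f" and t: "t0 \<in> I" "t \<in> I"
  shows "ball_int r R f t - ball_int r R f t0 =
    time_int t0 (ball_int r R (dt S f)) t + time_int t0 (bdry_int r R (\<lambda>p. vn p *\<^sub>R f p)) t"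
proof -
  have c: "continuous_on I (ball_int r R (dt S f))" "continuous_on I (bdry_int r R (\<lambda>p. vn p *\<^sub>R f p))"
    by (intro ball_int_cont bdry_int_cont continuous_on_scaleR vn_cont C1_onD f)+
  have "time_int t0 (\<lambda>t. ball_int r R (dt S f) t + bdry_int r R (\<lambda>p. vn p *\<^sub>R f p) t) t
      = ball_int r R f t - ball_int r R f t0"
    by (rule time_int_FTC[OF _ reynolds[OF f] t]) (intro continuous_on_add c)
  then show ?thesis by (simp add: time_int_add[OF c t])
qed

text \<open>The right-hand side is \<open>Q23 - Q3'\<close>.\<close>

lemma charge_balance:
  assumes C1: "C1_on S \<rho>" "C1_on S \<rho>'" "C1_on S J" "C1_on S J'" and t: "t0 \<in> I" "t \<in> I"
    and law: "\<And>p. p \<in> S \<Longrightarrow> dt S \<rho> p + dt S \<rho>' p + divergence S J p + divergence S J' p = 0"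
  shows "ball_int r R \<rho> t - ball_int r R \<rho> t0 =
     (time_int t0 (bdry_int r R (\<lambda>p. vn p * \<rho> p)) t - time_int t0 (bdry_int r R (\<lambda>p. nrm p \<bullet> J p)) t)
   - (ball_int r R \<rho>' t - ball_int r R \<rho>' t0 - time_int t0 (bdry_int r R (\<lambda>p. vn p * \<rho>' p)) t
      + time_int t0 (bdry_int r R (\<lambda>p. nrm p \<bullet> J' p)) t)"
proof -
  have c: "continuous_on S (dt S \<rho>)" "continuous_on S (dt S \<rho>')" "continuous_on S J" "continuous_on S J'"
    using C1_onD[OF C1(1)] C1_onD[OF C1(2)] C1_onD[OF C1(3)] C1_onD[OF C1(4)] by auto
  have b: "continuous_on I (ball_int r R (dt S \<rho>))" "continuous_on I (ball_int r R (dt S \<rho>'))"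
    "continuous_on I (bdry_int r R (\<lambda>p. nrm p \<bullet> J p))" "continuous_on I (bdry_int r R (\<lambda>p. nrm p \<bullet> J' p))"
    by (intro ball_int_cont bdry_int_cont c flux_cont)+
  have "ball_int r R (dt S \<rho>) s = - ball_int r R (dt S \<rho>') s - bdry_int r R (\<lambda>p. nrm p \<bullet> J p) s
      - bdry_int r R (\<lambda>p. nrm p \<bullet> J' p) s" if s: "s \<in> I" for s
  proof -
    have "ball_int r R (dt S \<rho>) s = ball_int r R (\<lambda>p. - dt S \<rho>' p - divergence S J p - divergence S J' p) s"
      by (rule ball_int_cong[OF s]) (use law s in \<open>force simp: mem_tube eq_neg_iff_add_eq_0 algebra_simps\<close>)
    also have "\<dots> = - ball_int r R (dt S \<rho>') s - ball_int r R (divergence S J) s - ball_int r R (divergence S J') s"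
      using c s C1 by (simp add: ball_int_diff ball_int_minus divergence_cont continuous_on_diff continuous_on_minus)
    finally show ?thesis unfolding gauss_divergence[OF C1(3) s] gauss_divergence[OF C1(4) s] .
  qed
  then have "time_int t0 (ball_int r R (dt S \<rho>)) t = time_int t0 (\<lambda>s. - ball_int r R (dt S \<rho>') s
      - bdry_int r R (\<lambda>p. nrm p \<bullet> J p) s - bdry_int r R (\<lambda>p. nrm p \<bullet> J' p) s) t"
    by (rule time_int_cong[OF t])
  also have "\<dots> = time_int t0 (\<lambda>s. - ball_int r R (dt S \<rho>') s) t
      - time_int t0 (bdry_int r R (\<lambda>p. nrm p \<bullet> J p)) t - time_int t0 (bdry_int r R (\<lambda>p. nrm p \<bullet> J' p)) t"
    using b t by (simp add: time_int_diff[of Tm Tp] continuous_on_diff continuous_on_minus)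
  also have "time_int t0 (\<lambda>s. - ball_int r R (dt S \<rho>') s) t = - time_int t0 (ball_int r R (dt S \<rho>')) t"
    by (rule time_int_linear[OF bounded_linear_minus[OF bounded_linear_ident] b(2) t])
  finally show ?thesis
    using transport_integrated[OF C1(1) t] transport_integrated[OF C1(2) t] by simp
qed

text \<open>The right-hand side is \<open>Q01 - Q0 - Q0'\<close>.  No regularity of \<open>f'\<close> is assumed; the momentum law makes
  it continuous.\<close>

lemma momentum_balance:
  fixes P P' f f' :: "spacetime \<Rightarrow> real^3"
  assumes C1: "C1_on S P" "C1_on S P'" "\<And>i j. C1_on S (T i j)" "\<And>i j. C1_on S (T' i j)"
    and f: "continuous_on S f" and t: "t0 \<in> I" "t \<in> I"
    and law: "\<And>p. p \<in> S \<Longrightarrow> dt S P p + dt S P' p + tensor_divergence S T p + tensor_divergence S T' p = f p + f' p"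
  shows "ball_int r R P t - ball_int r R P t0 - time_int t0 (ball_int r R f) t =
     time_int t0 (bdry_int r R (\<lambda>p. vn p *\<^sub>R P p)) t
   - time_int t0 (bdry_int r R (\<lambda>p. \<chi> j. \<Sum>i\<in>UNIV. nrm p $ i * T i j p)) t
   - (ball_int r R P' t - ball_int r R P' t0 - time_int t0 (bdry_int r R (\<lambda>p. vn p *\<^sub>R P' p)) t
      + time_int t0 (ball_int r R (tensor_divergence S T')) t - time_int t0 (ball_int r R f') t)"
proof -
  let ?N = "\<lambda>p. (\<chi> j. \<Sum>i\<in>UNIV. nrm p $ i * T i j p) :: real^3"
  have c: "continuous_on S (dt S P)" "continuous_on S (dt S P')"
    "continuous_on S (tensor_divergence S T)" "continuous_on S (tensor_divergence S T')"
    using C1_onD[OF C1(1)] C1_onD[OF C1(2)] tensor_divergence_cont C1 by auto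
  have N: "continuous_on S ?N" by (intro continuous_intros unit_normal_cont C1_onD C1)
  have "continuous_on S (\<lambda>p. dt S P p + dt S P' p + tensor_divergence S T p + tensor_divergence S T' p - f p)"
    by (intro continuous_intros c f)
  then have f': "continuous_on S f'"
    by (rule continuous_on_eq) (simp add: law)
  have b: "continuous_on I (ball_int r R f)" "continuous_on I (ball_int r R f')" "continuous_on I (ball_int r R (dt S P'))"
    "continuous_on I (bdry_int r R ?N)" "continuous_on I (ball_int r R (tensor_divergence S T'))"
    by (intro ball_int_cont bdry_int_cont c f f' N)+
  have "ball_int r R (dt S P) s = ball_int r R f s + ball_int r R f' s - ball_int r R (dt S P') s
      - bdry_int r R ?N s - ball_int r R (tensor_divergence S T') s" if s: "s \<in> I" for s
  proof -
    have "ball_int r R (dt S P) s =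
        ball_int r R (\<lambda>p. f p + f' p - dt S P' p - tensor_divergence S T p - tensor_divergence S T' p) s"
      by (rule ball_int_cong[OF s], subst law[symmetric]) (use s in \<open>simp_all add: mem_tube\<close>)
    also have "\<dots> = ball_int r R f s + ball_int r R f' s - ball_int r R (dt S P') s
        - ball_int r R (tensor_divergence S T) s - ball_int r R (tensor_divergence S T') s"
      using c f f' s by (simp add: ball_int_diff ball_int_add continuous_on_diff continuous_on_add)
    finally show ?thesis unfolding gauss_tensor[OF C1(3) s] .
  qed
  then have "time_int t0 (ball_int r R (dt S P)) t = time_int t0 (\<lambda>s. ball_int r R f s + ball_int r R f' s
      - ball_int r R (dt S P') s - bdry_int r R ?N s - ball_int r R (tensor_divergence S T') s) t"
    by (rule time_int_cong[OF t])
  also have "\<dots> = time_int t0 (ball_int r R f) t + time_int t0 (ball_int r R f') t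
      - time_int t0 (ball_int r R (dt S P')) t - time_int t0 (bdry_int r R ?N) t
      - time_int t0 (ball_int r R (tensor_divergence S T')) t"
    using b t by (simp add: time_int_diff[of Tm Tp] time_int_add[of Tm Tp] continuous_on_diff continuous_on_add)
  finally show ?thesis
    using transport_integrated[OF C1(1) t] transport_integrated[OF C1(2) t] by (simp add: algebra_simps)
qed

lemma has_C1_time:
  assumes k: "\<And>t. t \<in> I \<Longrightarrow> (k has_vector_derivative k' t) (at t within I)" and k': "continuous_on I k'"
  shows "has_C1 S (\<lambda>p. k (fst p)) (\<lambda>p h. fst h *\<^sub>R k' (fst p))"
  unfolding has_C1_def
proof (intro conjI ballI allI)
  show "continuous_on S (\<lambda>p. fst h *\<^sub>R k' (fst p))" for h :: spacetime
    by (intro continuous_intros time_cont k')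
  fix p assume p: "p \<in> S"
  have f: "(fst has_derivative fst) (at p within S)" by (auto intro!: derivative_eq_intros)
  have "fst p \<in> I" "fst ` S \<subseteq> I" using p by (auto simp: tube_def)
  then have "(k has_derivative (\<lambda>h. h *\<^sub>R k' (fst p))) (at (fst p) within fst ` S)"
    using k[unfolded has_vector_derivative_def] has_derivative_subset by blast
  from diff_chain_within[OF f this]
  show "((\<lambda>p. k (fst p)) has_derivative (\<lambda>h. fst h *\<^sub>R k' (fst p))) (at p within S)"
    by (simp add: o_def)
qed

text \<open>The velocity of the charge center: the remainders on the right-hand side are \<open>Q22\<close>, \<open>Q20\<close> and \<open>Q2'\<close>,
  in this order.  The identity comes from differentiating \<open>\<rho>b *\<^sub>R rc = M\<close>, where \<open>\<rho>b\<close> is the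
  charge and \<open>M\<close> the first moment of the charge density.\<close>

lemma charge_center_motion:
  fixes \<rho> \<rho>' :: "spacetime \<Rightarrow> real" and J J' :: "spacetime \<Rightarrow> real^3"
  assumes C1: "C1_on S \<rho>" "C1_on S \<rho>'" "C1_on S J" "C1_on S J'"
    and pos: "\<And>t. t \<in> I \<Longrightarrow> 0 < ball_int r R \<rho> t"
    and law: "\<And>p. p \<in> S \<Longrightarrow> dt S \<rho> p + dt S \<rho>' p + divergence S J p + divergence S J' p = 0"
  defines "rc \<equiv> charge_center r R \<rho>"
  shows "continuous_on I (vel Tm Tp rc)"
    and "t \<in> I \<Longrightarrow> (rc has_vector_derivative vel Tm Tp rc t) (at t within I)"
    and "t \<in> I \<Longrightarrow> ball_int r R \<rho> t *\<^sub>R vel Tm Tp rc t = ball_int r R J t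
        - bdry_int r R (\<lambda>p. (nrm p \<bullet> J p) *\<^sub>R (snd p - rc (fst p))) t
        - (- bdry_int r R (\<lambda>p. (vn p * \<rho> p) *\<^sub>R (snd p - rc (fst p))) t)
        - (ball_int r R (dt S (\<lambda>p. \<rho>' p *\<^sub>R (snd p - rc (fst p)))) t + ball_int r R \<rho>' t *\<^sub>R vel Tm Tp rc t
           + bdry_int r R (\<lambda>p. (nrm p \<bullet> J' p) *\<^sub>R (snd p - rc (fst p))) t - ball_int r R J' t)"
      (is "_ \<Longrightarrow> ?velocity")
proof -
  define X where "X = (\<lambda>p. \<rho> p *\<^sub>R snd p)"
  have X: "C1_on S X" unfolding X_def by (intro C1_on_scaleR C1 C1_on_snd)
  have dtX: "dt S X p = dt S \<rho> p *\<^sub>R snd p" if "p \<in> S" for p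
    unfolding X_def
    by (subst has_C1_dt[OF has_C1_bilinear[OF bounded_bilinear_scaleR C1_on_has_C1[OF C1(1)] has_C1_snd] that]) simp
  define M' where "M' = (\<lambda>t. ball_int r R (dt S X) t + bdry_int r R (\<lambda>p. vn p *\<^sub>R X p) t)"
  define b' where "b' = (\<lambda>t. ball_int r R (dt S \<rho>) t + bdry_int r R (\<lambda>p. vn p *\<^sub>R \<rho> p) t)"
  define rc' where "rc' = (\<lambda>t. (1 / ball_int r R \<rho> t) *\<^sub>R (M' t - b' t *\<^sub>R rc t))"
  have c: "continuous_on S \<rho>" "continuous_on S (dt S \<rho>)" "continuous_on S \<rho>'" "continuous_on S (dt S \<rho>')"
      "continuous_on S J" "continuous_on S J'" "continuous_on S X" "continuous_on S (dt S X)"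
    using C1_onD[OF C1(1)] C1_onD[OF C1(2)] C1_onD[OF C1(3)] C1_onD[OF C1(4)] C1_onD[OF X] by auto
  have dc: "continuous_on S (divergence S J)" "continuous_on S (divergence S J')"
    by (intro divergence_cont C1)+
  have M'c: "continuous_on I M'" and b'c: "continuous_on I b'"
    unfolding M'_def b'_def by (intro continuous_on_add ball_int_cont bdry_int_cont continuous_on_scaleR vn_cont c)+
  have rc_eq: "rc t = (1 / ball_int r R \<rho> t) *\<^sub>R ball_int r R X t" for t
    by (simp add: rc_def charge_center_def X_def)
  have Md: "(ball_int r R X has_vector_derivative M' t) (at t within I)"
    and bd: "(ball_int r R \<rho> has_vector_derivative b' t) (at t within I)" if "t \<in> I" for t
    unfolding M'_def b'_def by (rule reynolds[OF X that] reynolds[OF C1(1) that])+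
  have rcd: "(rc has_vector_derivative rc' t) (at t within I)" if t: "t \<in> I" for t
  proof -
    have p: "ball_int r R \<rho> t \<noteq> 0" using pos[OF t] by simp
    have "((\<lambda>t. inverse (ball_int r R \<rho> t)) has_real_derivative
        - (inverse (ball_int r R \<rho> t) * b' t * inverse (ball_int r R \<rho> t))) (at t within I)"
      using bd[OF t] p by (intro DERIV_inverse') (simp add: has_real_derivative_iff_has_vector_derivative)
    from has_vector_derivative_scaleR[OF this Md[OF t]]
    have "((\<lambda>t. inverse (ball_int r R \<rho> t) *\<^sub>R ball_int r R X t) has_vector_derivative rc' t) (at t within I)"
      by (rule has_vector_derivative_eq_rhs)
        (simp add: rc'_def rc_eq divide_inverse algebra_simps)
    then show ?thesis by (simp add: rc_eq[abs_def] divide_inverse)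
  qed
  have rcc: "continuous_on I rc" by (rule continuous_on_vector_derivative) (rule rcd)
  have rc'c: "continuous_on I rc'"
    unfolding rc'_def using pos by (intro continuous_intros M'c b'c rcc ball_int_cont c) force
  have vel: "vel Tm Tp rc t = rc' t" if t: "t \<in> I" for t
    unfolding vel_def using vector_derivative_within_cbox[OF T, of t rc "rc' t"] rcd[OF t] t by simp
  show "continuous_on I (vel Tm Tp rc)"
    by (rule continuous_on_eq[OF rc'c]) (simp add: vel)
  show "(rc has_vector_derivative vel Tm Tp rc t) (at t within I)" if "t \<in> I"
    using rcd[OF that] by (simp add: vel[OF that])
  show ?velocity if t: "t \<in> I"
  proof -
    \<comment> \<open>At a fixed time the center is a constant vector.\<close>
    define k where "k = rc t"
    have sk: "continuous_on S (\<lambda>p. snd p - k)" by (intro continuous_intros)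
    have sc: "continuous_on S (\<lambda>p. snd p - rc (fst p))" by (intro continuous_intros time_cont rcc)
    have bk: "bdry_int r R (\<lambda>p. f p *\<^sub>R (snd p - rc (fst p))) t = bdry_int r R (\<lambda>p. f p *\<^sub>R (snd p - k)) t" for f
      by (simp add: bdry_int_def k_def)
    have "ball_int r R \<rho> t *\<^sub>R rc' t = M' t - b' t *\<^sub>R k"
      using pos[OF t] by (simp add: rc'_def k_def)
    also have "M' t = ball_int r R (\<lambda>p. dt S \<rho> p *\<^sub>R snd p) t + bdry_int r R (\<lambda>p. vn p *\<^sub>R X p) t"
      unfolding M'_def by (subst ball_int_cong[OF t, of "dt S X" "\<lambda>p. dt S \<rho> p *\<^sub>R snd p"])
        (use t in \<open>simp_all add: dtX mem_tube\<close>)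
    also have "b' t *\<^sub>R k = ball_int r R (\<lambda>p. dt S \<rho> p *\<^sub>R k) t + bdry_int r R (\<lambda>p. (vn p *\<^sub>R \<rho> p) *\<^sub>R k) t"
      unfolding b'_def scaleR_left.add
      by (intro arg_cong2[where f = "(+)"] ball_int_linear[OF bounded_linear_scaleR_left, symmetric]
          bdry_int_linear[OF bounded_linear_scaleR_left, symmetric] t c continuous_on_scaleR vn_cont)
    also have "ball_int r R (\<lambda>p. dt S \<rho> p *\<^sub>R snd p) t + bdry_int r R (\<lambda>p. vn p *\<^sub>R X p) t - \<dots>
      = ball_int r R (\<lambda>p. dt S \<rho> p *\<^sub>R (snd p - k)) t + bdry_int r R (\<lambda>p. (vn p * \<rho> p) *\<^sub>R (snd p - k)) t"
    proof -
      have "ball_int r R (\<lambda>p. dt S \<rho> p *\<^sub>R (snd p - k) + dt S \<rho> p *\<^sub>R k) t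
         = ball_int r R (\<lambda>p. dt S \<rho> p *\<^sub>R (snd p - k)) t + ball_int r R (\<lambda>p. dt S \<rho> p *\<^sub>R k) t"
        by (intro ball_int_add t continuous_intros c sk)
      moreover have "bdry_int r R (\<lambda>p. (vn p * \<rho> p) *\<^sub>R (snd p - k) + (vn p * \<rho> p) *\<^sub>R k) t
         = bdry_int r R (\<lambda>p. (vn p * \<rho> p) *\<^sub>R (snd p - k)) t + bdry_int r R (\<lambda>p. (vn p * \<rho> p) *\<^sub>R k) t"
        by (intro bdry_int_add t continuous_intros c sk vn_cont)
      ultimately show ?thesis by (simp add: X_def scaleR_diff_right)
    qed
    also have "ball_int r R (\<lambda>p. dt S \<rho> p *\<^sub>R (snd p - k)) t
       = - ball_int r R (\<lambda>p. dt S \<rho>' p *\<^sub>R (snd p - k)) t - ball_int r R (\<lambda>p. divergence S J p *\<^sub>R (snd p - k)) t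
         - ball_int r R (\<lambda>p. divergence S J' p *\<^sub>R (snd p - k)) t"
    proof -
      have "dt S \<rho> p = - dt S \<rho>' p - divergence S J p - divergence S J' p" if "p \<in> S" for p
        using law[OF that] by linarith
      then have "ball_int r R (\<lambda>p. dt S \<rho> p *\<^sub>R (snd p - k)) t = ball_int r R (\<lambda>p. - (dt S \<rho>' p *\<^sub>R (snd p - k))
          - divergence S J p *\<^sub>R (snd p - k) - divergence S J' p *\<^sub>R (snd p - k)) t"
        by (intro ball_int_cong[OF t]) (use t in \<open>simp add: mem_tube scaleR_left.diff\<close>)
      then show ?thesis
        using c dc sk t by (simp add: ball_int_diff ball_int_minus continuous_on_diff continuous_on_minus continuous_on_scaleR)
    qed
    also have "ball_int r R (\<lambda>p. dt S \<rho>' p *\<^sub>R (snd p - k)) t =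
       ball_int r R (dt S (\<lambda>p. \<rho>' p *\<^sub>R (snd p - rc (fst p)))) t + ball_int r R \<rho>' t *\<^sub>R rc' t"
    proof -
      have s: "has_C1 S (\<lambda>p. snd p - rc (fst p)) (\<lambda>p h. snd h + - (fst h *\<^sub>R rc' (fst p)))"
        using has_C1_add[OF has_C1_snd has_C1_linear[OF bounded_linear_minus[OF bounded_linear_ident] has_C1_time[OF rcd rc'c]]]
        by simp
      have "dt S (\<lambda>p. \<rho>' p *\<^sub>R (snd p - rc (fst p))) p
          = dt S \<rho>' p *\<^sub>R (snd p - rc (fst p)) - \<rho>' p *\<^sub>R rc' (fst p)" if "p \<in> S" for p
        by (subst has_C1_dt[OF has_C1_bilinear[OF bounded_bilinear_scaleR C1_on_has_C1[OF C1(2)] s] that]) simp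
      then have "ball_int r R (dt S (\<lambda>p. \<rho>' p *\<^sub>R (snd p - rc (fst p)))) t
          = ball_int r R (\<lambda>p. dt S \<rho>' p *\<^sub>R (snd p - k) - \<rho>' p *\<^sub>R rc' (fst p)) t"
        by (intro ball_int_cong[OF t]) (use t in \<open>simp add: mem_tube k_def\<close>)
      also have "\<dots> = ball_int r R (\<lambda>p. dt S \<rho>' p *\<^sub>R (snd p - k)) t - ball_int r R (\<lambda>p. \<rho>' p *\<^sub>R rc' (fst p)) t"
        by (intro ball_int_diff t continuous_intros c sk time_cont rc'c)
      finally show ?thesis by (simp add: ball_int_time_scale[OF c(3) t])
    qed
    finally show ?thesis
      unfolding gauss_moment[OF C1(3) t] gauss_moment[OF C1(4) t] vel[OF t] bk by simp
  qed
qed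

text \<open>The charge center is an average of points of the ball.\<close>

lemma charge_center_near:
  fixes \<rho> :: "spacetime \<Rightarrow> real"
  assumes \<rho>: "continuous_on S \<rho>" "\<And>p. 0 \<le> \<rho> p" and t: "t \<in> I" and pos: "0 < ball_int r R \<rho> t"
  shows "norm (charge_center r R \<rho> t - r t) \<le> R"
proof -
  let ?b = "ball_int r R \<rho> t"
  have c: "continuous_on S (\<lambda>p. \<rho> p *\<^sub>R (snd p - r (fst p)))"
    by (intro continuous_intros \<rho> time_cont r_cont)
  have "ball_int r R (\<lambda>p. \<rho> p *\<^sub>R (snd p - r (fst p)) + \<rho> p *\<^sub>R r (fst p)) t
      = ball_int r R (\<lambda>p. \<rho> p *\<^sub>R (snd p - r (fst p))) t + ?b *\<^sub>R r t"
    by (subst ball_int_add[OF _ _ t]) (auto intro!: continuous_intros \<rho> time_cont r_cont simp: ball_int_time_scale[OF \<rho>(1) t])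
  then have "charge_center r R \<rho> t - r t = (1 / ?b) *\<^sub>R ball_int r R (\<lambda>p. \<rho> p *\<^sub>R (snd p - r (fst p))) t"
    using pos by (simp add: charge_center_def scaleR_diff_right algebra_simps)
  also have "norm \<dots> = (1 / ?b) * norm (ball_int r R (\<lambda>p. \<rho> p *\<^sub>R (snd p - r (fst p))) t)"
    using pos by simp
  also have "\<dots> \<le> (1 / ?b) * ball_int r R (\<lambda>p. \<rho> p *\<^sub>R R) t"
    using pos \<rho>(2) by (intro mult_left_mono norm_ball_int_le c continuous_intros \<rho>(1) t)
      (auto simp: dist_norm norm_minus_commute intro!: mult_left_mono)
  also have "ball_int r R (\<lambda>p. \<rho> p *\<^sub>R R) t = ?b * R"
    using ball_int_linear[OF bounded_linear_scaleR_left \<rho>(1) t, of R] by simp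
  finally show ?thesis using pos by simp
qed

end


section \<open>The densities of the NLS equation\<close>

text \<open>The curl as a sum of cross products; this form is linear in the partial derivatives and is the
  convenient one for continuity and differentiation.\<close>

lemma curl_eq: "curl S F p = (\<Sum>i\<in>UNIV. cross3 (axis i 1) (dx S i F p))"
  by (simp add: curl_def sum_3 vec_eq_iff forall_3 cross3_def axis_def)

context nls
begin

text \<open>\<open>G1'\<close> may be unbounded near 0, but the continuity of \<open>nl_g\<close> bounds \<open>sqrt s * G1' s\<close> there.  Hence the
  integrand of \<open>Ga\<close> is integrable up to 0.\<close>

lemma Ga_eq:
  assumes nl: nonlinearity_condition and a: "0 < a" and s: "0 \<le> s"
  shows "Ga a s = (G1 (a ^ 3 * s) - G1 0) / a ^ 5"
proof (cases "s = 0")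
  case True
  then show ?thesis by (simp add: Ga_def)
next
  case False
  with s have s: "0 < s" by simp
  define b where "b = a ^ 3"
  have b: "0 < b" using a by (simp add: b_def)
  have G1': "continuous_on {0<..} G1'" and G1_der: "\<And>x. 0 < x \<Longrightarrow> (G1 has_real_derivative G1' x) (at x)"
    and G1c: "continuous_on {0..} G1" and gc: "continuous_on UNIV nl_g"
    using nl by (auto simp: nonlinearity_condition_def)
  have "bounded (nl_g ` cball 0 (sqrt (b * s)))"
    by (intro compact_imp_bounded compact_continuous_image continuous_on_subset[OF gc]) auto
  from bounded_normE[OF this] obtain K where K: "\<And>z. z \<in> cball 0 (sqrt (b * s)) \<Longrightarrow> norm (nl_g z) \<le> K"
    by (metis imageI)
  have bound: "\<bar>G1' (b * x)\<bar> \<le> K / sqrt b * (1 / sqrt x)" if x: "0 < x" "x < s" for x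
  proof -
    define y where "y = sqrt (b * x)"
    have y: "0 < y" using b x by (simp add: y_def)
    have "norm (nl_g (complex_of_real y)) \<le> K"
      using b x by (intro K) (simp add: y_def)
    moreover have "norm (nl_g (complex_of_real y)) = \<bar>G1' (b * x)\<bar> * y"
      using y b x by (simp add: nl_g_def norm_mult y_def)
    ultimately have "\<bar>G1' (b * x)\<bar> * y \<le> K" by simp
    then show ?thesis using y b x by (simp add: y_def real_sqrt_mult field_simps)
  qed
  have int1: "set_integrable lborel (einterval (ereal 0) (ereal s)) (\<lambda>x. 1 / sqrt x)"
  proof (rule interval_integral_FTC_nonneg(1)[where F = "\<lambda>x. 2 * sqrt x" and A = 0 and B = "2 * sqrt s"])
    show "((\<lambda>x. 2 * sqrt x) has_real_derivative 1 / sqrt x) (at x)" if "ereal 0 < ereal x" for x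
      using that by (auto intro!: derivative_eq_intros simp: field_simps)
    show "isCont (\<lambda>x. 1 / sqrt x) x" if "ereal 0 < ereal x" for x
      using that by (auto intro!: continuous_intros)
    have "((\<lambda>x. 2 * sqrt x) \<longlongrightarrow> 2 * sqrt 0) (at_right 0)" by (intro tendsto_intros)
    then show "(((\<lambda>x. 2 * sqrt x) \<circ> real_of_ereal) \<longlongrightarrow> 0) (at_right (ereal 0))"
      by (simp add: ereal_tendsto_simps1)
    have "((\<lambda>x. 2 * sqrt x) \<longlongrightarrow> 2 * sqrt s) (at_left s)" by (intro tendsto_intros)
    then show "(((\<lambda>x. 2 * sqrt x) \<circ> real_of_ereal) \<longlongrightarrow> 2 * sqrt s) (at_left (ereal s))"
      by (simp add: ereal_tendsto_simps1)
  qed (use s in auto)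
  have cont: "isCont (\<lambda>x. G1' (b * x) / a\<^sup>2) x" if "0 < x" for x
  proof -
    have "isCont G1' (b * x)"
      using G1' that b by (intro continuous_on_interior[of "{0<..}"]) (auto simp: interior_open)
    then have "isCont (\<lambda>x. G1' (b * x)) x"
      by (rule isCont_o2[where f = "\<lambda>x. b * x", rotated]) (intro continuous_intros)
    then show ?thesis using a by (intro continuous_divide continuous_const) auto
  qed
  have int: "set_integrable lborel (einterval (ereal 0) (ereal s)) (\<lambda>x. G1' (b * x) / a\<^sup>2)"
  proof (rule set_integrable_bound)
    show "set_integrable lborel (einterval (ereal 0) (ereal s)) (\<lambda>x. K / sqrt b / a\<^sup>2 * (1 / sqrt x))"
      by (rule set_integrable_mult_right[OF int1])
    have "continuous_on {0<..<s} (\<lambda>x. G1' (b * x) / a\<^sup>2)"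
      using cont by (intro continuous_at_imp_continuous_on) auto
    from borel_measurable_continuous_on_indicator[OF _ this]
    show "set_borel_measurable lborel (einterval (ereal 0) (ereal s)) (\<lambda>x. G1' (b * x) / a\<^sup>2)"
      by (simp add: set_borel_measurable_def)
    have "\<bar>G1' (b * x) / a\<^sup>2\<bar> \<le> \<bar>K / sqrt b / a\<^sup>2 * (1 / sqrt x)\<bar>" if x: "0 < x" "x < s" for x
    proof -
      have "\<bar>G1' (b * x) / a\<^sup>2\<bar> = \<bar>G1' (b * x)\<bar> / a\<^sup>2" by simp
      also have "\<dots> \<le> K / sqrt b * (1 / sqrt x) / a\<^sup>2"
        by (intro divide_right_mono bound x) simp
      also have "\<dots> = K / sqrt b / a\<^sup>2 * (1 / sqrt x)" by simp
      also have "\<dots> \<le> \<bar>K / sqrt b / a\<^sup>2 * (1 / sqrt x)\<bar>" by (rule abs_ge_self)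
      finally show ?thesis .
    qed
    then show "AE x in lborel. x \<in> einterval (ereal 0) (ereal s) \<longrightarrow>
        norm (G1' (b * x) / a\<^sup>2) \<le> norm (K / sqrt b / a\<^sup>2 * (1 / sqrt x))"
      by (intro AE_I2) auto
  qed
  define F where "F = (\<lambda>x. G1 (b * x) / a ^ 5)"
  have Fc: "continuous_on {0..} F"
    unfolding F_def using a b by (intro continuous_intros continuous_on_compose2[OF G1c]) auto
  have "(LBINT x=ereal 0..ereal s. G1' (b * x) / a\<^sup>2) = F s - F 0"
  proof (rule interval_integral_FTC_integrable[OF _ _ _ int])
    show "(F has_vector_derivative G1' (b * x) / a\<^sup>2) (at x)" if "ereal 0 < ereal x" for x
    proof -
      have "(G1 has_real_derivative G1' (b * x)) (at (b * x))" using that b by (intro G1_der) simp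
      moreover have "((\<lambda>x. b * x) has_real_derivative b) (at x)" by (auto intro!: derivative_eq_intros)
      ultimately have "((\<lambda>x. G1 (b * x)) has_real_derivative G1' (b * x) * b) (at x)"
        by (rule DERIV_chain2)
      then have "(F has_real_derivative G1' (b * x) * b / a ^ 5) (at x)"
        unfolding F_def by (rule DERIV_cdivide)
      moreover have "G1' (b * x) * b / a ^ 5 = G1' (b * x) / a\<^sup>2"
        using a by (simp add: b_def field_simps flip: power_add)
      ultimately show ?thesis by (simp add: has_real_derivative_iff_has_vector_derivative)
    qed
    have "(F \<longlongrightarrow> F 0) (at 0 within {0..})" using Fc by (auto simp: continuous_on)
    then have "(F \<longlongrightarrow> F 0) (at_right 0)"
      by (rule tendsto_within_subset) auto
    then show "((F \<circ> real_of_ereal) \<longlongrightarrow> F 0) (at_right (ereal 0))"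
      by (simp only: ereal_tendsto_simps1)
    have "isCont F s" using Fc s by (intro continuous_on_interior[OF Fc]) (simp add: interior_real_atLeast)
    then have "(F \<longlongrightarrow> F s) (at_left s)"
      unfolding isCont_def by (rule tendsto_within_subset) auto
    then show "((F \<circ> real_of_ereal) \<longlongrightarrow> F s) (at_left (ereal s))"
      by (simp only: ereal_tendsto_simps1)
  qed (use s cont in auto)
  then show ?thesis
    by (simp add: Ga_def Ga'_def F_def b_def diff_divide_distrib)
qed

text \<open>By \<open>Ga_eq\<close>, \<open>Ga a (|z|\<^sup>2)\<close> is \<open>G1 (|k z|\<^sup>2)\<close> up to scaling and a constant, with \<open>k\<^sup>2 = a\<^sup>3\<close>, and the condition
  on the nonlinearity provides the derivative of the latter, also at \<open>z = 0\<close>.\<close>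

lemma has_C1_Ga:
  assumes nl: nonlinearity_condition and a: "0 < a" and \<psi>: "has_C1 S \<psi> \<psi>'"
  shows "has_C1 S (\<lambda>p. Ga a ((cmod (\<psi> p))\<^sup>2))
    (\<lambda>p h. Re (nl_g (sqrt (a ^ 3) *\<^sub>R \<psi> p) * cnj (sqrt (a ^ 3) *\<^sub>R \<psi>' p h)
      + cnj (nl_g (sqrt (a ^ 3) *\<^sub>R \<psi> p)) * (sqrt (a ^ 3) *\<^sub>R \<psi>' p h)) / a ^ 5)"
proof -
  let ?k = "sqrt (a ^ 3)"
  have gc: "continuous_on UNIV nl_g" and
    der: "((\<lambda>z. complex_of_real (G1 ((cmod z)\<^sup>2))) has_derivative (\<lambda>h. nl_g z * cnj h + cnj (nl_g z) * h)) (at z)" for z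
    using nl by (auto simp: nonlinearity_condition_def)
  have k: "?k\<^sup>2 = a ^ 3" using a by simp
  have Ga: "Ga a ((cmod z)\<^sup>2) = Re (complex_of_real (G1 ((cmod (?k *\<^sub>R z))\<^sup>2))) / a ^ 5 - G1 0 / a ^ 5" for z
    using a by (subst Ga_eq[OF nl a]) (simp_all add: power_mult_distrib k diff_divide_distrib)
  have "((\<lambda>z. Ga a ((cmod z)\<^sup>2)) has_derivative (\<lambda>h. Re (nl_g (?k *\<^sub>R z) * cnj (?k *\<^sub>R h)
      + cnj (nl_g (?k *\<^sub>R z)) * (?k *\<^sub>R h)) / a ^ 5)) (at z)" for z
  proof -
    have "((\<lambda>z. ?k *\<^sub>R z) has_derivative (\<lambda>h. ?k *\<^sub>R h)) (at z)"
      by (intro bounded_linear_imp_has_derivative bounded_linear_scaleR_right)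
    from has_derivative_compose[OF this der]
    have "((\<lambda>z. Re (complex_of_real (G1 ((cmod (?k *\<^sub>R z))\<^sup>2)))) has_derivative
        (\<lambda>h. Re (nl_g (?k *\<^sub>R z) * cnj (?k *\<^sub>R h) + cnj (nl_g (?k *\<^sub>R z)) * (?k *\<^sub>R h)))) (at z)"
      by (rule bounded_linear.has_derivative[OF bounded_linear_Re])
    from has_derivative_diff[OF bounded_linear.has_derivative[OF bounded_linear_divide this] has_derivative_const]
    show ?thesis unfolding Ga by simp
  qed
  moreover have "continuous_on UNIV (\<lambda>(z, h). Re (nl_g (?k *\<^sub>R z) * cnj (?k *\<^sub>R h)
      + cnj (nl_g (?k *\<^sub>R z)) * (?k *\<^sub>R h)) / a ^ 5)"
    unfolding case_prod_unfold using a
    by (intro continuous_intros continuous_on_compose2[OF gc]) auto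
  ultimately show ?thesis by (rule has_C1_compose[OF \<psi>])
qed

lemma current_eq_momentum:
  assumes "m \<noteq> 0"
  shows "current_density S A \<psi> p = (q / m) *\<^sub>R momentum_density S A \<psi> p"
  using assms by (simp add: current_density_def momentum_density_def vec_eq_iff field_simps)

lemma charge_density_eq: "charge_density \<psi> p = q * (cmod (\<psi> p))\<^sup>2"
  unfolding charge_density_def mult.assoc complex_norm_square[symmetric] by simp

end

text \<open>The NLS densities on the tube of a moving ball.\<close>

locale nls_ball = nls m q chi c G1 G1' + moving_ball Tm Tp r R
  for m q chi c :: real and G1 G1' and Tm Tp :: real and r and R :: real +
  assumes constants_pos: "0 < m" "0 < q" "0 < chi" "0 < c"
begin

lemma C1_on_mult: "C1_on S f \<Longrightarrow> C1_on S g \<Longrightarrow> C1_on S (\<lambda>p. f p * g p)" for f g :: "spacetime \<Rightarrow> complex"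
  by (rule C1_on_bilinear[OF bounded_bilinear_mult])

lemma C1_on_cnj: "C1_on S f \<Longrightarrow> C1_on S (\<lambda>p. cnj (f p))"
  by (rule C1_on_linear[OF bounded_linear_cnj])

lemma C1_on_Re: "C1_on S f \<Longrightarrow> C1_on S (\<lambda>p. Re (f p))"
  by (rule C1_on_linear[OF bounded_linear_Re])

lemma C1_on_diff: "C1_on S f \<Longrightarrow> C1_on S g \<Longrightarrow> C1_on S (\<lambda>p. f p - g p)"
  using C1_on_add[of f "\<lambda>p. - g p"] C1_on_linear[OF bounded_linear_minus[OF bounded_linear_ident], of g] by simp

lemma C2_onD:
  assumes "C2_on S f"
  shows "C1_on S f" "C1_on S (dt S f)" "C1_on S (dx S i f)"
  using assms by (auto simp: C2_on_def)

lemma dx_cnj: "C1_on S f \<Longrightarrow> p \<in> S \<Longrightarrow> dx S i (\<lambda>p. cnj (f p)) p = cnj (dx S i f p)"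
  by (subst has_C1_dx[OF has_C1_linear[OF bounded_linear_cnj C1_on_has_C1]]) simp_all

lemma dt_cnj: "C1_on S f \<Longrightarrow> p \<in> S \<Longrightarrow> dt S (\<lambda>p. cnj (f p)) p = cnj (dt S f p)"
  by (rule dt_linear[OF bounded_linear_cnj])

lemma cov_x_star_cnj: "C1_on S f \<Longrightarrow> p \<in> S \<Longrightarrow> cov_x_star S A j (\<lambda>p. cnj (f p)) p = cnj (cov_x S A j f p)"
  by (simp add: cov_x_star_def cov_x_def dx_cnj)

lemma cov_t_star_cnj: "C1_on S f \<Longrightarrow> p \<in> S \<Longrightarrow> cov_t_star S \<phi> (\<lambda>p. cnj (f p)) p = cnj (cov_t S \<phi> f p)"
  by (simp add: cov_t_star_def cov_t_def dt_cnj)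

lemma C1_cov_x:
  assumes "C2_on S f" "C1_on S A"
  shows "C1_on S (cov_x S A j f)"
proof -
  have "C1_on S (\<lambda>p. dx S j f p + A p $ j *\<^sub>R (- \<i> * complex_of_real (q / (chi * c)) * f p))"
    by (intro C1_on_add C1_on_scaleR C1_on_nth C1_on_mult C1_on_const C2_onD assms)
  then show ?thesis
    by (rule C1_on_cong) (simp add: cov_x_def scaleR_conv_of_real mult_ac)
qed

lemma C1_cov_t:
  assumes "C2_on S f" "C1_on S \<phi>"
  shows "C1_on S (cov_t S \<phi> f)"
proof -
  have "C1_on S (\<lambda>p. dt S f p + \<phi> p *\<^sub>R (\<i> * complex_of_real (q / chi) * f p))"
    by (intro C1_on_add C1_on_scaleR C1_on_mult C1_on_const C2_onD assms)
  then show ?thesis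
    by (rule C1_on_cong) (simp add: cov_t_def scaleR_conv_of_real mult_ac)
qed

lemma C1_charge_density: "C1_on S \<psi> \<Longrightarrow> C1_on S (charge_density \<psi>)"
  unfolding charge_density_def[abs_def] by (intro C1_on_Re C1_on_mult C1_on_const C1_on_cnj)

lemma C1_momentum_density:
  assumes "C2_on S \<psi>" "C1_on S A"
  shows "C1_on S (momentum_density S A \<psi>)"
proof (rule C1_on_vec)
  fix j
  have "C1_on S (\<lambda>p. Re (\<i> * complex_of_real (chi / 2) *
     (\<psi> p * cnj (cov_x S A j \<psi> p) - cnj (\<psi> p) * cov_x S A j \<psi> p)))"
    by (intro C1_on_Re C1_on_mult C1_on_diff C1_on_const C1_on_cnj C1_cov_x assms C2_onD(1))
  then show "C1_on S (\<lambda>p. momentum_density S A \<psi> p $ j)"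
    by (rule C1_on_cong) (simp add: momentum_density_def cov_x_star_cnj C2_onD(1)[OF assms(1)])
qed

lemma C1_current_density:
  assumes "C2_on S \<psi>" "C1_on S A"
  shows "C1_on S (current_density S A \<psi>)"
proof -
  have "C1_on S (\<lambda>p. (q / m) *\<^sub>R momentum_density S A \<psi> p)"
    by (intro C1_on_scaleR C1_on_const C1_momentum_density assms)
  then show ?thesis
    by (rule C1_on_cong) (use constants_pos in \<open>simp add: current_eq_momentum\<close>)
qed

lemma C1_u_density:
  assumes nl: nonlinearity_condition and a: "0 < a" and \<psi>: "C2_on S \<psi>" and A: "C1_on S A"
  shows "C1_on S (u_density a S A \<psi>)"
proof -
  have G: "C1_on S (\<lambda>p. Ga a ((cmod (\<psi> p))\<^sup>2))"
    by (rule has_C1_C1_on[OF has_C1_Ga[OF nl a C1_on_has_C1[OF C2_onD(1)[OF \<psi>]]]])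
  have c: "C1_on S (\<lambda>p. Re (cov_x S A j \<psi> p * cnj (cov_x S A j \<psi> p)))" for j
    by (intro C1_on_Re C1_on_mult C1_on_cnj C1_cov_x \<psi> A)
  have "C1_on S (\<lambda>p. (chi\<^sup>2 / (2 * m)) *\<^sub>R (Re (cov_x S A 1 \<psi> p * cnj (cov_x S A 1 \<psi> p))
     + Re (cov_x S A 2 \<psi> p * cnj (cov_x S A 2 \<psi> p)) + Re (cov_x S A 3 \<psi> p * cnj (cov_x S A 3 \<psi> p))
     + Ga a ((cmod (\<psi> p))\<^sup>2)))"
    by (intro C1_on_scaleR C1_on_const C1_on_add c G)
  then show ?thesis
    by (rule C1_on_cong) (simp only: u_density_def sum_3 complex_norm_square[symmetric] Re_complex_of_real real_scaleR_def)
qed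

lemma C1_stress_tensor:
  assumes nl: nonlinearity_condition and a: "0 < a" and \<psi>: "C2_on S \<psi>" and A: "C1_on S A" and \<phi>: "C1_on S \<phi>"
  shows "C1_on S (stress_tensor a S \<phi> A \<psi> i j)"
proof (cases "i = j")
  case False
  have "C1_on S (\<lambda>p. Re (complex_of_real (chi\<^sup>2 / (2 * m)) *
          (cov_x S A i \<psi> p * cnj (cov_x S A j \<psi> p) + cov_x S A j \<psi> p * cnj (cov_x S A i \<psi> p))))"
    by (intro C1_on_Re C1_on_mult C1_on_add C1_on_const C1_on_cnj C1_cov_x \<psi> A)
  then show ?thesis
    by (rule C1_on_cong) (simp add: stress_tensor_def False cov_x_star_cnj C2_onD(1)[OF \<psi>])
next
  case True
  have "C1_on S (\<lambda>p. Re (complex_of_real (chi\<^sup>2 / m) * (cov_x S A i \<psi> p * cnj (cov_x S A i \<psi> p))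
          + \<i> * complex_of_real (chi / 2) *
              (cnj (\<psi> p) * cov_t S \<phi> \<psi> p - \<psi> p * cnj (cov_t S \<phi> \<psi> p))) - u_density a S A \<psi> p)"
    by (intro C1_on_Re C1_on_mult C1_on_add C1_on_diff C1_on_const C1_on_cnj C1_cov_x C1_cov_t
        C1_u_density[OF nl a] \<psi> A \<phi> C2_onD(1)[OF \<psi>])
  then show ?thesis
    by (rule C1_on_cong) (simp add: stress_tensor_def True cov_x_star_cnj cov_t_star_cnj C2_onD(1)[OF \<psi>])
qed

lemma Efield_cont: "C1_on S \<phi> \<Longrightarrow> C1_on S A \<Longrightarrow> continuous_on S (Efield S \<phi> A)"
  unfolding Efield_def[abs_def] grad_def by (intro continuous_intros C1_onD)

lemma Bfield_cont: "C1_on S A \<Longrightarrow> continuous_on S (Bfield S A)"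
  unfolding Bfield_def[abs_def] curl_eq by (intro continuous_intros C1_onD)

lemma lorentz_force_cont:
  assumes "C2_on S \<psi>" "C1_on S A" "C1_on S \<phi>"
  shows "continuous_on S (lorentz_force S \<phi> A \<psi>)"
  unfolding lorentz_force_def[abs_def]
  by (intro continuous_intros Efield_cont Bfield_cont C1_onD(1)[OF C1_charge_density] 
      C1_onD(1)[OF C1_current_density] C2_onD(1) assms)

text \<open>The first two terms on the right-hand side are \<open>Q30\<close> and \<open>Q31\<close>; in the last term the current is
  replaced by the momentum.\<close>

lemma total_lorentz_force:
  assumes \<psi>: "C2_on S \<psi>" and A: "C1_on S A" and \<phi>: "C1_on S \<phi>"
    and E: "continuous_on I E" and B: "continuous_on I B" and t: "t \<in> I"
  shows "ball_int r R (lorentz_force S \<phi> A \<psi>) t =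
      ball_int r R (\<lambda>p. charge_density \<psi> p *\<^sub>R (Efield S \<phi> A p - E (fst p))) t
    + ball_int r R (\<lambda>p. (1 / c) *\<^sub>R cross3 (current_density S A \<psi> p) (Bfield S A p - B (fst p))) t
    + (ball_int r R (charge_density \<psi>) t *\<^sub>R E t
       + (q / (m * c)) *\<^sub>R cross3 (ball_int r R (momentum_density S A \<psi>) t) (B t))"
proof -
  have c: "continuous_on S (charge_density \<psi>)" "continuous_on S (current_density S A \<psi>)"
      "continuous_on S (momentum_density S A \<psi>)"
    using C1_onD(1) C1_charge_density C1_current_density C1_momentum_density C2_onD(1) \<psi> A by blast+
  note bb = bounded_bilinear_cross3
  let ?f1 = "\<lambda>p. charge_density \<psi> p *\<^sub>R (Efield S \<phi> A p - E (fst p))"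
  let ?f2 = "\<lambda>p. (1 / c) *\<^sub>R cross3 (current_density S A \<psi> p) (Bfield S A p - B (fst p))"
  let ?L = "\<lambda>x. (q / (m * c)) *\<^sub>R cross3 x (B t)"
  let ?f3 = "\<lambda>p. charge_density \<psi> p *\<^sub>R E (fst p)" and ?f4 = "\<lambda>p. (q / (m * c)) *\<^sub>R cross3 (momentum_density S A \<psi> p) (B (fst p))"
  have f: "continuous_on S ?f1" "continuous_on S ?f2" "continuous_on S ?f3" "continuous_on S ?f4"
    by (intro continuous_intros c Efield_cont Bfield_cont \<phi> A time_cont E B)+
  have "lorentz_force S \<phi> A \<psi> p = (?f1 p + ?f2 p) + (?f3 p + ?f4 p)" for p
    using constants_pos by (simp add: lorentz_force_def current_eq_momentum algebra_simps
        bounded_bilinear.diff_right[OF bb] bounded_bilinear.scaleR_left[OF bb])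
  then have "ball_int r R (lorentz_force S \<phi> A \<psi>) t = ball_int r R (\<lambda>p. (?f1 p + ?f2 p) + (?f3 p + ?f4 p)) t"
    by presburger
  also have "\<dots> = (ball_int r R ?f1 t + ball_int r R ?f2 t) + (ball_int r R ?f3 t + ball_int r R ?f4 t)"
    using f t by (simp add: ball_int_add continuous_on_add)
  also have "ball_int r R ?f3 t = ball_int r R (charge_density \<psi>) t *\<^sub>R E t"
    by (rule ball_int_time_scale[OF c(1) t])
  also have "ball_int r R ?f4 t = ball_int r R (\<lambda>p. ?L (momentum_density S A \<psi> p)) t"
    by (simp add: ball_int_def)
  also have "\<dots> = ?L (ball_int r R (momentum_density S A \<psi>) t)"
    by (intro ball_int_linear c t bounded_linear_compose[OF bounded_linear_scaleR_right]
        bounded_bilinear.bounded_linear_left[OF bb])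
  finally show ?thesis .
qed

end

section \<open>The limit fields\<close>

lemma C1_along_curve:
  assumes F: "C1_on D F" and r: "(r has_vector_derivative v) (at t within I)" and rD: "\<And>s. s \<in> I \<Longrightarrow> (s, r s) \<in> D" and t: "t \<in> I"
  shows "((\<lambda>s. F (s, r s)) has_vector_derivative C1_deriv D F (t, r t) (1, v)) (at t within I)"
proof -
  have "(F has_derivative C1_deriv D F (t, r t)) (at (t, r t) within D)"
    using C1_on_has_C1[OF F] rD[OF t] unfolding has_C1_def by blast
  then have "(F has_derivative C1_deriv D F (t, r t)) (at (t, r t) within (\<lambda>s. (s, r s)) ` I)"
    by (rule has_derivative_subset) (use rD in auto)
  moreover have "((\<lambda>s. (s, r s)) has_vector_derivative (1, v)) (at t within I)"
    by (intro has_vector_derivative_Pair has_vector_derivative_id r)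
  ultimately show ?thesis
    using vector_derivative_diff_chain_within[of "\<lambda>s. (s, r s)" "(1, v)" t I F] by (simp add: o_def)
qed

lemma slab_unique:
  assumes "Tm < Tp" "t \<in> {Tm..Tp}"
    and f: "(f has_derivative f') (at (t, x) within slab Tm Tp)"
  shows "frechet_derivative f (at (t, x) within slab Tm Tp) = f'"
proof (rule frechet_derivative_unique_within[OF _ f])
  show "(f has_derivative frechet_derivative f (at (t, x) within slab Tm Tp)) (at (t, x) within slab Tm Tp)"
    using f unfolding frechet_derivative_works[symmetric] differentiable_def by blast
  fix i :: spacetime and e :: real
  assume i: "i \<in> Basis" and e: "0 < e"
  show "\<exists>d. 0 < \<bar>d\<bar> \<and> \<bar>d\<bar> < e \<and> (t, x) + d *\<^sub>R i \<in> slab Tm Tp"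
  proof (cases "snd i = 0")
    case True
    with i have i: "i = (1, 0)" by (auto simp: Basis_prod_def zero_prod_def)
    define d where "d = min (e / 2) (Tp - Tm) / 2"
    have d: "0 < d" "d < e" "2 * d \<le> Tp - Tm" using e assms by (auto simp: d_def min_def)
    show ?thesis
    proof (cases "t + d \<le> Tp")
      case True
      then show ?thesis using d assms(2) by (intro exI[of _ d]) (auto simp: i slab_def)
    next
      case False
      then show ?thesis using d assms(2) by (intro exI[of _ "- d"]) (auto simp: i slab_def)
    qed
  next
    case False
    with i have "fst i = 0" by (auto simp: Basis_prod_def)
    then show ?thesis using e assms(2) by (intro exI[of _ "e / 2"]) (auto simp: slab_def mem_Times_iff)
  qed
qed

text \<open>At the point \<open>(t, r t)\<close> of the trajectory a field and its linear part have the same derivative: the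
  terms from the motion of \<open>r\<close> cancel, and the derivatives of the coefficients are multiplied by
  \<open>x - r t = 0\<close>.\<close>

lemma linear_part_has_derivative:
  fixes F :: "spacetime \<Rightarrow> 'b::real_normed_vector"
  assumes F: "C2_on D F" and r: "(r has_vector_derivative v) (at t within {Tm..Tp})"
    and rD: "\<And>s. s \<in> {Tm..Tp} \<Longrightarrow> (s, r s) \<in> D" and t: "t \<in> {Tm..Tp}"
  shows "(linear_part D r F has_derivative C1_deriv D F (t, r t)) (at (t, r t) within slab Tm Tp)"
proof -
  let ?I = "{Tm..Tp}" and ?p = "(t, r t)"
  have F1: "C1_on D F" and F2: "C1_on D (dx D i F)" for i using F by (auto simp: C2_on_def)
  have tm: "((\<lambda>p. g (fst p)) has_derivative (\<lambda>h. fst h *\<^sub>R g')) (at ?p within slab Tm Tp)"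
    if "(g has_vector_derivative g') (at t within ?I)" for g :: "real \<Rightarrow> 'c::real_normed_vector" and g'
  proof -
    have "(g has_derivative (\<lambda>h. h *\<^sub>R g')) (at (fst ?p) within fst ` slab Tm Tp)"
      using that by (simp add: has_vector_derivative_def slab_def)
    moreover have "(fst has_derivative fst) (at ?p within slab Tm Tp)" by (auto intro!: derivative_eq_intros)
    ultimately show ?thesis
      using diff_chain_within[of fst fst ?p "slab Tm Tp" g "\<lambda>h. h *\<^sub>R g'"] by (simp add: o_def)
  qed
  have y: "((\<lambda>p. (snd p - r (fst p)) $ i) has_derivative (\<lambda>h. (snd h - fst h *\<^sub>R v) $ i)) (at ?p within slab Tm Tp)" for i
    by (intro bounded_linear.has_derivative[OF bounded_linear_vec_nth] has_derivative_diff tm[OF r])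
      (auto intro!: derivative_eq_intros)
  have "((\<lambda>p. F (fst p, r (fst p)) + (\<Sum>i\<in>UNIV. (snd p - r (fst p)) $ i *\<^sub>R dx D i F (fst p, r (fst p)))) has_derivative
     (\<lambda>h. fst h *\<^sub>R C1_deriv D F ?p (1, v) + (\<Sum>i\<in>UNIV. (snd ?p - r (fst ?p)) $ i *\<^sub>R (fst h *\<^sub>R C1_deriv D (dx D i F) ?p (1, v))
        + (snd h - fst h *\<^sub>R v) $ i *\<^sub>R dx D i F (fst ?p, r (fst ?p))))) (at ?p within slab Tm Tp)"
    by (intro has_derivative_add has_derivative_sum has_derivative_scaleR y
        tm[OF C1_along_curve[OF F1 r rD t]] tm[OF C1_along_curve[OF F2 r rD t]])
  then have "(linear_part D r F has_derivative (\<lambda>h. fst h *\<^sub>R C1_deriv D F ?p (1, v)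
      + (\<Sum>i\<in>UNIV. (snd h - fst h *\<^sub>R v) $ i *\<^sub>R dx D i F ?p))) (at ?p within slab Tm Tp)"
    by (simp add: linear_part_def[abs_def] Let_def grad_def)
  moreover have "fst h *\<^sub>R C1_deriv D F ?p (1, v) + (\<Sum>i\<in>UNIV. (snd h - fst h *\<^sub>R v) $ i *\<^sub>R dx D i F ?p)
      = C1_deriv D F ?p h" for h
    by (simp add: C1_deriv_def scaleR_add_right scaleR_sum_right scaleR_diff_left sum_subtractf)
  ultimately show ?thesis by simp
qed


lemma linear_part_dt_dx:
  fixes F :: "spacetime \<Rightarrow> 'b::real_normed_vector"
  assumes F: "C2_on D F" and traj: "trajectory Tm Tp r" and T: "Tm < Tp"
    and rD: "\<And>s. s \<in> {Tm..Tp} \<Longrightarrow> (s, r s) \<in> D" and t: "t \<in> {Tm..Tp}"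
  shows "dt (slab Tm Tp) (linear_part D r F) (t, r t) = dt D F (t, r t)"
    and "dx (slab Tm Tp) i (linear_part D r F) (t, r t) = dx D i F (t, r t)"
proof -
  \<comment> \<open>The radius is irrelevant here.\<close>
  interpret moving_ball Tm Tp r 1 by unfold_locales (use T traj in auto)
  have "frechet_derivative (linear_part D r F) (at (t, r t) within slab Tm Tp) = C1_deriv D F (t, r t)"
    by (rule slab_unique[OF T t linear_part_has_derivative[OF F vel_deriv[OF t] rD t]])
  then show "dt (slab Tm Tp) (linear_part D r F) (t, r t) = dt D F (t, r t)"
    and "dx (slab Tm Tp) i (linear_part D r F) (t, r t) = dx D i F (t, r t)"
    by (simp_all add: dt_def dx_def C1_deriv_def sum_axis_scaleR)
qed

lemma continuous_on_along_trajectory: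
  assumes "continuous_on D f" "trajectory Tm Tp r" "\<And>s. s \<in> {Tm..Tp} \<Longrightarrow> (s, r s) \<in> D"
  shows "continuous_on {Tm..Tp} (\<lambda>s. f (s, r s))"
proof -
  have "continuous_on {Tm..Tp} r"
    using assms(2) differentiable_imp_continuous_on unfolding trajectory_def by blast
  then show ?thesis
    using assms(3) by (intro continuous_on_compose2[OF assms(1)] continuous_intros) auto
qed

context nls
begin

lemma Efield_along_trajectory_cont:
  assumes "C1_on D \<phi>" "C1_on D A" "trajectory Tm Tp r" "\<And>s. s \<in> {Tm..Tp} \<Longrightarrow> (s, r s) \<in> D"
  shows "continuous_on {Tm..Tp} (\<lambda>s. Efield D \<phi> A (s, r s))"
  by (rule continuous_on_along_trajectory[OF _ assms(3,4)])
    (use assms(1,2) in \<open>auto simp: Efield_def[abs_def] grad_def C1_on_def intro!: continuous_intros\<close>)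

lemma Bfield_along_trajectory:
  assumes A: "C2_on D A" and traj: "trajectory Tm Tp r" and T: "Tm < Tp" and rD: "\<And>s. s \<in> {Tm..Tp} \<Longrightarrow> (s, r s) \<in> D"
  obtains B' where "\<And>t. t \<in> {Tm..Tp} \<Longrightarrow> ((\<lambda>s. Bfield D A (s, r s)) has_vector_derivative B' t) (at t within {Tm..Tp})"
    "continuous_on {Tm..Tp} B'"
proof -
  \<comment> \<open>The radius is irrelevant here.\<close>
  interpret moving_ball Tm Tp r 1 by unfold_locales (use T traj in auto)
  have C1: "C1_on D (dx D i A)" for i using A by (auto simp: C2_on_def)
  define B' where "B' = (\<lambda>t. \<Sum>i\<in>UNIV. cross3 (axis i 1) (C1_deriv D (dx D i A) (t, r t) (1, v t)))"
  show ?thesis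
  proof
    fix t assume t: "t \<in> {Tm..Tp}"
    show "((\<lambda>s. Bfield D A (s, r s)) has_vector_derivative B' t) (at t within {Tm..Tp})"
      unfolding B'_def Bfield_def curl_eq
      by (intro has_vector_derivative_sum bounded_linear.has_vector_derivative[OF
            bounded_bilinear.bounded_linear_right[OF bounded_bilinear_cross3]]
          C1_along_curve[OF C1 vel_deriv[OF t] rD t])
  next
    have "continuous_on {Tm..Tp} (\<lambda>s. dt D (dx D i A) (s, r s))"
      "continuous_on {Tm..Tp} (\<lambda>s. dx D j (dx D i A) (s, r s))" for i j
      using C1[of i] by (auto intro!: continuous_on_along_trajectory[OF _ traj rD] simp: C1_on_def)
    then show "continuous_on {Tm..Tp} B'"
      unfolding B'_def C1_deriv_def by (auto intro!: continuous_intros v_cont)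
  qed
qed

section \<open>Newton's law\<close>

lemma concentration_newton:
  assumes pos: "m > 0" "q > 0" "chi > 0" "c > 0" and T: "Tm < Tp"
    and C2: "C2_on D \<phi>" "C2_on D A" and traj: "trajectory Tm Tp r" and rD: "\<And>t. t \<in> {Tm..Tp} \<Longrightarrow> (t, r t) \<in> D"
    and conc: "asymptotic_solutions_concentrate Tm Tp r (linear_part D r \<phi>) (linear_part D r A) \<psi>"
    and t: "t \<in> {Tm..Tp}"
  shows "m *\<^sub>R acc Tm Tp r t = q *\<^sub>R Efield D \<phi> A (t, r t) + (q / c) *\<^sub>R cross3 (vel Tm Tp r t) (Bfield D A (t, r t))"
proof -
  obtain a R \<phi>n An where nl: nonlinearity_condition
    and a: "\<forall>n. 0 < a n" and R: "\<forall>n. 0 < R n" and R0: "R \<longlonglongrightarrow> (0::real)"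
    and pot: "localized_potentials Tm Tp r R \<phi>n An (linear_part D r \<phi>) (linear_part D r A)"
    and \<psi>2: "\<forall>n. C2_on (tube Tm Tp r (R n)) (\<psi> n)"
    and P_bd: "\<exists>C. \<forall>n. \<forall>t\<in>{Tm..Tp}. norm (ball_int r (R n) (momentum_density (tube Tm Tp r (R n)) (An n) (\<psi> n)) t) \<le> C"
    and \<rho>_bd: "\<exists>C. \<exists>c0>0. \<exists>n0. \<forall>n\<ge>n0. \<forall>t\<in>{Tm..Tp}. c0 \<le> ball_int r (R n) (charge_density (\<psi> n)) t
        \<and> ball_int r (R n) (charge_density (\<psi> n)) t \<le> C"
    and t0_ex: "\<exists>t0\<in>{Tm..Tp}. \<exists>\<rho>inf. (\<lambda>n. ball_int r (R n) (charge_density (\<psi> n)) t0) \<longlonglongrightarrow> \<rho>inf \<and>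
       perturbed_conservation_laws Tm Tp r R t0 (\<lambda>n. charge_density (\<psi> n))
         (\<lambda>n. current_density (tube Tm Tp r (R n)) (An n) (\<psi> n))
         (\<lambda>n. momentum_density (tube Tm Tp r (R n)) (An n) (\<psi> n))
         (\<lambda>n. stress_tensor (a n) (tube Tm Tp r (R n)) (\<phi>n n) (An n) (\<psi> n))
         (\<lambda>n. lorentz_force (tube Tm Tp r (R n)) (\<phi>n n) (An n) (\<psi> n)) \<and>
       boundary_terms_vanish Tm Tp r R t0 (\<lambda>n. charge_density (\<psi> n))
         (\<lambda>n. current_density (tube Tm Tp r (R n)) (An n) (\<psi> n))
         (\<lambda>n. momentum_density (tube Tm Tp r (R n)) (An n) (\<psi> n))
         (\<lambda>n. stress_tensor (a n) (tube Tm Tp r (R n)) (\<phi>n n) (An n) (\<psi> n)) \<and>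
       uniform_limit {Tm..Tp} (\<lambda>n. time_int t0 (\<lambda>s.
          ball_int r (R n) (\<lambda>p. charge_density (\<psi> n) p *\<^sub>R (Efield (tube Tm Tp r (R n)) (\<phi>n n) (An n) p -
             Efield (slab Tm Tp) (linear_part D r \<phi>) (linear_part D r A) (fst p, r (fst p)))) s
        + ball_int r (R n) (\<lambda>p. (1 / c) *\<^sub>R cross3 (current_density (tube Tm Tp r (R n)) (An n) (\<psi> n) p)
             (Bfield (tube Tm Tp r (R n)) (An n) p - Bfield (slab Tm Tp) (linear_part D r A) (fst p, r (fst p)))) s))
        (\<lambda>_. 0) sequentially"
  proof -
    show ?thesis
      by (insert conc[unfolded asymptotic_solutions_concentrate_def Let_def],
          elim conjE, (erule exE)+, elim conjE, rule that, assumption+)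
  qed
  define S where "S = (\<lambda>n. tube Tm Tp r (R n))"
  define \<rho> where "\<rho> = (\<lambda>n. charge_density (\<psi> n))"
  define J where "J = (\<lambda>n. current_density (S n) (An n) (\<psi> n))"
  define P where "P = (\<lambda>n. momentum_density (S n) (An n) (\<psi> n))"
  define Te where "Te = (\<lambda>n. stress_tensor (a n) (S n) (\<phi>n n) (An n) (\<psi> n))"
  define f where "f = (\<lambda>n. lorentz_force (S n) (\<phi>n n) (An n) (\<psi> n))"
  define E where "E = (\<lambda>t. Efield D \<phi> A (t, r t))"
  define B where "B = (\<lambda>t. Bfield D A (t, r t))"
  have Einf: "Efield (slab Tm Tp) (linear_part D r \<phi>) (linear_part D r A) (t, r t) = E t" if "t \<in> {Tm..Tp}" for t
  proof -
    have "dx (slab Tm Tp) i (linear_part D r \<phi>) (t, r t) = dx D i \<phi> (t, r t)" for i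
      by (rule linear_part_dt_dx(2)[OF C2(1) traj T _ that]) (rule rD)
    moreover have "dt (slab Tm Tp) (linear_part D r A) (t, r t) = dt D A (t, r t)"
      by (rule linear_part_dt_dx(1)[OF C2(2) traj T _ that]) (rule rD)
    ultimately show ?thesis by (simp add: E_def Efield_def grad_def)
  qed
  have Binf: "Bfield (slab Tm Tp) (linear_part D r A) (t, r t) = B t" if "t \<in> {Tm..Tp}" for t
  proof -
    have "dx (slab Tm Tp) i (linear_part D r A) (t, r t) = dx D i A (t, r t)" for i
      by (rule linear_part_dt_dx(2)[OF C2(2) traj T _ that]) (rule rD)
    then show ?thesis by (simp add: B_def Bfield_def curl_def)
  qed
  have E_cont: "continuous_on {Tm..Tp} E"
    unfolding E_def using C2 by (intro Efield_along_trajectory_cont traj rD) (auto simp: C2_on_def)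
  obtain B' where B_der: "\<And>t. t \<in> {Tm..Tp} \<Longrightarrow> (B has_vector_derivative B' t) (at t within {Tm..Tp})"
    and B'_cont: "continuous_on {Tm..Tp} B'"
    unfolding B_def using Bfield_along_trajectory[OF C2(2) traj T rD] by blast
  have B_cont: "continuous_on {Tm..Tp} B"
    by (rule continuous_on_vector_derivative) (rule B_der)

  have nb: "nls_ball m q chi c Tm Tp r (R n)" for n
    by unfold_locales (use pos T traj R in auto)
  have mb: "moving_ball Tm Tp r (R n)" for n
    by unfold_locales (use T traj R in auto)
  have \<phi>A: "C1_on (S n) (\<phi>n n)" "C1_on (S n) (An n)" for n
    using pot by (auto simp: localized_potentials_def Let_def C2_on_def S_def)
  have \<psi>C: "C2_on (S n) (\<psi> n)" "C1_on (S n) (\<psi> n)" for n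
    using \<psi>2 by (auto simp: S_def C2_on_def)
  have \<rho>C: "C1_on (S n) (\<rho> n)" and JC: "C1_on (S n) (J n)" and PC: "C1_on (S n) (P n)"
    and TC: "C1_on (S n) (Te n i j)" and fc: "continuous_on (S n) (f n)" for n i j
    using nls_ball.C1_charge_density[OF nb, of n "\<psi> n"]
      nls_ball.C1_current_density[OF nb, of n "\<psi> n" "An n"]
      nls_ball.C1_momentum_density[OF nb, of n "\<psi> n" "An n"]
      nls_ball.C1_stress_tensor[OF nb nl, of "a n" n "\<psi> n" "An n" "\<phi>n n" i j]
      nls_ball.lorentz_force_cont[OF nb, of n "\<psi> n" "An n" "\<phi>n n"] a \<phi>A[of n] \<psi>C[of n]
    by (simp_all add: S_def \<rho>_def J_def P_def Te_def f_def)
  define \<rho>b where "\<rho>b = (\<lambda>n. ball_int r (R n) (\<rho> n))"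
  define p where "p = (\<lambda>n. ball_int r (R n) (P n))"
  define x where "x = (\<lambda>n. charge_center r (R n) (\<rho> n))"
  have \<rho>b_cont: "continuous_on {Tm..Tp} (\<rho>b n)" and p_cont: "continuous_on {Tm..Tp} (p n)" for n
    unfolding \<rho>b_def p_def using C1_on_continuous[OF \<rho>C[of n]] C1_on_continuous[OF PC[of n]]
    by (auto intro!: moving_ball.ball_int_cont[OF mb] simp: S_def)

  obtain t0 \<rho>inf where t0: "t0 \<in> {Tm..Tp}" and lim0: "(\<lambda>n. \<rho>b n t0) \<longlonglongrightarrow> \<rho>inf"
    and pert: "perturbed_conservation_laws Tm Tp r R t0 \<rho> J P Te f"
    and bdry: "boundary_terms_vanish Tm Tp r R t0 \<rho> J P Te"
    and fields: "unull {Tm..Tp} (\<lambda>n. time_int t0 (\<lambda>s.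
          ball_int r (R n) (\<lambda>p. \<rho> n p *\<^sub>R (Efield (S n) (\<phi>n n) (An n) p -
             Efield (slab Tm Tp) (linear_part D r \<phi>) (linear_part D r A) (fst p, r (fst p)))) s
        + ball_int r (R n) (\<lambda>p. (1 / c) *\<^sub>R cross3 (J n p)
             (Bfield (S n) (An n) p - Bfield (slab Tm Tp) (linear_part D r A) (fst p, r (fst p)))) s))"
    using t0_ex unfolding \<rho>b_def S_def \<rho>_def J_def P_def Te_def f_def by blast
  obtain \<rho>' J' P' T' f' where
      C1': "\<And>n. C1_on (S n) (\<rho>' n)" "\<And>n. C1_on (S n) (J' n)" "\<And>n. C1_on (S n) (P' n)" "\<And>n i j. C1_on (S n) (T' n i j)"
    and law1: "\<And>n p. p \<in> S n \<Longrightarrow> dt (S n) (\<rho> n) p + dt (S n) (\<rho>' n) p + divergence (S n) (J n) p + divergence (S n) (J' n) p = 0"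
    and law2: "\<And>n p. p \<in> S n \<Longrightarrow> dt (S n) (P n) p + dt (S n) (P' n) p + tensor_divergence (S n) (Te n) p
         + tensor_divergence (S n) (T' n) p = f n p + f' n p"
    and Q0': "unull {Tm..Tp} (\<lambda>n t. ball_int r (R n) (P' n) t - ball_int r (R n) (P' n) t0
            - time_int t0 (bdry_int r (R n) (\<lambda>p. (vel Tm Tp r (fst p) \<bullet> unit_normal r (R n) p) *\<^sub>R P' n p)) t
            + time_int t0 (ball_int r (R n) (tensor_divergence (S n) (T' n))) t
            - time_int t0 (ball_int r (R n) (f' n)) t)"
    and Q2': "unull {Tm..Tp} (\<lambda>n t. ball_int r (R n) (dt (S n) (\<lambda>p. \<rho>' n p *\<^sub>R (snd p - x n (fst p)))) t
            + ball_int r (R n) (\<rho>' n) t *\<^sub>R vel Tm Tp (x n) t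
            + bdry_int r (R n) (\<lambda>p. (unit_normal r (R n) p \<bullet> J' n p) *\<^sub>R (snd p - x n (fst p))) t
            - ball_int r (R n) (J' n) t)"
    and Q3': "unull {Tm..Tp} (\<lambda>n t. ball_int r (R n) (\<rho>' n) t - ball_int r (R n) (\<rho>' n) t0
            - time_int t0 (bdry_int r (R n) (\<lambda>p. vel Tm Tp r (fst p) \<bullet> unit_normal r (R n) p * \<rho>' n p)) t
            + time_int t0 (bdry_int r (R n) (\<lambda>p. unit_normal r (R n) p \<bullet> J' n p)) t)"
    using pert unfolding perturbed_conservation_laws_def Let_def x_def S_def by blast
  have Q0: "unull {Tm..Tp} (\<lambda>n t. time_int t0 (bdry_int r (R n)
                 (\<lambda>p. (\<chi> j. \<Sum>i\<in>UNIV. unit_normal r (R n) p $ i * Te n i j p) :: real^3)) t)"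
    and Q01: "unull {Tm..Tp} (\<lambda>n t. time_int t0 (bdry_int r (R n) (\<lambda>p. (vel Tm Tp r (fst p) \<bullet> unit_normal r (R n) p) *\<^sub>R P n p)) t)"
    and Q20: "unull {Tm..Tp} (\<lambda>n t. - bdry_int r (R n) (\<lambda>p. (vel Tm Tp r (fst p) \<bullet> unit_normal r (R n) p * \<rho> n p) *\<^sub>R (snd p - x n (fst p))) t)"
    and Q22: "unull {Tm..Tp} (\<lambda>n t. bdry_int r (R n) (\<lambda>p. (unit_normal r (R n) p \<bullet> J n p) *\<^sub>R (snd p - x n (fst p))) t)"
    and Q23: "unull {Tm..Tp} (\<lambda>n t. time_int t0 (bdry_int r (R n) (\<lambda>p. vel Tm Tp r (fst p) \<bullet> unit_normal r (R n) p * \<rho> n p)) t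
                      - time_int t0 (bdry_int r (R n) (\<lambda>p. unit_normal r (R n) p \<bullet> J n p)) t)"
    using bdry unfolding boundary_terms_vanish_def Let_def x_def by blast+

  obtain c0 n0 where c0: "0 < c0" "\<And>n t. n0 \<le> n \<Longrightarrow> t \<in> {Tm..Tp} \<Longrightarrow> c0 \<le> \<rho>b n t"
    using \<rho>_bd unfolding \<rho>b_def \<rho>_def by blast
  obtain C where C: "\<And>n t. t \<in> {Tm..Tp} \<Longrightarrow> norm (p n t) \<le> C"
    using P_bd unfolding p_def P_def S_def by blast
  have "c0 \<le> \<rho>inf"
    using c0(2) t0 by (intro LIMSEQ_le_const[OF lim0]) blast
  then have \<rho>inf: "0 < \<rho>inf" using c0 by simp
  have late: "\<forall>\<^sub>F n in sequentially. n0 \<le> n" by (rule eventually_ge_at_top)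
  have \<rho>b_pos: "0 < \<rho>b n t" if "n0 \<le> n" "t \<in> {Tm..Tp}" for n t
    using c0(1) c0(2)[OF that] by linarith

  have "unull {Tm..Tp} (\<lambda>n t. \<rho>b n t - \<rho>b n t0)"
    using unull_diff[OF Q23 Q3']
  proof (rule unull_cong, intro always_eventually allI ballI)
    fix n t assume t: "t \<in> {Tm..Tp}"
    show "(time_int t0 (bdry_int r (R n) (\<lambda>p. vel Tm Tp r (fst p) \<bullet> unit_normal r (R n) p * \<rho> n p)) t
                      - time_int t0 (bdry_int r (R n) (\<lambda>p. unit_normal r (R n) p \<bullet> J n p)) t)
        - (ball_int r (R n) (\<rho>' n) t - ball_int r (R n) (\<rho>' n) t0
            - time_int t0 (bdry_int r (R n) (\<lambda>p. vel Tm Tp r (fst p) \<bullet> unit_normal r (R n) p * \<rho>' n p)) t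
            + time_int t0 (bdry_int r (R n) (\<lambda>p. unit_normal r (R n) p \<bullet> J' n p)) t) = \<rho>b n t - \<rho>b n t0"
      unfolding \<rho>b_def
      by (rule moving_ball.charge_balance[OF mb \<rho>C[unfolded S_def] C1'(1)[unfolded S_def] JC[unfolded S_def]
            C1'(2)[unfolded S_def] t0 t law1[unfolded S_def], symmetric])
  qed
  from unull_add[OF this unull_const[OF LIM_zero[OF lim0]]]
  have \<rho>_lim: "unull {Tm..Tp} (\<lambda>n t. \<rho>b n t - \<rho>inf)" by simp

  have mom: "unull {Tm..Tp} (\<lambda>n t. p n t - p n t0 -
       time_int t0 (\<lambda>s. \<rho>b n s *\<^sub>R E s + (q / (m * c)) *\<^sub>R cross3 (p n s) (B s)) t)"
    using unull_add[OF unull_diff[OF unull_diff[OF Q01 Q0] Q0'] fields]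
  proof (rule unull_cong, intro always_eventually allI ballI)
    fix n t assume t: "t \<in> {Tm..Tp}"
    let ?F = "\<lambda>s. ball_int r (R n) (\<lambda>p. \<rho> n p *\<^sub>R (Efield (S n) (\<phi>n n) (An n) p -
             Efield (slab Tm Tp) (linear_part D r \<phi>) (linear_part D r A) (fst p, r (fst p)))) s
        + ball_int r (R n) (\<lambda>p. (1 / c) *\<^sub>R cross3 (J n p)
             (Bfield (S n) (An n) p - Bfield (slab Tm Tp) (linear_part D r A) (fst p, r (fst p)))) s"
    let ?G = "\<lambda>s. \<rho>b n s *\<^sub>R E s + (q / (m * c)) *\<^sub>R cross3 (p n s) (B s)"
    have telescope: "u - w + (w - z) = u - z" for u w z :: "real^3" by (simp add: algebra_simps)
    have fb: "continuous_on {Tm..Tp} (ball_int r (R n) (f n))"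
      by (rule moving_ball.ball_int_cont[OF mb fc[unfolded S_def]])
    have G: "continuous_on {Tm..Tp} ?G" by (intro continuous_intros \<rho>b_cont p_cont E_cont B_cont)
    have eq: "?F s = ball_int r (R n) (f n) s - ?G s" if s: "s \<in> {Tm..Tp}" for s
      using nls_ball.total_lorentz_force[OF nb \<psi>C(1)[unfolded S_def] \<phi>A(2)[unfolded S_def] \<phi>A(1)[unfolded S_def]
          E_cont B_cont s, of n]
      by (simp add: ball_int_def Einf[OF s] Binf[OF s] S_def \<rho>_def J_def P_def f_def \<rho>b_def p_def)
    have "time_int t0 ?F t = time_int t0 (\<lambda>s. ball_int r (R n) (f n) s - ?G s) t"
      by (rule time_int_cong[OF t0 t eq])
    also have "\<dots> = time_int t0 (ball_int r (R n) (f n)) t - time_int t0 ?G t"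
      by (rule time_int_diff[OF fb G t0 t])
    finally have F: "time_int t0 ?F t = time_int t0 (ball_int r (R n) (f n)) t - time_int t0 ?G t" .
    show "time_int t0 (bdry_int r (R n) (\<lambda>p. (vel Tm Tp r (fst p) \<bullet> unit_normal r (R n) p) *\<^sub>R P n p)) t
       - time_int t0 (bdry_int r (R n) (\<lambda>p. \<chi> j. \<Sum>i\<in>UNIV. unit_normal r (R n) p $ i * Te n i j p)) t
       - (ball_int r (R n) (P' n) t - ball_int r (R n) (P' n) t0
            - time_int t0 (bdry_int r (R n) (\<lambda>p. (vel Tm Tp r (fst p) \<bullet> unit_normal r (R n) p) *\<^sub>R P' n p)) t
            + time_int t0 (ball_int r (R n) (tensor_divergence (S n) (T' n))) t
            - time_int t0 (ball_int r (R n) (f' n)) t)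
       + time_int t0 ?F t = p n t - p n t0 - time_int t0 ?G t"
      unfolding F unfolding p_def S_def
      by (subst moving_ball.momentum_balance[OF mb PC[unfolded S_def] C1'(3)[unfolded S_def] TC[unfolded S_def]
            C1'(4)[unfolded S_def] fc[unfolded S_def] t0 t law2[unfolded S_def], symmetric])
        (assumption, rule telescope)
  qed

  have x_near: "norm (x n t - r t) \<le> R n" if "n0 \<le> n" "t \<in> {Tm..Tp}" for n t
    unfolding x_def
  proof (rule moving_ball.charge_center_near[OF mb])
    show "continuous_on (tube Tm Tp r (R n)) (\<rho> n)" using C1_on_continuous[OF \<rho>C[of n]] by (simp add: S_def)
    show "0 \<le> \<rho> n p" for p using pos by (simp add: \<rho>_def charge_density_eq)
  qed (use \<rho>b_pos[OF that] that in \<open>simp_all add: \<rho>b_def\<close>)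
  have x_lim: "unull {Tm..Tp} (\<lambda>n t. x n t - r t)"
  proof (rule unull_le[OF unull_const[OF R0], where K = 1])
    show "\<forall>\<^sub>F n in sequentially. \<forall>t\<in>{Tm..Tp}. norm (x n t - r t) \<le> 1 * norm (R n)"
      using late by eventually_elim (use x_near R in \<open>auto simp: less_imp_le\<close>)
  qed

  have center: "continuous_on {Tm..Tp} (vel Tm Tp (x n))"
      "t \<in> {Tm..Tp} \<Longrightarrow> (x n has_vector_derivative vel Tm Tp (x n) t) (at t within {Tm..Tp})"
      "t \<in> {Tm..Tp} \<Longrightarrow> \<rho>b n t *\<^sub>R vel Tm Tp (x n) t = ball_int r (R n) (J n) t
        - bdry_int r (R n) (\<lambda>p. (unit_normal r (R n) p \<bullet> J n p) *\<^sub>R (snd p - x n (fst p))) t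
        - (- bdry_int r (R n) (\<lambda>p. (vel Tm Tp r (fst p) \<bullet> unit_normal r (R n) p * \<rho> n p) *\<^sub>R (snd p - x n (fst p))) t)
        - (ball_int r (R n) (dt (S n) (\<lambda>p. \<rho>' n p *\<^sub>R (snd p - x n (fst p)))) t
            + ball_int r (R n) (\<rho>' n) t *\<^sub>R vel Tm Tp (x n) t
            + bdry_int r (R n) (\<lambda>p. (unit_normal r (R n) p \<bullet> J' n p) *\<^sub>R (snd p - x n (fst p))) t
            - ball_int r (R n) (J' n) t)" (is "_ \<Longrightarrow> ?velocity")
    if n: "n0 \<le> n" for n t
  proof -
    have pos': "\<And>t. t \<in> {Tm..Tp} \<Longrightarrow> 0 < ball_int r (R n) (\<rho> n) t"
      using \<rho>b_pos[OF n] by (simp add: \<rho>b_def)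
    note motion = moving_ball.charge_center_motion[OF mb \<rho>C[unfolded S_def] C1'(1)[unfolded S_def] JC[unfolded S_def]
      C1'(2)[unfolded S_def] pos' law1[unfolded S_def]]
    show "continuous_on {Tm..Tp} (vel Tm Tp (x n))"
      unfolding x_def by (rule motion(1))
    show "(x n has_vector_derivative vel Tm Tp (x n) t) (at t within {Tm..Tp})" if "t \<in> {Tm..Tp}"
      unfolding x_def by (rule motion(2)) (use that in simp_all)
    show ?velocity if "t \<in> {Tm..Tp}"
      unfolding x_def \<rho>b_def S_def by (rule motion(3)) (use that in simp_all)
  qed
  have vel_lim: "unull {Tm..Tp} (\<lambda>n t. \<rho>b n t *\<^sub>R vel Tm Tp (x n) t - (q / m) *\<^sub>R p n t)"
    using unull_linear[OF bounded_linear_minus[OF bounded_linear_ident] unull_add[OF unull_add[OF Q22 Q20] Q2']]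
  proof (rule unull_cong)
    show "\<forall>\<^sub>F n in sequentially. \<forall>t\<in>{Tm..Tp}.
        - (bdry_int r (R n) (\<lambda>p. (unit_normal r (R n) p \<bullet> J n p) *\<^sub>R (snd p - x n (fst p))) t
         + - bdry_int r (R n) (\<lambda>p. (vel Tm Tp r (fst p) \<bullet> unit_normal r (R n) p * \<rho> n p) *\<^sub>R (snd p - x n (fst p))) t
         + (ball_int r (R n) (dt (S n) (\<lambda>p. \<rho>' n p *\<^sub>R (snd p - x n (fst p)))) t
            + ball_int r (R n) (\<rho>' n) t *\<^sub>R vel Tm Tp (x n) t
            + bdry_int r (R n) (\<lambda>p. (unit_normal r (R n) p \<bullet> J' n p) *\<^sub>R (snd p - x n (fst p))) t
            - ball_int r (R n) (J' n) t))
        = \<rho>b n t *\<^sub>R vel Tm Tp (x n) t - (q / m) *\<^sub>R p n t"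
      (is "\<forall>\<^sub>F n in _. \<forall>t\<in>_. ?lhs n t = ?rhs n t")
    proof (rule eventually_mono[OF late], rule ballI)
      fix n t assume n: "n0 \<le> n" and t: "t \<in> {Tm..Tp}"
      have "ball_int r (R n) (J n) t = ball_int r (R n) (\<lambda>y. (q / m) *\<^sub>R P n y) t"
        using pos by (simp add: J_def P_def ball_int_def current_eq_momentum)
      also have "\<dots> = (q / m) *\<^sub>R p n t"
        unfolding p_def using C1_on_continuous[OF PC[of n]]
        by (intro moving_ball.ball_int_linear[OF mb] bounded_linear_scaleR_right t) (simp add: S_def)
      finally have Jp: "ball_int r (R n) (J n) t = (q / m) *\<^sub>R p n t" .
      show "?lhs n t = ?rhs n t"
        unfolding center(3)[OF n t] Jp by (simp add: algebra_simps)
    qed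
  qed

  have v_der: "(vel Tm Tp r has_vector_derivative acc Tm Tp r t) (at t within {Tm..Tp})" if "t \<in> {Tm..Tp}" for t
    using traj that unfolding trajectory_def acc_def differentiable_on_def
    by (auto simp: vector_derivative_works[symmetric])
  have "m *\<^sub>R acc Tm Tp r t = q *\<^sub>R E t + (q / c) *\<^sub>R cross3 (vel Tm Tp r t) (B t)"
  proof (rule newton_limit[OF T t0 pos(1,2,4) \<rho>inf \<rho>_lim C x_lim _ _ vel_lim mom \<rho>b_cont p_cont E_cont
        B_der B'_cont moving_ball.vel_deriv[OF mb] v_der t])
    show "\<forall>\<^sub>F n in sequentially. \<forall>t\<in>{Tm..Tp}. (x n has_vector_derivative vel Tm Tp (x n) t) (at t within {Tm..Tp})"
      using late by eventually_elim (use center(2) in blast)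
    show "\<forall>\<^sub>F n in sequentially. continuous_on {Tm..Tp} (vel Tm Tp (x n))"
      using late by eventually_elim (rule center(1))
  qed
  then show ?thesis by (simp add: E_def B_def)
qed

end

theorem theorem6:
  fixes m q chi c Tm Tp :: real
    and G1 G1' :: "real \<Rightarrow> real"
    and D :: "spacetime set"
    and \<phi> :: "spacetime \<Rightarrow> real"
    and A :: "spacetime \<Rightarrow> real^3"
    and r :: "real \<Rightarrow> real^3"
    and \<psi> :: "nat \<Rightarrow> spacetime \<Rightarrow> complex"
  assumes "m > 0" "q > 0" "chi > 0" "c > 0"
    and "Tm < Tp"
    and "open D" "connected D"
    and "C2_on D \<phi>" "C2_on D A"
    and "trajectory Tm Tp r"
    and "\<forall>t\<in>{Tm..Tp}. (t, r t) \<in> D"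
    and "nls.asymptotic_solutions_concentrate m q chi c G1 G1' Tm Tp r
           (linear_part D r \<phi>) (linear_part D r A) \<psi>"
  shows "\<forall>t\<in>{Tm..Tp}.
           m *\<^sub>R acc Tm Tp r t =
             q *\<^sub>R nls.Efield c D \<phi> A (t, r t) +
             (q / c) *\<^sub>R cross3 (vel Tm Tp r t) (nls.Bfield D A (t, r t))"
  using nls.concentration_newton[OF assms(1-5,8-10) _ assms(12)] assms(11) by blast

end
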